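(* Suppose that $\Gamma$ and $H$ are weakly sofic groups, that $\Gamma\curvearrowright_{\alpha}X$ is a sofic action on the set $X$, and that $\Gamma\curvearrowright_{\beta}Y$ is a sofic action on the graph $Y$. Then: (a) the restricted permutational wreath product $H\wr_{\alpha}\Gamma$ is weakly sofic; (b) if it is true that for every set $V$ and every family $\{\Gamma_v:v\in V\}$ of weakly sofic groups the free product $\ast_{v\in V}\Gamma_v$ is weakly sofic, then the free wreath product $H\wr_{\alpha}^{\ast}\Gamma$ is weakly sofic; (c) if it is true that for every set $V$, every family $\{\Gamma_v:v\in V\}$ of weakly sofic groups and every graph with vertex set $V$, the graph product of the $\Gamma_v$ over this graph is weakly sofic, then the graph wreath product $\mathcal{W}(\Gamma,H,Y)$ is weakly sofic.
   Context: Graph products. For a graph $X=(V,E)$ and groups $(\Gamma_v)_{v\in V}$, the graph product is $(\ast_{v\in V}\Gamma_v)/\langle\langle h^{-1}k^{-1}hk:(v,w)\in E,\ h\in\Gamma_v,\ k\in\Gamma_w\rangle\rangle$; it is denoted $P(H,X)$ when every $\Gamma_v$ is a copy $H_v$ of a single group $H$. An action $\Gamma\curvearrowright_\alpha X$ by graph automorphisms induces an action $\hat\alpha$ on $P(H,X)$ by automorphisms, where $g$ sends $H_v$ identically to $H_{\alpha(g)v}$; the graph wreath product is $\mathcal{W}(\Gamma,H,X)=P(H,X)\rtimes_{\hat\alpha}\Gamma$. For an action on a set $X$: $H\wr_\alpha\Gamma=(\bigoplus_XH)\rtimes\Gamma$ (the case of the complete graph on $X$) and $H\wr_\alpha^\ast\Gamma=(\ast_XH)\rtimes\Gamma$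 (the case of the graph on $X$ with no edges), with $\Gamma$ permuting the copies of $H$. Weakly sofic groups. A group $\Gamma$ is weakly sofic if there is $c>0$ such that for every finite $F\subseteq\Gamma$ and $\epsilon>0$ there are a finite group $G$ with a bi-invariant metric $d$ of diameter one and a function $\varphi:\Gamma\to G$ with $\varphi(e)=e$; $d(\varphi(gh),\varphi(g)\varphi(h))<\epsilon$ for all $g,h\in F$ with $gh\in F$; and $d(\varphi(g),e)>c$ for all $e\neq g\in F$. Sofic actions on sets and graphs. For a finite set $A$, $d_A(\sigma,\tau)=1-\frac{1}{|A|}|\{a\in A:\sigma(a)=\tau(a)\}|$ on $\operatorname{Sym}(A)$. A function $\varphi:\Gamma\to\operatorname{Sym}(A)$ is unital if $\varphi(e)=e$ and $(F,\epsilon)$-multiplicative if $d_A(\varphi(gh),\varphi(g)\varphi(h))<\epsilon$ for all $g,h\in F$ with $gh\in F$. Given $\Gamma\curvearrowright_\alpha X$ on a set, finite $F\subseteq\Gamma$, $E\subseteq X$, and $\epsilon>0$, $\varphi$ is an $(F,E,\epsilon)$-orbit approximation of $\alpha$ if there exist a finite set $B$, $S\subseteq A$ with $|S|>(1-\epsilon)|A|$, and injective functions $(\pi_s:E\hookrightarrow B)_{s\in S}$ such that for all $g\in F$, $x\in E$, $s\in S$, if $\varphi(g)\cdot s\in S$ and $\alpha(g)^{-1}\cdot x\in E$ then $\pi_{\varphi(g)\cdot s}(x)=\pi_s(\alpha(g)^{-1}\cdot x)$. The action is sofic if for all such $F,E,\epsilon$ there exist a finite set $A$ and a unital $(F,\epsilon)$-multiplicative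 $(F,E,\epsilon)$-orbit approximation $\varphi:\Gamma\to\operatorname{Sym}(A)$. For actions on graphs by automorphisms the definition is the same, with $E$ a finite induced subgraph of $X$, $B$ a finite graph, and the $\pi_s$ inclusions of induced subgraphs (injective vertex maps preserving adjacency and non-adjacency). *)

theory Defs
  imports "HOL-Algebra.Group_Action" "HOL-Algebra.Product_Groups" "HOL-Analysis.Abstract_Metric_Spaces"
begin

section \<open>Free products and graph products of groups\<close>

text \<open>A word over the family \<open>\<Gamma>\<close> is a list of letters \<open>(v, g)\<close> with \<open>g\<close> an element of
  \<open>\<Gamma> v\<close>. The free product consists of the words modulo the congruence for concatenation
  generated by deleting trivial letters and multiplying adjacent letters of the same factor.\<close>

definition fp_words :: "'v set \<Rightarrow> ('v \<Rightarrow> ('a, 'c) monoid_scheme) \<Rightarrow> ('v \<times> 'a) list set" where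
  "fp_words V \<Gamma> = lists (SIGMA v:V. carrier (\<Gamma> v))"

inductive fp_eq ::
  "'v set \<Rightarrow> ('v \<Rightarrow> ('a, 'c) monoid_scheme) \<Rightarrow> ('v \<times> 'a) list \<Rightarrow> ('v \<times> 'a) list \<Rightarrow> bool"
  for V \<Gamma> where
  fp_eq_refl: "w \<in> fp_words V \<Gamma> \<Longrightarrow> fp_eq V \<Gamma> w w"
| fp_eq_sym: "fp_eq V \<Gamma> u w \<Longrightarrow> fp_eq V \<Gamma> w u"
| fp_eq_trans: "fp_eq V \<Gamma> u v \<Longrightarrow> fp_eq V \<Gamma> v w \<Longrightarrow> fp_eq V \<Gamma> u w"
| fp_eq_trivial: "u \<in> fp_words V \<Gamma> \<Longrightarrow> w \<in> fp_words V \<Gamma> \<Longrightarrow> v \<in> V \<Longrightarrow>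
    fp_eq V \<Gamma> (u @ [(v, \<one>\<^bsub>\<Gamma> v\<^esub>)] @ w) (u @ w)"
| fp_eq_mult: "u \<in> fp_words V \<Gamma> \<Longrightarrow> w \<in> fp_words V \<Gamma> \<Longrightarrow> v \<in> V \<Longrightarrow>
    g \<in> carrier (\<Gamma> v) \<Longrightarrow> h \<in> carrier (\<Gamma> v) \<Longrightarrow>
    fp_eq V \<Gamma> (u @ [(v, g), (v, h)] @ w) (u @ [(v, g \<otimes>\<^bsub>\<Gamma> v\<^esub> h)] @ w)"

definition fp_rel ::
  "'v set \<Rightarrow> ('v \<Rightarrow> ('a, 'c) monoid_scheme) \<Rightarrow> (('v \<times> 'a) list \<times> ('v \<times> 'a) list) set" where
  "fp_rel V \<Gamma> = {(u, w). fp_eq V \<Gamma> u w}"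

definition free_product ::
  "'v set \<Rightarrow> ('v \<Rightarrow> ('a, 'c) monoid_scheme) \<Rightarrow> ('v \<times> 'a) list set monoid" where
  "free_product V \<Gamma> =
    \<lparr>carrier = fp_words V \<Gamma> // fp_rel V \<Gamma>,
     monoid.mult = (\<lambda>C D. \<Union>c\<in>C. \<Union>d\<in>D. fp_rel V \<Gamma> `` {c @ d}),
     one = fp_rel V \<Gamma> `` {[]}\<rparr>"

definition fp_incl ::
  "'v set \<Rightarrow> ('v \<Rightarrow> ('a, 'c) monoid_scheme) \<Rightarrow> 'v \<Rightarrow> 'a \<Rightarrow> ('v \<times> 'a) list set" where
  "fp_incl V \<Gamma> v g = fp_rel V \<Gamma> `` {[(v, g)]}"

definition normal_closure :: "('a, 'c) monoid_scheme \<Rightarrow> 'a set \<Rightarrow> 'a set" where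
  "normal_closure G R = \<Inter>{N. N \<lhd> G \<and> R \<subseteq> N}"

definition simple_graph :: "'v set \<Rightarrow> ('v \<times> 'v) set \<Rightarrow> bool" where
  "simple_graph V E \<longleftrightarrow> E \<subseteq> V \<times> V \<and> Relation.sym E \<and> irrefl E"

definition graph_relators ::
  "'v set \<Rightarrow> ('v \<times> 'v) set \<Rightarrow> ('v \<Rightarrow> ('a, 'c) monoid_scheme) \<Rightarrow> ('v \<times> 'a) list set set" where
  "graph_relators V E \<Gamma> =
    {inv\<^bsub>free_product V \<Gamma>\<^esub> (fp_incl V \<Gamma> v h) \<otimes>\<^bsub>free_product V \<Gamma>\<^esub>
     inv\<^bsub>free_product V \<Gamma>\<^esub> (fp_incl V \<Gamma> w k) \<otimes>\<^bsub>free_product V \<Gamma>\<^esub>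
     fp_incl V \<Gamma> v h \<otimes>\<^bsub>free_product V \<Gamma>\<^esub> fp_incl V \<Gamma> w k
     | v w h k. (v, w) \<in> E \<and> h \<in> carrier (\<Gamma> v) \<and> k \<in> carrier (\<Gamma> w)}"

definition graph_product ::
  "'v set \<Rightarrow> ('v \<times> 'v) set \<Rightarrow> ('v \<Rightarrow> ('a, 'c) monoid_scheme) \<Rightarrow> ('v \<times> 'a) list set set monoid" where
  "graph_product V E \<Gamma> =
    free_product V \<Gamma> Mod normal_closure (free_product V \<Gamma>) (graph_relators V E \<Gamma>)"


section \<open>Wreath products\<close>

definition semidirect ::
  "('n, 'c) monoid_scheme \<Rightarrow> ('k, 'd) monoid_scheme \<Rightarrow> ('k \<Rightarrow> 'n \<Rightarrow> 'n) \<Rightarrow> ('n \<times> 'k) monoid" where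
  "semidirect N K \<theta> =
    \<lparr>carrier = carrier N \<times> carrier K,
     monoid.mult = (\<lambda>(m, k) (n, l). (m \<otimes>\<^bsub>N\<^esub> \<theta> k n, k \<otimes>\<^bsub>K\<^esub> l)),
     one = (\<one>\<^bsub>N\<^esub>, \<one>\<^bsub>K\<^esub>)\<rparr>"

text \<open>The element of the direct sum with entry \<open>h\<close> at \<open>x\<close> is sent by \<open>g\<close> to the one with
  entry \<open>h\<close> at \<open>\<alpha> g x\<close>.\<close>

definition sum_perm :: "'x set \<Rightarrow> ('g \<Rightarrow> 'x \<Rightarrow> 'x) \<Rightarrow> 'g \<Rightarrow> ('x \<Rightarrow> 'h) \<Rightarrow> 'x \<Rightarrow> 'h" where
  "sum_perm X \<alpha> g f = (\<lambda>x\<in>X. f ((inv\<^bsub>BijGroup X\<^esub> (\<alpha> g)) x))"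

definition wreath ::
  "('h, 'c) monoid_scheme \<Rightarrow> ('g, 'd) monoid_scheme \<Rightarrow> 'x set \<Rightarrow> ('g \<Rightarrow> 'x \<Rightarrow> 'x) \<Rightarrow>
    (('x \<Rightarrow> 'h) \<times> 'g) monoid" where
  "wreath H \<Gamma> X \<alpha> = semidirect (sum_group X (\<lambda>_. H)) \<Gamma> (sum_perm X \<alpha>)"

text \<open>Elements of the free product are sets of words (congruence classes), and relabelling all
  words of a class by the bijection \<open>\<alpha> g\<close> again gives a class. Elements of the graph product
  are cosets, i.e. sets of such classes, and are relabelled elementwise.\<close>

definition fp_perm :: "('g \<Rightarrow> 'x \<Rightarrow> 'x) \<Rightarrow> 'g \<Rightarrow> ('x \<times> 'h) list set \<Rightarrow> ('x \<times> 'h) list set" where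
  "fp_perm \<alpha> g C = map (\<lambda>(x, h). (\<alpha> g x, h)) ` C"

definition gp_perm :: "('g \<Rightarrow> 'x \<Rightarrow> 'x) \<Rightarrow> 'g \<Rightarrow> ('x \<times> 'h) list set set \<Rightarrow> ('x \<times> 'h) list set set"
  where "gp_perm \<alpha> g K = fp_perm \<alpha> g ` K"

definition free_wreath ::
  "('h, 'c) monoid_scheme \<Rightarrow> ('g, 'd) monoid_scheme \<Rightarrow> 'x set \<Rightarrow> ('g \<Rightarrow> 'x \<Rightarrow> 'x) \<Rightarrow>
    (('x \<times> 'h) list set \<times> 'g) monoid" where
  "free_wreath H \<Gamma> X \<alpha> = semidirect (free_product X (\<lambda>_. H)) \<Gamma> (fp_perm \<alpha>)"

definition graph_wreath ::
  "('g, 'd) monoid_scheme \<Rightarrow> ('h, 'c) monoid_scheme \<Rightarrow> 'x set \<Rightarrow> ('x \<times> 'x) set \<Rightarrow>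
    ('g \<Rightarrow> 'x \<Rightarrow> 'x) \<Rightarrow> (('x \<times> 'h) list set set \<times> 'g) monoid" where
  "graph_wreath \<Gamma> H X E \<alpha> = semidirect (graph_product X E (\<lambda>_. H)) \<Gamma> (gp_perm \<alpha>)"


section \<open>Weakly sofic groups\<close>

definition biinvariant_metric ::
  "('a, 'c) monoid_scheme \<Rightarrow> ('a \<Rightarrow> 'a \<Rightarrow> real) \<Rightarrow> bool" where
  "biinvariant_metric G d \<longleftrightarrow> Metric_space (carrier G) d \<and>
    (\<forall>k\<in>carrier G. \<forall>x\<in>carrier G. \<forall>y\<in>carrier G.
      d (k \<otimes>\<^bsub>G\<^esub> x) (k \<otimes>\<^bsub>G\<^esub> y) = d x y \<and> d (x \<otimes>\<^bsub>G\<^esub> k) (y \<otimes>\<^bsub>G\<^esub> k) = d x y)"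

text \<open>Finite groups, finite sets and finite graphs are considered only up to isomorphism, so
  wherever one is asserted to exist below its elements are taken to be natural numbers.\<close>

definition weakly_sofic :: "('g, 'c) monoid_scheme \<Rightarrow> bool" where
  "weakly_sofic \<Gamma> \<longleftrightarrow> group \<Gamma> \<and>
    (\<exists>c>0. \<forall>F \<epsilon>. finite F \<and> F \<subseteq> carrier \<Gamma> \<and> \<epsilon> > 0 \<longrightarrow>
      (\<exists>(G :: nat monoid) d \<phi>. group G \<and> finite (carrier G) \<and> biinvariant_metric G d \<and>
        (SUP (x, y) \<in> carrier G \<times> carrier G. d x y) = 1 \<and>
        \<phi> \<in> carrier \<Gamma> \<rightarrow> carrier G \<and> \<phi> \<one>\<^bsub>\<Gamma>\<^esub> = \<one>\<^bsub>G\<^esub> \<and>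
        (\<forall>g\<in>F. \<forall>h\<in>F. g \<otimes>\<^bsub>\<Gamma>\<^esub> h \<in> F \<longrightarrow> d (\<phi> (g \<otimes>\<^bsub>\<Gamma>\<^esub> h)) (\<phi> g \<otimes>\<^bsub>G\<^esub> \<phi> h) < \<epsilon>) \<and>
        (\<forall>g\<in>F. g \<noteq> \<one>\<^bsub>\<Gamma>\<^esub> \<longrightarrow> d (\<phi> g) \<one>\<^bsub>G\<^esub> > c)))"


section \<open>Sofic actions\<close>

definition hamming :: "'a set \<Rightarrow> ('a \<Rightarrow> 'a) \<Rightarrow> ('a \<Rightarrow> 'a) \<Rightarrow> real" where
  "hamming A \<sigma> \<tau> = 1 - real (card {a \<in> A. \<sigma> a = \<tau> a}) / real (card A)"

definition unital_multiplicative ::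
  "('g, 'c) monoid_scheme \<Rightarrow> 'g set \<Rightarrow> real \<Rightarrow> 'a set \<Rightarrow> ('g \<Rightarrow> 'a \<Rightarrow> 'a) \<Rightarrow> bool" where
  "unital_multiplicative \<Gamma> F \<epsilon> A \<phi> \<longleftrightarrow>
    \<phi> \<in> carrier \<Gamma> \<rightarrow> carrier (BijGroup A) \<and> \<phi> \<one>\<^bsub>\<Gamma>\<^esub> = \<one>\<^bsub>BijGroup A\<^esub> \<and>
    (\<forall>g\<in>F. \<forall>h\<in>F. g \<otimes>\<^bsub>\<Gamma>\<^esub> h \<in> F \<longrightarrow>
      hamming A (\<phi> (g \<otimes>\<^bsub>\<Gamma>\<^esub> h)) (\<phi> g \<otimes>\<^bsub>BijGroup A\<^esub> \<phi> h) < \<epsilon>)"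

definition orbit_compatible ::
  "'x set \<Rightarrow> ('g \<Rightarrow> 'x \<Rightarrow> 'x) \<Rightarrow> 'g set \<Rightarrow> 'x set \<Rightarrow> ('g \<Rightarrow> 'a \<Rightarrow> 'a) \<Rightarrow> 'a set \<Rightarrow>
    ('a \<Rightarrow> 'x \<Rightarrow> 'b) \<Rightarrow> bool" where
  "orbit_compatible X \<alpha> F E \<phi> S \<pi> \<longleftrightarrow>
    (\<forall>g\<in>F. \<forall>x\<in>E. \<forall>s\<in>S. \<phi> g s \<in> S \<and> (inv\<^bsub>BijGroup X\<^esub> (\<alpha> g)) x \<in> E \<longrightarrow>
      \<pi> (\<phi> g s) x = \<pi> s ((inv\<^bsub>BijGroup X\<^esub> (\<alpha> g)) x))"

definition orbit_approx ::
  "'x set \<Rightarrow> ('g \<Rightarrow> 'x \<Rightarrow> 'x) \<Rightarrow> 'g set \<Rightarrow> 'x set \<Rightarrow> real \<Rightarrow> 'a set \<Rightarrow> ('g \<Rightarrow> 'a \<Rightarrow> 'a) \<Rightarrow> bool" where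
  "orbit_approx X \<alpha> F E \<epsilon> A \<phi> \<longleftrightarrow>
    (\<exists>(B :: nat set) S \<pi>. finite B \<and> S \<subseteq> A \<and> real (card S) > (1 - \<epsilon>) * real (card A) \<and>
      (\<forall>s\<in>S. \<pi> s \<in> E \<rightarrow> B \<and> inj_on (\<pi> s) E) \<and>
      orbit_compatible X \<alpha> F E \<phi> S \<pi>)"

definition sofic_action ::
  "('g, 'c) monoid_scheme \<Rightarrow> 'x set \<Rightarrow> ('g \<Rightarrow> 'x \<Rightarrow> 'x) \<Rightarrow> bool" where
  "sofic_action \<Gamma> X \<alpha> \<longleftrightarrow> group_action \<Gamma> X \<alpha> \<and>
    (\<forall>F E \<epsilon>. finite F \<and> F \<subseteq> carrier \<Gamma> \<and> finite E \<and> E \<subseteq> X \<and> \<epsilon> > 0 \<longrightarrow>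
      (\<exists>(A :: nat set) \<phi>. finite A \<and> unital_multiplicative \<Gamma> F \<epsilon> A \<phi> \<and>
        orbit_approx X \<alpha> F E \<epsilon> A \<phi>))"

definition graph_action ::
  "('g, 'c) monoid_scheme \<Rightarrow> 'x set \<Rightarrow> ('x \<times> 'x) set \<Rightarrow> ('g \<Rightarrow> 'x \<Rightarrow> 'x) \<Rightarrow> bool" where
  "graph_action \<Gamma> X D \<alpha> \<longleftrightarrow> simple_graph X D \<and> group_action \<Gamma> X \<alpha> \<and>
    (\<forall>g\<in>carrier \<Gamma>. \<forall>x\<in>X. \<forall>y\<in>X. (\<alpha> g x, \<alpha> g y) \<in> D \<longleftrightarrow> (x, y) \<in> D)"

text \<open>The finite induced subgraph is given by its vertex set \<open>E\<close>.\<close>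

definition graph_orbit_approx ::
  "'x set \<Rightarrow> ('x \<times> 'x) set \<Rightarrow> ('g \<Rightarrow> 'x \<Rightarrow> 'x) \<Rightarrow> 'g set \<Rightarrow> 'x set \<Rightarrow> real \<Rightarrow> 'a set \<Rightarrow>
    ('g \<Rightarrow> 'a \<Rightarrow> 'a) \<Rightarrow> bool" where
  "graph_orbit_approx X D \<alpha> F E \<epsilon> A \<phi> \<longleftrightarrow>
    (\<exists>(B :: nat set) DB S \<pi>. finite B \<and> simple_graph B DB \<and>
      S \<subseteq> A \<and> real (card S) > (1 - \<epsilon>) * real (card A) \<and>
      (\<forall>s\<in>S. \<pi> s \<in> E \<rightarrow> B \<and> inj_on (\<pi> s) E \<and>
        (\<forall>x\<in>E. \<forall>y\<in>E. (\<pi> s x, \<pi> s y) \<in> DB \<longleftrightarrow> (x, y) \<in> D)) \<and>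
      orbit_compatible X \<alpha> F E \<phi> S \<pi>)"

definition sofic_graph_action ::
  "('g, 'c) monoid_scheme \<Rightarrow> 'x set \<Rightarrow> ('x \<times> 'x) set \<Rightarrow> ('g \<Rightarrow> 'x \<Rightarrow> 'x) \<Rightarrow> bool" where
  "sofic_graph_action \<Gamma> X D \<alpha> \<longleftrightarrow> graph_action \<Gamma> X D \<alpha> \<and>
    (\<forall>F E \<epsilon>. finite F \<and> F \<subseteq> carrier \<Gamma> \<and> finite E \<and> E \<subseteq> X \<and> \<epsilon> > 0 \<longrightarrow>
      (\<exists>(A :: nat set) \<phi>. finite A \<and> unital_multiplicative \<Gamma> F \<epsilon> A \<phi> \<and>
        graph_orbit_approx X D \<alpha> F E \<epsilon> A \<phi>))"

end

theory Submission
  imports Defs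
begin

text \<open>Let \<open>N\<close> be the direct sum, free product or graph product of copies of \<open>H\<close>. A sofic
  approximation of the action provides a finite set \<open>A\<close>, almost an action of \<open>\<Gamma>\<close> on \<open>A\<close>, and for most
  \<open>s \<in> A\<close> an embedding of a large finite piece of the vertex set into one finite \<open>B\<close>. Each embedding
  induces a homomorphism \<open>p\<^sub>s\<close> from \<open>N\<close> to the analogous group \<open>M\<close> over \<open>B\<close>, with a left inverse on the
  subgroup supported on that piece, and \<open>p\<close> is almost equivariant. If \<open>\<psi>\<close> models the weakly sofic
  group \<open>M\<close> in a finite group \<open>G\<close>, then \<open>(n, g) \<mapsto> ((\<psi> (p\<^sub>s n))\<^sub>s, \<phi> g)\<close> models the semidirect product in
  \<open>G \<wr> Sym A\<close>, with the length that counts a moved point as 1 and averages the length in \<open>G\<close> over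
  the fixed points. Elements with \<open>g \<noteq> 1\<close> are separated by an extra factor modelling \<open>\<Gamma>\<close>. The separation
  constant of \<open>M\<close> does not depend on \<open>B\<close>, since metrics can be rescaled and truncated at 1.\<close>

section \<open>Length functions and models of weakly sofic groups\<close>

text \<open>The map \<open>\<phi>\<close> of a sofic action is almost multiplicative but need not
  separate anything: for a trivial action every \<open>\<phi> g\<close> may be the identity. Hence
  the factor that models \<open>\<Gamma>\<close> itself. It matters that \<open>B\<close> is the
  same for all \<open>s\<close>: a product in the wreath product combines the coordinate at
  \<open>\<phi> g s\<close> with the one at \<open>s\<close>, so all \<open>p\<^sub>s\<close> must
  take values in one group \<open>M\<close> with one model \<open>G\<close>. A partial embedding of
  vertices becomes a homomorphism on all of \<open>N\<close> by killing the generators outside the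
  finite piece. This destroys injectivity in general, but the finitely many given elements live over
  the piece. For graphs, the map back respects the commutation relations because embeddings preserve
  non-adjacency as well. Bi-invariant metrics are handled through the distance to the identity,
  where invariance reads \<open>l (x y) = l (y x)\<close>. Zeros off the identity are allowed, so
  that sums and pullbacks along projections remain length functions; positivity is restored once, in
  \<open>weakly_soficI\<close>.\<close>

definition length_function :: "('a, 'c) monoid_scheme \<Rightarrow> ('a \<Rightarrow> real) \<Rightarrow> bool" where
  "length_function G l \<longleftrightarrow> l \<one>\<^bsub>G\<^esub> = 0 \<and> (\<forall>x\<in>carrier G. 0 \<le> l x \<and> l (inv\<^bsub>G\<^esub> x) = l x) \<and>
    (\<forall>x\<in>carrier G. \<forall>y\<in>carrier G.
      l (x \<otimes>\<^bsub>G\<^esub> y) \<le> l x + l y \<and> l (x \<otimes>\<^bsub>G\<^esub> y) = l (y \<otimes>\<^bsub>G\<^esub> x))"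

lemma length_functionD:
  assumes "length_function G l"
  shows "l \<one>\<^bsub>G\<^esub> = 0"
    and "x \<in> carrier G \<Longrightarrow> 0 \<le> l x"
    and "x \<in> carrier G \<Longrightarrow> l (inv\<^bsub>G\<^esub> x) = l x"
    and "x \<in> carrier G \<Longrightarrow> y \<in> carrier G \<Longrightarrow> l (x \<otimes>\<^bsub>G\<^esub> y) \<le> l x + l y"
    and "x \<in> carrier G \<Longrightarrow> y \<in> carrier G \<Longrightarrow> l (x \<otimes>\<^bsub>G\<^esub> y) = l (y \<otimes>\<^bsub>G\<^esub> x)"
  using assms by (auto simp: length_function_def)

lemma length_function_add:
  "length_function G l \<Longrightarrow> length_function G l' \<Longrightarrow> length_function G (\<lambda>x. l x + l' x)"
  by (fastforce simp: length_function_def)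

lemma length_function_scale:
  "length_function G l \<Longrightarrow> 0 \<le> c \<Longrightarrow> length_function G (\<lambda>x. c * l x)"
  by (auto simp: length_function_def mult_left_mono simp flip: distrib_left)

lemma length_function_min_one:
  "length_function G l \<Longrightarrow> length_function G (\<lambda>x. min 1 (l x))"
  by (fastforce simp: length_function_def min_def)

lemma length_function_comp:
  assumes "length_function K l" "f \<in> hom G K" "group G" "group K"
  shows "length_function G (\<lambda>x. l (f x))"
proof -
  interpret group_hom G K f
    using assms by (simp add: group_hom_def group_hom_axioms_def)
  show ?thesis
    using assms(1) by (auto simp: length_function_def)
qed

lemma length_function_discrete:
  fixes G (structure)
  assumes "group G" "0 \<le> c"
  shows "length_function G (\<lambda>x. if x = \<one>\<^bsub>G\<^esub> then 0 else c)"
proof -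
  interpret group G by fact
  have "x \<otimes> y = \<one> \<longleftrightarrow> y \<otimes> x = \<one>" if "x \<in> carrier G" "y \<in> carrier G" for x y
    using that by (metis inv_comm)
  then show ?thesis
    using assms(2) by (auto simp: length_function_def inv_eq_1_iff)
qed

text \<open>Transport of structure. It moves finite models to \<open>nat\<close>, where
  \<open>weakly_sofic\<close> wants them, and \<open>H\<close> to the type over which the hypotheses
  on free and graph products range.\<close>

lemma group_copy:
  fixes G (structure)
  assumes "group G" "inj_on e (carrier G)"
  obtains G' :: "'b monoid" where "group G'" "carrier G' = e ` carrier G" "e \<in> iso G G'"
proof -
  interpret group G by fact
  define d where "d = inv_into (carrier G) e"
  have d [simp]: "d (e x) = x" if "x \<in> carrier G" for x
    using assms(2) that by (simp add: d_def)
  define G' where "G' = \<lparr>carrier = e ` carrier G, monoid.mult = (\<lambda>a b. e (d a \<otimes> d b)), one = e \<one>\<rparr>"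
  have "group G'"
    by (rule groupI) (auto simp: G'_def m_assoc intro!: imageI, metis d inv_closed l_inv)
  moreover have "e \<in> iso G G'"
    using assms(2) by (auto simp: iso_def hom_def G'_def bij_betw_def)
  ultimately show ?thesis
    by (intro that[of G']) (auto simp: G'_def)
qed

text \<open>Left invariance is cancellation; right invariance is where
  \<open>l (x y) = l (y x)\<close> enters. The value 0 off the carrier is there because
  \<open>Metric_space\<close> asks for nonnegativity and symmetry at all arguments of the
  type.\<close>

lemma biinvariant_metric_of_length:
  fixes G (structure)
  assumes "group G" "length_function G l" "\<And>x. x \<in> carrier G \<Longrightarrow> l x = 0 \<Longrightarrow> x = \<one>\<^bsub>G\<^esub>"
  shows "biinvariant_metric G
    (\<lambda>x y. if x \<in> carrier G \<and> y \<in> carrier G then l (inv\<^bsub>G\<^esub> x \<otimes>\<^bsub>G\<^esub> y) else 0)"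
proof -
  interpret group G by fact
  note l = length_functionD[OF assms(2)]
  have sym: "l (inv x \<otimes> y) = l (inv y \<otimes> x)" if "x \<in> carrier G" "y \<in> carrier G" for x y
    using l(3)[of "inv x \<otimes> y"] that by (simp add: inv_mult_group)
  have zero: "l (inv x \<otimes> y) = 0 \<longleftrightarrow> x = y" if "x \<in> carrier G" "y \<in> carrier G" for x y
    using that assms(3)[of "inv x \<otimes> y"] l(1) by (metis inv_closed inv_equality inv_inv l_inv m_closed)
  have tri: "l (inv x \<otimes> z) \<le> l (inv x \<otimes> y) + l (inv y \<otimes> z)"
    if "x \<in> carrier G" "y \<in> carrier G" "z \<in> carrier G" for x y z
  proof -
    have "inv x \<otimes> z = (inv x \<otimes> y) \<otimes> (inv y \<otimes> z)"
      using that by (metis inv_closed inv_solve_left m_assoc m_closed)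
    then show ?thesis
      using that l(4)[of "inv x \<otimes> y" "inv y \<otimes> z"] by simp
  qed
  have left: "l (inv (k \<otimes> x) \<otimes> (k \<otimes> y)) = l (inv x \<otimes> y)"
    if "x \<in> carrier G" "y \<in> carrier G" "k \<in> carrier G" for x y k
  proof -
    have "inv (k \<otimes> x) \<otimes> (k \<otimes> y) = inv x \<otimes> (inv k \<otimes> k \<otimes> y)"
      using that by (simp only: inv_mult_group m_assoc inv_closed m_closed)
    then show ?thesis
      using that by simp
  qed
  have right: "l (inv (x \<otimes> k) \<otimes> (y \<otimes> k)) = l (inv x \<otimes> y)"
    if "x \<in> carrier G" "y \<in> carrier G" "k \<in> carrier G" for x y k
  proof -
    have "l (inv (x \<otimes> k) \<otimes> (y \<otimes> k)) = l (inv k \<otimes> (inv x \<otimes> y \<otimes> k))"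
      using that by (simp add: inv_mult_group m_assoc)
    also have "\<dots> = l (inv x \<otimes> y \<otimes> k \<otimes> inv k)"
      using that by (intro l(5)) auto
    finally show ?thesis
      using that by (simp add: m_assoc)
  qed
  show ?thesis
    using l(2) by (auto simp: biinvariant_metric_def Metric_space_def sym zero tri left right)
qed

text \<open>The factor of order two in the model group provides elements at distance exactly one, and
  the discrete summand turns a length function that may vanish off the identity into one that
  gives a metric.\<close>

lemma weakly_soficI:
  fixes G :: "('g, 'c) monoid_scheme"
  assumes "group G" "0 < c"
    and approx: "\<And>F \<epsilon>. \<lbrakk>finite F; F \<subseteq> carrier G; 0 < \<epsilon>\<rbrakk> \<Longrightarrow>
      \<exists>(K :: 'k monoid) l \<phi>. group K \<and> finite (carrier K) \<and> length_function K l \<and>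
        \<phi> \<in> carrier G \<rightarrow> carrier K \<and> \<phi> \<one>\<^bsub>G\<^esub> = \<one>\<^bsub>K\<^esub> \<and>
        (\<forall>g\<in>F. \<forall>h\<in>F. g \<otimes>\<^bsub>G\<^esub> h \<in> F \<longrightarrow>
          l (inv\<^bsub>K\<^esub> (\<phi> (g \<otimes>\<^bsub>G\<^esub> h)) \<otimes>\<^bsub>K\<^esub> (\<phi> g \<otimes>\<^bsub>K\<^esub> \<phi> h)) < \<epsilon>) \<and>
        (\<forall>g\<in>F. g \<noteq> \<one>\<^bsub>G\<^esub> \<longrightarrow> c \<le> l (\<phi> g))"
  shows "weakly_sofic G"
  unfolding weakly_sofic_def
proof (intro conjI exI[of _ "min 1 c / 2"] allI impI)
  \<comment> \<open>Truncation at 1 leaves a separation of \<open>min 1 c\<close>; half of it is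
    exceeded strictly, as the definition demands.\<close>
  show "group G" "0 < min 1 c / 2"
    using assms by auto
  fix F and \<epsilon> :: real
  assume "finite F \<and> F \<subseteq> carrier G \<and> 0 < \<epsilon>"
  \<comment> \<open>One half of \<epsilon> bounds the defect of \<open>\<phi>\<close>; the other
    half is the weight of the discrete summand of \<open>L\<close>, which a nontrivial defect also
    pays.\<close>
  then have F: "finite F" "F \<subseteq> carrier G" "0 < \<epsilon> / 2" and eps: "0 < \<epsilon>"
    by auto
  obtain K :: "'k monoid" and l \<phi> where *: "group K \<and> finite (carrier K) \<and> length_function K l \<and>
        \<phi> \<in> carrier G \<rightarrow> carrier K \<and> \<phi> \<one>\<^bsub>G\<^esub> = \<one>\<^bsub>K\<^esub> \<and>
        (\<forall>g\<in>F. \<forall>h\<in>F. g \<otimes>\<^bsub>G\<^esub> h \<in> F \<longrightarrow>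
          l (inv\<^bsub>K\<^esub> (\<phi> (g \<otimes>\<^bsub>G\<^esub> h)) \<otimes>\<^bsub>K\<^esub> (\<phi> g \<otimes>\<^bsub>K\<^esub> \<phi> h)) < \<epsilon> / 2) \<and>
        (\<forall>g\<in>F. g \<noteq> \<one>\<^bsub>G\<^esub> \<longrightarrow> c \<le> l (\<phi> g))"
    using approx[OF F] by (elim exE) (rule that)
  have "group K" and fin: "finite (carrier K)"
    and l: "length_function K l" and \<phi>: "\<phi> \<in> carrier G \<rightarrow> carrier K" "\<phi> \<one>\<^bsub>G\<^esub> = \<one>\<^bsub>K\<^esub>"
    and mult: "\<And>g h. \<lbrakk>g \<in> F; h \<in> F; g \<otimes>\<^bsub>G\<^esub> h \<in> F\<rbrakk> \<Longrightarrow>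
          l (inv\<^bsub>K\<^esub> (\<phi> (g \<otimes>\<^bsub>G\<^esub> h)) \<otimes>\<^bsub>K\<^esub> (\<phi> g \<otimes>\<^bsub>K\<^esub> \<phi> h)) < \<epsilon> / 2"
    and sep: "\<And>g. \<lbrakk>g \<in> F; g \<noteq> \<one>\<^bsub>G\<^esub>\<rbrakk> \<Longrightarrow> c \<le> l (\<phi> g)"
    using * by simp_all
  interpret G: group G by fact
  interpret K: group K by fact
  define Z where "Z = integer_mod_group 2"
  have Z: "group Z" "finite (carrier Z)" "1 \<in> carrier Z" and Z0: "\<one>\<^bsub>Z\<^esub> = 0"
    by (auto simp: Z_def carrier_integer_mod_group)
  interpret Z: group Z by (rule Z)
  define P where "P = K \<times>\<times> Z"
  have P: "group P" "finite (carrier P)"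
    using Z fin by (auto simp: P_def DirProd_group)
  obtain f :: "_ \<Rightarrow> nat" where f_inj: "inj_on f (carrier P)"
    using finite_imp_inj_to_nat_seg[OF P(2)] by blast
  obtain N :: "nat monoid" where "group N" and carN: "carrier N = f ` carrier P" and f: "f \<in> iso P N"
    by (rule group_copy[OF P(1) f_inj]) (rule that)
  then have finN: "finite (carrier N)"
    using P by simp
  interpret P: group P by fact
  interpret N: group N by fact
  interpret f: group_hom P N f
    using f by (simp add: group_hom_def group_hom_axioms_def iso_imp_homomorphism)
  define f' where "f' = inv_into (carrier P) f"
  have f': "f' \<in> iso N P"
    using P.iso_set_sym[OF f] by (simp add: f'_def)
  have f'f [simp]: "f' (f x) = x" if "x \<in> carrier P" for x
    using f that by (simp add: f'_def iso_def bij_betw_def)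
  have f'0: "f' x = \<one>\<^bsub>P\<^esub> \<longleftrightarrow> x = \<one>\<^bsub>N\<^esub>" if "x \<in> carrier N" for x
    using f' that P(1) iso_iff_mon_epi[of f' N P] mon_iff_hom_one[of N P f'] hom_one[of f' N P]
    by (auto simp: iso_def)
  define L where "L = (\<lambda>x. min 1 (l (fst x) + (if snd x = \<one>\<^bsub>Z\<^esub> then 0 else 1)
      + (if x = \<one>\<^bsub>P\<^esub> then 0 else \<epsilon> / 2)))"
  have hom: "fst \<in> hom P K" "snd \<in> hom P Z"
    by (auto simp: hom_def P_def mult_DirProd')
  have "length_function P (\<lambda>x. l (fst x))"
    by (rule length_function_comp[OF l hom(1) P(1) \<open>group K\<close>])
  moreover have "length_function P (\<lambda>x. if snd x = \<one>\<^bsub>Z\<^esub> then 0 else 1)"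
    by (rule length_function_comp[OF length_function_discrete hom(2) P(1)]) (use Z in auto)
  ultimately have L: "length_function P L"
    unfolding L_def
    by (rule length_function_min_one[OF length_function_add[OF length_function_add]])
      (rule length_function_discrete[OF P(1)], use eps in simp)
  have Lpos: "x = \<one>\<^bsub>P\<^esub>" if "x \<in> carrier P" "L x = 0" for x
    using that length_functionD(2)[OF l, of "fst x"] eps
    by (auto simp: L_def P_def min_def split: if_splits)
  define LN where "LN = (\<lambda>x. L (f' x))"
  have LN: "length_function N LN"
    unfolding LN_def
    by (rule length_function_comp[OF L iso_imp_homomorphism[OF f'] \<open>group N\<close> P(1)])
  define d where "d = (\<lambda>x y. if x \<in> carrier N \<and> y \<in> carrier N then LN (inv\<^bsub>N\<^esub> x \<otimes>\<^bsub>N\<^esub> y) else 0)"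
  have bi: "biinvariant_metric N d"
    unfolding d_def
  proof (rule biinvariant_metric_of_length[OF \<open>group N\<close> LN])
    fix x assume "x \<in> carrier N" "LN x = 0"
    moreover have "f' x \<in> carrier P"
      using f' \<open>x \<in> carrier N\<close> by (auto simp: iso_def hom_def)
    ultimately show "x = \<one>\<^bsub>N\<^esub>"
      using Lpos f'0 by (auto simp: LN_def)
  qed
  \<comment> \<open>The trivial second coordinate keeps the factor of order two out of both the
    defect and the separation.\<close>
  define \<psi> where "\<psi> = (\<lambda>g. f (\<phi> g, \<one>\<^bsub>Z\<^esub>))"
  have in_P: "(k, z) \<in> carrier P" if "k \<in> carrier K" "z \<in> carrier Z" for k z
    using that by (simp add: P_def)
  have \<phi>P: "(\<phi> g, \<one>\<^bsub>Z\<^esub>) \<in> carrier P" if "g \<in> carrier G" for g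
    using \<phi> that Z by (intro in_P) (auto simp: Z_def)
  have d_f: "d (f x) (f y) = L (inv\<^bsub>P\<^esub> x \<otimes>\<^bsub>P\<^esub> y)" if "x \<in> carrier P" "y \<in> carrier P" for x y
    using that by (simp add: d_def LN_def flip: f.hom_mult f.hom_inv)
  have d_le: "d x y \<le> 1" for x y
    by (simp add: d_def LN_def L_def)
  have one_P: "\<one>\<^bsub>P\<^esub> = (\<one>\<^bsub>K\<^esub>, \<one>\<^bsub>Z\<^esub>)"
    by (simp add: P_def)
  have d_one: "d \<one>\<^bsub>N\<^esub> (f (\<one>\<^bsub>K\<^esub>, 1)) = 1"
  proof -
    have p: "(\<one>\<^bsub>K\<^esub>, 1) \<in> carrier P"
      using Z by (auto intro: in_P)
    have "d \<one>\<^bsub>N\<^esub> (f (\<one>\<^bsub>K\<^esub>, 1)) = L (\<one>\<^bsub>K\<^esub>, 1)"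
      using d_f[OF P.one_closed p] p by simp
    then show ?thesis
      using Z0 eps length_functionD(1)[OF l] by (simp add: L_def)
  qed
  show "\<exists>(N :: nat monoid) d \<psi>. group N \<and> finite (carrier N) \<and> biinvariant_metric N d \<and>
        (SUP (x, y) \<in> carrier N \<times> carrier N. d x y) = 1 \<and>
        \<psi> \<in> carrier G \<rightarrow> carrier N \<and> \<psi> \<one>\<^bsub>G\<^esub> = \<one>\<^bsub>N\<^esub> \<and>
        (\<forall>g\<in>F. \<forall>h\<in>F. g \<otimes>\<^bsub>G\<^esub> h \<in> F \<longrightarrow> d (\<psi> (g \<otimes>\<^bsub>G\<^esub> h)) (\<psi> g \<otimes>\<^bsub>N\<^esub> \<psi> h) < \<epsilon>) \<and>
        (\<forall>g\<in>F. g \<noteq> \<one>\<^bsub>G\<^esub> \<longrightarrow> d (\<psi> g) \<one>\<^bsub>N\<^esub> > min 1 c / 2)"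
  proof (intro exI conjI ballI impI)
    show "(SUP (x, y) \<in> carrier N \<times> carrier N. d x y) = 1"
    proof (rule cSup_eq_maximum)
      have "f (\<one>\<^bsub>K\<^esub>, 1) \<in> carrier N"
        using Z by (intro f.hom_closed in_P) auto
      then show "1 \<in> (\<lambda>(x, y). d x y) ` (carrier N \<times> carrier N)"
        using d_one by (intro image_eqI[of _ _ "(\<one>\<^bsub>N\<^esub>, f (\<one>\<^bsub>K\<^esub>, 1))"]) auto
    qed (use d_le in auto)
    show "\<psi> \<in> carrier G \<rightarrow> carrier N"
      using \<phi>P by (auto simp: \<psi>_def)
    show "\<psi> \<one>\<^bsub>G\<^esub> = \<one>\<^bsub>N\<^esub>"
      using f.hom_one by (simp add: \<psi>_def \<phi> one_P)
  next
    fix g h assume gh: "g \<in> F" "h \<in> F" "g \<otimes>\<^bsub>G\<^esub> h \<in> F"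
    then have car: "g \<in> carrier G" "h \<in> carrier G"
      using F by auto
    have *: "\<phi> g \<in> carrier K" "\<phi> h \<in> carrier K" "\<phi> (g \<otimes>\<^bsub>G\<^esub> h) \<in> carrier K"
      using \<phi> car by auto
    have z: "\<one>\<^bsub>Z\<^esub> \<otimes>\<^bsub>Z\<^esub> \<one>\<^bsub>Z\<^esub> = \<one>\<^bsub>Z\<^esub>" "inv\<^bsub>Z\<^esub> \<one>\<^bsub>Z\<^esub> = \<one>\<^bsub>Z\<^esub>"
      by simp_all
    have "\<psi> g \<otimes>\<^bsub>N\<^esub> \<psi> h = f (\<phi> g \<otimes>\<^bsub>K\<^esub> \<phi> h, \<one>\<^bsub>Z\<^esub>)"
      using f.hom_mult[OF \<phi>P \<phi>P, OF car] z by (simp add: \<psi>_def P_def)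
    then have "d (\<psi> (g \<otimes>\<^bsub>G\<^esub> h)) (\<psi> g \<otimes>\<^bsub>N\<^esub> \<psi> h) =
        L (inv\<^bsub>P\<^esub> (\<phi> (g \<otimes>\<^bsub>G\<^esub> h), \<one>\<^bsub>Z\<^esub>) \<otimes>\<^bsub>P\<^esub> (\<phi> g \<otimes>\<^bsub>K\<^esub> \<phi> h, \<one>\<^bsub>Z\<^esub>))"
      unfolding \<psi>_def using car * Z by (subst d_f[symmetric]) (auto intro!: in_P simp: group.is_monoid)
    also have "\<dots> = L (inv\<^bsub>K\<^esub> (\<phi> (g \<otimes>\<^bsub>G\<^esub> h)) \<otimes>\<^bsub>K\<^esub> (\<phi> g \<otimes>\<^bsub>K\<^esub> \<phi> h), \<one>\<^bsub>Z\<^esub>)"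
      using * Z z by (simp add: P_def K.group_axioms group.is_monoid)
    also have "\<dots> < \<epsilon>"
      using mult[OF gh] eps by (simp add: L_def min_def)
    finally show "d (\<psi> (g \<otimes>\<^bsub>G\<^esub> h)) (\<psi> g \<otimes>\<^bsub>N\<^esub> \<psi> h) < \<epsilon>" .
  next
    fix g assume g: "g \<in> F" "g \<noteq> \<one>\<^bsub>G\<^esub>"
    then have car: "g \<in> carrier G"
      using F by auto
    have "d (\<psi> g) \<one>\<^bsub>N\<^esub> = L (inv\<^bsub>P\<^esub> (\<phi> g, \<one>\<^bsub>Z\<^esub>))"
      using d_f[OF \<phi>P P.one_closed, OF car] \<phi>P[OF car] by (simp add: \<psi>_def)
    also have "\<dots> = L (\<phi> g, \<one>\<^bsub>Z\<^esub>)"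
      using length_functionD(3)[OF L] \<phi>P[OF car] by simp
    also have "\<dots> > min 1 c / 2"
      using sep[OF g] eps assms(2) by (auto simp: L_def)
    finally show "d (\<psi> g) \<one>\<^bsub>N\<^esub> > min 1 c / 2" .
  qed (fact | simp)+
qed

text \<open>The bound \<open>l x \<le> 1\<close> comes from the truncation that also makes the
  separation exactly 1. It is what allows 1 as the cost of a moved point in the wreath
  product.\<close>

lemma weakly_soficE:
  assumes "weakly_sofic G" "finite F" "F \<subseteq> carrier G" "0 < \<epsilon>"
  obtains K :: "nat monoid" and l \<phi> where "group K" "finite (carrier K)" "length_function K l"
    "\<And>x. x \<in> carrier K \<Longrightarrow> l x \<le> 1"
    "\<phi> \<in> carrier G \<rightarrow> carrier K" "\<phi> \<one>\<^bsub>G\<^esub> = \<one>\<^bsub>K\<^esub>"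
    "\<And>g h. \<lbrakk>g \<in> F; h \<in> F; g \<otimes>\<^bsub>G\<^esub> h \<in> F\<rbrakk> \<Longrightarrow>
      l (inv\<^bsub>K\<^esub> (\<phi> (g \<otimes>\<^bsub>G\<^esub> h)) \<otimes>\<^bsub>K\<^esub> (\<phi> g \<otimes>\<^bsub>K\<^esub> \<phi> h)) < \<epsilon>"
    "\<And>g. \<lbrakk>g \<in> F; g \<noteq> \<one>\<^bsub>G\<^esub>\<rbrakk> \<Longrightarrow> l (\<phi> g) = 1"
proof -
  interpret G: group G
    using assms by (simp add: weakly_sofic_def)
  from assms(1)[unfolded weakly_sofic_def, THEN conjunct2]
  obtain c where "0 < c" and c: "\<forall>F \<epsilon>. finite F \<and> F \<subseteq> carrier G \<and> \<epsilon> > 0 \<longrightarrow>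
      (\<exists>(K :: nat monoid) d \<phi>. group K \<and> finite (carrier K) \<and> biinvariant_metric K d \<and>
        (SUP (x, y) \<in> carrier K \<times> carrier K. d x y) = 1 \<and>
        \<phi> \<in> carrier G \<rightarrow> carrier K \<and> \<phi> \<one>\<^bsub>G\<^esub> = \<one>\<^bsub>K\<^esub> \<and>
        (\<forall>g\<in>F. \<forall>h\<in>F. g \<otimes>\<^bsub>G\<^esub> h \<in> F \<longrightarrow> d (\<phi> (g \<otimes>\<^bsub>G\<^esub> h)) (\<phi> g \<otimes>\<^bsub>K\<^esub> \<phi> h) < \<epsilon>) \<and>
        (\<forall>g\<in>F. g \<noteq> \<one>\<^bsub>G\<^esub> \<longrightarrow> d (\<phi> g) \<one>\<^bsub>K\<^esub> > c))"
    by (elim exE conjE) (rule that)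
  \<comment> \<open>The tolerance \<open>\<epsilon> * c\<close> compensates the factor
    \<open>1 / c\<close> in the definition of \<open>l\<close>.\<close>
  have "finite F \<and> F \<subseteq> carrier G \<and> 0 < \<epsilon> * c"
    by (intro conjI mult_pos_pos assms \<open>0 < c\<close>)
  from c[THEN spec, THEN spec, THEN mp, OF this] obtain K :: "nat monoid" and d \<phi> where *: "group K \<and> finite (carrier K) \<and> biinvariant_metric K d \<and>
        (SUP (x, y) \<in> carrier K \<times> carrier K. d x y) = 1 \<and>
        \<phi> \<in> carrier G \<rightarrow> carrier K \<and> \<phi> \<one>\<^bsub>G\<^esub> = \<one>\<^bsub>K\<^esub> \<and>
        (\<forall>g\<in>F. \<forall>h\<in>F. g \<otimes>\<^bsub>G\<^esub> h \<in> F \<longrightarrow> d (\<phi> (g \<otimes>\<^bsub>G\<^esub> h)) (\<phi> g \<otimes>\<^bsub>K\<^esub> \<phi> h) < \<epsilon> * c) \<and>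
        (\<forall>g\<in>F. g \<noteq> \<one>\<^bsub>G\<^esub> \<longrightarrow> d (\<phi> g) \<one>\<^bsub>K\<^esub> > c)"
    by (elim exE) (rule that)
  have K: "group K" "finite (carrier K)"
    and "biinvariant_metric K d" and \<phi>: "\<phi> \<in> carrier G \<rightarrow> carrier K" "\<phi> \<one>\<^bsub>G\<^esub> = \<one>\<^bsub>K\<^esub>"
    and mult: "\<And>g h. \<lbrakk>g \<in> F; h \<in> F; g \<otimes>\<^bsub>G\<^esub> h \<in> F\<rbrakk> \<Longrightarrow>
      d (\<phi> (g \<otimes>\<^bsub>G\<^esub> h)) (\<phi> g \<otimes>\<^bsub>K\<^esub> \<phi> h) < \<epsilon> * c"
    and sep: "\<And>g. \<lbrakk>g \<in> F; g \<noteq> \<one>\<^bsub>G\<^esub>\<rbrakk> \<Longrightarrow> d (\<phi> g) \<one>\<^bsub>K\<^esub> > c"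
    using * by simp_all
  interpret K: group K by fact
  have "Metric_space (carrier K) d"
    and inv_l: "\<And>k x y. \<lbrakk>k \<in> carrier K; x \<in> carrier K; y \<in> carrier K\<rbrakk> \<Longrightarrow>
      d (k \<otimes>\<^bsub>K\<^esub> x) (k \<otimes>\<^bsub>K\<^esub> y) = d x y"
    and inv_r: "\<And>k x y. \<lbrakk>k \<in> carrier K; x \<in> carrier K; y \<in> carrier K\<rbrakk> \<Longrightarrow>
      d (x \<otimes>\<^bsub>K\<^esub> k) (y \<otimes>\<^bsub>K\<^esub> k) = d x y"
    using \<open>biinvariant_metric K d\<close> by (auto simp: biinvariant_metric_def)
  then interpret M: Metric_space "carrier K" d by simp
  have len: "length_function K (\<lambda>x. d x \<one>\<^bsub>K\<^esub>)"
    unfolding length_function_def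
  proof (intro conjI ballI)
    fix x y assume xy: "x \<in> carrier K" "y \<in> carrier K"
    \<comment> \<open>Translation turns the length of a product into the distance between
      \<open>y\<close> and \<open>inv x\<close>. Invariance under inversion, the exchange of factors
      and the triangle inequality are all read off from this form.\<close>
    have 1: "d (x \<otimes>\<^bsub>K\<^esub> y) \<one>\<^bsub>K\<^esub> = d y (inv\<^bsub>K\<^esub> x)" if "x \<in> carrier K" "y \<in> carrier K" for x y
      using that inv_l[of "inv\<^bsub>K\<^esub> x" "x \<otimes>\<^bsub>K\<^esub> y" "\<one>\<^bsub>K\<^esub>"] by (simp flip: K.m_assoc)
    have 2: "d y (inv\<^bsub>K\<^esub> x) = d (y \<otimes>\<^bsub>K\<^esub> x) \<one>\<^bsub>K\<^esub>"
      using xy inv_r[of x y "inv\<^bsub>K\<^esub> x"] by simp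
    show "d (x \<otimes>\<^bsub>K\<^esub> y) \<one>\<^bsub>K\<^esub> = d (y \<otimes>\<^bsub>K\<^esub> x) \<one>\<^bsub>K\<^esub>"
      using 1 2 xy by simp
    show "d (inv\<^bsub>K\<^esub> x) \<one>\<^bsub>K\<^esub> = d x \<one>\<^bsub>K\<^esub>"
      using 1[of x "\<one>\<^bsub>K\<^esub>"] xy by (simp add: M.commute)
    then show "d (x \<otimes>\<^bsub>K\<^esub> y) \<one>\<^bsub>K\<^esub> \<le> d x \<one>\<^bsub>K\<^esub> + d y \<one>\<^bsub>K\<^esub>"
      using xy 1[of x y] M.triangle[of y "\<one>\<^bsub>K\<^esub>" "inv\<^bsub>K\<^esub> x"] by (simp add: M.commute)
  qed auto
  define l where "l = (\<lambda>x. min 1 (1 / c * d x \<one>\<^bsub>K\<^esub>))"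
  have l: "length_function K l"
    unfolding l_def using \<open>0 < c\<close> by (intro length_function_min_one length_function_scale len) auto
  show thesis
  proof (rule that[OF K l _ \<phi>])
    fix g h assume gh: "g \<in> F" "h \<in> F" "g \<otimes>\<^bsub>G\<^esub> h \<in> F"
    then have *: "\<phi> g \<in> carrier K" "\<phi> h \<in> carrier K" "\<phi> (g \<otimes>\<^bsub>G\<^esub> h) \<in> carrier K"
      using \<phi> assms by (auto simp: Pi_iff)
    then have "d (inv\<^bsub>K\<^esub> (\<phi> (g \<otimes>\<^bsub>G\<^esub> h)) \<otimes>\<^bsub>K\<^esub> (\<phi> g \<otimes>\<^bsub>K\<^esub> \<phi> h)) \<one>\<^bsub>K\<^esub> =
        d (\<phi> g \<otimes>\<^bsub>K\<^esub> \<phi> h) (\<phi> (g \<otimes>\<^bsub>G\<^esub> h))"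
      using inv_l[of "\<phi> (g \<otimes>\<^bsub>G\<^esub> h)" "inv\<^bsub>K\<^esub> (\<phi> (g \<otimes>\<^bsub>G\<^esub> h)) \<otimes>\<^bsub>K\<^esub> (\<phi> g \<otimes>\<^bsub>K\<^esub> \<phi> h)" "\<one>\<^bsub>K\<^esub>"]
      by (simp flip: K.m_assoc)
    then show "l (inv\<^bsub>K\<^esub> (\<phi> (g \<otimes>\<^bsub>G\<^esub> h)) \<otimes>\<^bsub>K\<^esub> (\<phi> g \<otimes>\<^bsub>K\<^esub> \<phi> h)) < \<epsilon>"
      using mult[OF gh] \<open>0 < c\<close> by (simp add: l_def M.commute min_less_iff_disj field_simps)
  next
    fix g assume "g \<in> F" "g \<noteq> \<one>\<^bsub>G\<^esub>"
    then show "l (\<phi> g) = 1"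
      using sep[of g] \<open>0 < c\<close> by (simp add: l_def min_def field_simps)
  qed (simp add: l_def)
qed

text \<open>A model of \<open>H\<close> restricts along \<open>f\<close>, and injectivity keeps
  nontrivial elements separated. It serves to pass weak soficity to an isomorphic copy on another
  type.\<close>

lemma weakly_sofic_embedding:
  assumes "group G" "weakly_sofic H" "f \<in> hom G H" "inj_on f (carrier G)"
  shows "weakly_sofic G"
proof (rule weakly_soficI[where c = 1 and 'k = nat])
  interpret G: group G by fact
  interpret f: group_hom G H f
    using assms by (simp add: group_hom_def group_hom_axioms_def weakly_sofic_def)
  fix F and \<epsilon> :: real assume F: "finite F" "F \<subseteq> carrier G" and "0 < \<epsilon>"
  have T: "finite (f ` F)" "f ` F \<subseteq> carrier H"
    using F by auto
  obtain K :: "nat monoid" and l \<phi> where K: "group K" "finite (carrier K)" "length_function K l"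
    and \<phi>: "\<phi> \<in> carrier H \<rightarrow> carrier K" "\<phi> \<one>\<^bsub>H\<^esub> = \<one>\<^bsub>K\<^esub>"
    and mult: "\<And>g h. \<lbrakk>g \<in> f ` F; h \<in> f ` F; g \<otimes>\<^bsub>H\<^esub> h \<in> f ` F\<rbrakk> \<Longrightarrow>
      l (inv\<^bsub>K\<^esub> (\<phi> (g \<otimes>\<^bsub>H\<^esub> h)) \<otimes>\<^bsub>K\<^esub> (\<phi> g \<otimes>\<^bsub>K\<^esub> \<phi> h)) < \<epsilon>"
    and sep: "\<And>g. \<lbrakk>g \<in> f ` F; g \<noteq> \<one>\<^bsub>H\<^esub>\<rbrakk> \<Longrightarrow> l (\<phi> g) = 1"
    using weakly_soficE[OF assms(2) T \<open>0 < \<epsilon>\<close>] by metis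
  show "\<exists>(K :: nat monoid) l \<psi>. group K \<and> finite (carrier K) \<and> length_function K l \<and>
      \<psi> \<in> carrier G \<rightarrow> carrier K \<and> \<psi> \<one>\<^bsub>G\<^esub> = \<one>\<^bsub>K\<^esub> \<and>
      (\<forall>g\<in>F. \<forall>h\<in>F. g \<otimes>\<^bsub>G\<^esub> h \<in> F \<longrightarrow>
        l (inv\<^bsub>K\<^esub> (\<psi> (g \<otimes>\<^bsub>G\<^esub> h)) \<otimes>\<^bsub>K\<^esub> (\<psi> g \<otimes>\<^bsub>K\<^esub> \<psi> h)) < \<epsilon>) \<and>
      (\<forall>g\<in>F. g \<noteq> \<one>\<^bsub>G\<^esub> \<longrightarrow> 1 \<le> l (\<psi> g))"
  proof (intro exI[of _ K] exI[of _ l] exI[of _ "\<phi> \<circ> f"] conjI ballI impI K)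
    fix g h assume gh: "g \<in> F" "h \<in> F" "g \<otimes>\<^bsub>G\<^esub> h \<in> F"
    then have "g \<in> carrier G" "h \<in> carrier G"
      using F by auto
    then have eq: "f (g \<otimes>\<^bsub>G\<^esub> h) = f g \<otimes>\<^bsub>H\<^esub> f h"
      by simp
    then have "f g \<otimes>\<^bsub>H\<^esub> f h \<in> f ` F"
      using gh(3) by (metis imageI)
    then show "l (inv\<^bsub>K\<^esub> ((\<phi> \<circ> f) (g \<otimes>\<^bsub>G\<^esub> h)) \<otimes>\<^bsub>K\<^esub> ((\<phi> \<circ> f) g \<otimes>\<^bsub>K\<^esub> (\<phi> \<circ> f) h)) < \<epsilon>"
      using mult gh by (simp add: eq)
  next
    fix g assume g: "g \<in> F" "g \<noteq> \<one>\<^bsub>G\<^esub>"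
    then have "f g \<noteq> \<one>\<^bsub>H\<^esub>"
      using F inj_onD[OF assms(4), of g "\<one>\<^bsub>G\<^esub>"] by auto
    then show "1 \<le> l ((\<phi> \<circ> f) g)"
      using sep g by simp
  qed (use \<phi> in auto)
qed (use assms in simp_all)

section \<open>Lengths on finite wreath products\<close>

text \<open>Homomorphisms are enough to have an action by automorphisms: by the two action laws,
  \<open>\<theta> (inv k)\<close> inverts \<open>\<theta> k\<close> on the carrier.\<close>

locale hom_action = N: group N + K: group K
  for N :: "('n, 'c) monoid_scheme" and K :: "('k, 'd) monoid_scheme" and \<theta> +
  assumes action_hom: "k \<in> carrier K \<Longrightarrow> \<theta> k \<in> hom N N"
    and action_one: "n \<in> carrier N \<Longrightarrow> \<theta> \<one>\<^bsub>K\<^esub> n = n"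
    and action_mult: "\<lbrakk>k \<in> carrier K; l \<in> carrier K; n \<in> carrier N\<rbrakk> \<Longrightarrow>
      \<theta> (k \<otimes>\<^bsub>K\<^esub> l) n = \<theta> k (\<theta> l n)"
begin

lemma action_closed [simp]: "k \<in> carrier K \<Longrightarrow> n \<in> carrier N \<Longrightarrow> \<theta> k n \<in> carrier N"
  using action_hom by (auto simp: hom_def)

lemma group_semidirect: "group (semidirect N K \<theta>)"
proof (rule groupI)
  fix x assume "x \<in> carrier (semidirect N K \<theta>)"
  then obtain m k where x: "x = (m, k)" "m \<in> carrier N" "k \<in> carrier K"
    by (auto simp: semidirect_def)
  have "\<theta> (inv\<^bsub>K\<^esub> k) (inv\<^bsub>N\<^esub> m) \<otimes>\<^bsub>N\<^esub> \<theta> (inv\<^bsub>K\<^esub> k) m = \<one>\<^bsub>N\<^esub>"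
    using x hom_mult[OF action_hom[of "inv\<^bsub>K\<^esub> k"], of "inv\<^bsub>N\<^esub> m" m]
      hom_one[OF action_hom[of "inv\<^bsub>K\<^esub> k"]] by simp
  then show "\<exists>y\<in>carrier (semidirect N K \<theta>). y \<otimes>\<^bsub>semidirect N K \<theta>\<^esub> x = \<one>\<^bsub>semidirect N K \<theta>\<^esub>"
    using x by (intro bexI[of _ "(\<theta> (inv\<^bsub>K\<^esub> k) (inv\<^bsub>N\<^esub> m), inv\<^bsub>K\<^esub> k)"]) (auto simp: semidirect_def)
qed (auto simp: semidirect_def N.m_assoc K.m_assoc action_one action_mult hom_mult[OF action_hom])

lemma inv_semidirect:
  assumes "m \<in> carrier N" "k \<in> carrier K"
  shows "inv\<^bsub>semidirect N K \<theta>\<^esub> (m, k) = (\<theta> (inv\<^bsub>K\<^esub> k) (inv\<^bsub>N\<^esub> m), inv\<^bsub>K\<^esub> k)"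
proof (rule group.inv_equality[OF group_semidirect])
  have "\<theta> (inv\<^bsub>K\<^esub> k) (inv\<^bsub>N\<^esub> m) \<otimes>\<^bsub>N\<^esub> \<theta> (inv\<^bsub>K\<^esub> k) m = \<one>\<^bsub>N\<^esub>"
    using assms hom_mult[OF action_hom[of "inv\<^bsub>K\<^esub> k"], of "inv\<^bsub>N\<^esub> m" m]
      hom_one[OF action_hom[of "inv\<^bsub>K\<^esub> k"]] by simp
  then show "(\<theta> (inv\<^bsub>K\<^esub> k) (inv\<^bsub>N\<^esub> m), inv\<^bsub>K\<^esub> k) \<otimes>\<^bsub>semidirect N K \<theta>\<^esub> (m, k) = \<one>\<^bsub>semidirect N K \<theta>\<^esub>"
    using assms by (auto simp: semidirect_def)
qed (use assms in \<open>auto simp: semidirect_def\<close>)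

end

section \<open>Groups of bijections and their action on direct sums\<close>

lemma BijGroup_simps:
  assumes "\<sigma> \<in> carrier (BijGroup A)" "a \<in> A"
  shows "\<sigma> a \<in> A" and "(inv\<^bsub>BijGroup A\<^esub> \<sigma>) a \<in> A"
    and "\<sigma> ((inv\<^bsub>BijGroup A\<^esub> \<sigma>) a) = a" and "(inv\<^bsub>BijGroup A\<^esub> \<sigma>) (\<sigma> a) = a"
    and "\<tau> \<in> carrier (BijGroup A) \<Longrightarrow> (\<sigma> \<otimes>\<^bsub>BijGroup A\<^esub> \<tau>) a = \<sigma> (\<tau> a)"
proof -
  have \<sigma>: "\<sigma> \<in> Bij A" "bij_betw \<sigma> A A"
    using assms by (auto simp: BijGroup_def Bij_def)
  then show *: "\<sigma> a \<in> A"
    using assms bij_betwE by blast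
  have inv: "inv\<^bsub>BijGroup A\<^esub> \<sigma> = (\<lambda>a\<in>A. inv_into A \<sigma> a)"
    by (rule inv_BijGroup[OF \<sigma>(1)])
  show "(inv\<^bsub>BijGroup A\<^esub> \<sigma>) a \<in> A" "\<sigma> ((inv\<^bsub>BijGroup A\<^esub> \<sigma>) a) = a"
    using assms Bij_inv_into_mem[OF \<sigma>(1)] bij_betw_inv_into_right[OF \<sigma>(2)] by (auto simp: inv)
  show "(inv\<^bsub>BijGroup A\<^esub> \<sigma>) (\<sigma> a) = a"
    using assms * bij_betw_inv_into_left[OF \<sigma>(2)] by (simp add: inv)
  show "\<tau> \<in> carrier (BijGroup A) \<Longrightarrow> (\<sigma> \<otimes>\<^bsub>BijGroup A\<^esub> \<tau>) a = \<sigma> (\<tau> a)"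
    using assms \<sigma> by (simp add: BijGroup_def compose_eq)
qed

lemma one_BijGroup: "a \<in> A \<Longrightarrow> \<one>\<^bsub>BijGroup A\<^esub> a = a"
  by (simp add: BijGroup_def)

text \<open>The support of the permuted function lies in the image under \<open>\<alpha> g\<close>
  of the old support, so it stays finite. The inverse inside \<open>sum_perm\<close> makes this a
  left action, since inversion reverses products.\<close>

lemma hom_action_sum_perm:
  assumes "group H" "group_action \<Gamma> X \<alpha>"
  shows "hom_action (sum_group X (\<lambda>_. H)) \<Gamma> (sum_perm X \<alpha>)"
proof -
  interpret H: group H by fact
  interpret A: group_action \<Gamma> X \<alpha> by fact
  interpret \<alpha>: group_hom \<Gamma> "BijGroup X" \<alpha> by (rule A.group_hom)
  have car: "carrier (sum_group X (\<lambda>_. H)) =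
      {f \<in> X \<rightarrow>\<^sub>E carrier H. finite {x \<in> X. f x \<noteq> \<one>\<^bsub>H\<^esub>}}"
    using assms by (simp add: carrier_sum_group)
  note B = BijGroup_simps[OF \<alpha>.hom_closed]
  have closed: "sum_perm X \<alpha> g f \<in> carrier (sum_group X (\<lambda>_. H))"
    if g: "g \<in> carrier \<Gamma>" and f: "f \<in> carrier (sum_group X (\<lambda>_. H))" for g f
  proof -
    have "{x \<in> X. sum_perm X \<alpha> g f x \<noteq> \<one>\<^bsub>H\<^esub>} \<subseteq> \<alpha> g ` {x \<in> X. f x \<noteq> \<one>\<^bsub>H\<^esub>}"
    proof
      fix x assume "x \<in> {x \<in> X. sum_perm X \<alpha> g f x \<noteq> \<one>\<^bsub>H\<^esub>}"
      then show "x \<in> \<alpha> g ` {x \<in> X. f x \<noteq> \<one>\<^bsub>H\<^esub>}"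
        using g B(2,3)[OF g, of x] by (intro image_eqI[of _ _ "(inv\<^bsub>BijGroup X\<^esub> (\<alpha> g)) x"]) (auto simp: sum_perm_def)
    qed
    moreover have "finite {x \<in> X. f x \<noteq> \<one>\<^bsub>H\<^esub>}"
      using f by (simp add: car)
    ultimately have "finite {x \<in> X. sum_perm X \<alpha> g f x \<noteq> \<one>\<^bsub>H\<^esub>}"
      by (rule finite_subset[OF _ finite_imageI])
    moreover have "sum_perm X \<alpha> g f \<in> X \<rightarrow>\<^sub>E carrier H"
      using f B(2)[OF g] by (auto simp: car sum_perm_def)
    ultimately show ?thesis
      by (simp add: car)
  qed
  show ?thesis
  proof (intro hom_action.intro hom_action_axioms.intro)
    fix g assume g: "g \<in> carrier \<Gamma>"
    show "sum_perm X \<alpha> g \<in> hom (sum_group X (\<lambda>_. H)) (sum_group X (\<lambda>_. H))"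
      using closed[OF g] B(2)[OF g] by (auto simp: hom_def sum_perm_def intro!: restrict_ext)
  next
    fix f assume "f \<in> carrier (sum_group X (\<lambda>_. H))"
    then show "sum_perm X \<alpha> \<one>\<^bsub>\<Gamma>\<^esub> f = f"
      by (auto simp: car sum_perm_def PiE_iff extensional_def fun_eq_iff one_BijGroup group.is_monoid[OF group_BijGroup])
  next
    fix g h f assume gh: "g \<in> carrier \<Gamma>" "h \<in> carrier \<Gamma>" and "f \<in> carrier (sum_group X (\<lambda>_. H))"
    have "(inv\<^bsub>BijGroup X\<^esub> (\<alpha> (g \<otimes>\<^bsub>\<Gamma>\<^esub> h))) x = (inv\<^bsub>BijGroup X\<^esub> (\<alpha> h)) ((inv\<^bsub>BijGroup X\<^esub> (\<alpha> g)) x)"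
      if "x \<in> X" for x
    proof -
      have "inv\<^bsub>BijGroup X\<^esub> (\<alpha> (g \<otimes>\<^bsub>\<Gamma>\<^esub> h)) = inv\<^bsub>BijGroup X\<^esub> (\<alpha> h) \<otimes>\<^bsub>BijGroup X\<^esub> inv\<^bsub>BijGroup X\<^esub> (\<alpha> g)"
        using gh by (simp add: group.inv_mult_group)
      then show ?thesis
        using gh that by (simp add: BijGroup_simps group.inv_closed[OF group_BijGroup])
    qed
    then show "sum_perm X \<alpha> (g \<otimes>\<^bsub>\<Gamma>\<^esub> h) f = sum_perm X \<alpha> g (sum_perm X \<alpha> h f)"
      using B(2)[OF gh(1)] by (auto simp: sum_perm_def intro!: restrict_ext)
  qed (simp_all add: H.group_axioms \<alpha>.G.group_axioms)
qed

lemma group_action_BijGroup: "group_action (BijGroup A) A (\<lambda>\<sigma>. \<sigma>)"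
  by (simp add: group_action_def group_hom_def group_hom_axioms_def group_BijGroup hom_def)

section \<open>The averaged length on a finite wreath product\<close>

definition wreath_length :: "('h \<Rightarrow> real) \<Rightarrow> 'a set \<Rightarrow> ('a \<Rightarrow> 'h) \<times> ('a \<Rightarrow> 'a) \<Rightarrow> real" where
  "wreath_length l A x = (\<Sum>a\<in>A. if snd x a = a then l (fst x a) else 1) / real (card A)"

locale finite_wreath = G: group G for G :: "('h, 'c) monoid_scheme" +
  fixes A :: "'a set" and l :: "'h \<Rightarrow> real"
  assumes fin: "finite A" and len: "length_function G l"
    and len_le: "x \<in> carrier G \<Longrightarrow> l x \<le> 1"
begin

abbreviation W where "W \<equiv> wreath G (BijGroup A) A (\<lambda>\<sigma>. \<sigma>)"

sublocale W: hom_action "sum_group A (\<lambda>_. G)" "BijGroup A" "sum_perm A (\<lambda>\<sigma>. \<sigma>)"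
  by (intro hom_action_sum_perm group_action_BijGroup G.group_axioms)

lemma group_W: "group W"
  unfolding wreath_def by (rule W.group_semidirect)

lemma carrier_W: "carrier W = (A \<rightarrow>\<^sub>E carrier G) \<times> carrier (BijGroup A)"
  using fin by (simp add: wreath_def semidirect_def carrier_sum_group G.group_axioms)

lemma finite_W: "finite (carrier G) \<Longrightarrow> finite (carrier W)"
proof -
  assume "finite (carrier G)"
  moreover have "carrier (BijGroup A) \<subseteq> A \<rightarrow>\<^sub>E A"
    by (auto simp: BijGroup_def Bij_def PiE_def dest: bij_betwE)
  then have "finite (carrier (BijGroup A))"
    by (rule finite_subset) (simp add: finite_PiE fin)
  ultimately show ?thesis
    by (simp add: carrier_W finite_PiE fin)
qed

lemma one_W: "\<one>\<^bsub>W\<^esub> = (\<lambda>a\<in>A. \<one>\<^bsub>G\<^esub>, \<one>\<^bsub>BijGroup A\<^esub>)"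
  by (simp add: wreath_def semidirect_def)

lemma mult_W: "(f, \<sigma>) \<otimes>\<^bsub>W\<^esub> (f', \<tau>) =
    (\<lambda>a\<in>A. f a \<otimes>\<^bsub>G\<^esub> f' ((inv\<^bsub>BijGroup A\<^esub> \<sigma>) a), \<sigma> \<otimes>\<^bsub>BijGroup A\<^esub> \<tau>)"
  by (auto simp: wreath_def semidirect_def sum_perm_def intro!: restrict_ext)

lemma inv_W:
  assumes "f \<in> A \<rightarrow>\<^sub>E carrier G" "\<sigma> \<in> carrier (BijGroup A)"
  shows "inv\<^bsub>W\<^esub> (f, \<sigma>) = (\<lambda>a\<in>A. inv\<^bsub>G\<^esub> (f (\<sigma> a)), inv\<^bsub>BijGroup A\<^esub> \<sigma>)"
proof -
  have f: "f \<in> carrier (sum_group A (\<lambda>_. G))"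
    using assms fin by (simp add: carrier_sum_group G.group_axioms)
  show ?thesis
    unfolding wreath_def using assms f
    by (auto simp: W.inv_semidirect G.group_axioms sum_perm_def BijGroup_simps intro!: restrict_ext)
qed

abbreviation point_length where
  "point_length x a \<equiv> if snd x a = a then l (fst x a) else 1"

text \<open>All conditions are compared point by point and then summed, after reindexing by a
  permutation. Each comparison is a case split on whether the point is fixed, since only fixed
  points carry a length of \<open>G\<close>.\<close>

lemma length_function_wreath: "length_function W (wreath_length l A)"
  unfolding length_function_def
proof (intro conjI ballI)
  note l = length_functionD[OF len]
  show "wreath_length l A \<one>\<^bsub>W\<^esub> = 0"
    unfolding wreath_length_def by (subst sum.neutral) (auto simp: one_W one_BijGroup l(1))
  fix x assume x: "x \<in> carrier W"
  obtain f \<sigma> where x_eq: "x = (f, \<sigma>)" and f: "f \<in> A \<rightarrow>\<^sub>E carrier G" and \<sigma>: "\<sigma> \<in> carrier (BijGroup A)"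
    using x by (auto simp: carrier_W)
  have fa [simp]: "a \<in> A \<Longrightarrow> f a \<in> carrier G" for a
    using f by auto
  note S = BijGroup_simps[OF \<sigma>]
  show "0 \<le> wreath_length l A x"
    unfolding wreath_length_def x_eq by (intro divide_nonneg_nonneg sum_nonneg) (auto simp: l(2))
  have "point_length (inv\<^bsub>W\<^esub> x) a = point_length x a" if "a \<in> A" for a
  proof -
    have "(inv\<^bsub>BijGroup A\<^esub> \<sigma>) a = a \<longleftrightarrow> \<sigma> a = a"
      using S(3,4)[OF that] by metis
    then show ?thesis
      using that l(3)[OF fa[OF that]] by (auto simp: x_eq inv_W[OF f \<sigma>])
  qed
  then show "wreath_length l A (inv\<^bsub>W\<^esub> x) = wreath_length l A x"
    unfolding wreath_length_def by (simp cong: sum.cong)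
  fix y assume y: "y \<in> carrier W"
  obtain f' \<tau> where y_eq: "y = (f', \<tau>)" and f': "f' \<in> A \<rightarrow>\<^sub>E carrier G" and \<tau>: "\<tau> \<in> carrier (BijGroup A)"
    using y by (auto simp: carrier_W)
  have f'a [simp]: "a \<in> A \<Longrightarrow> f' a \<in> carrier G" for a
    using f' by auto
  note T = BijGroup_simps[OF \<tau>]
  have bij: "bij_betw \<tau> A A" "bij_betw (inv\<^bsub>BijGroup A\<^esub> \<sigma>) A A"
    using \<tau> group.inv_closed[OF group_BijGroup \<sigma>] by (auto simp: BijGroup_def Bij_def)
  \<comment> \<open>The term of \<open>x y\<close> at \<open>a\<close> is matched with that of
    \<open>y x\<close> at \<open>\<tau> a\<close>: both points are fixed or both are moved, and when
    fixed their entries are \<open>f a f' (\<tau> a)\<close> and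
    \<open>f' (\<tau> a) f a\<close>.\<close>
  have "point_length (x \<otimes>\<^bsub>W\<^esub> y) a = point_length (y \<otimes>\<^bsub>W\<^esub> x) (\<tau> a)" if a: "a \<in> A" for a
  proof (cases "\<sigma> (\<tau> a) = a")
    case True
    then have "(inv\<^bsub>BijGroup A\<^esub> \<sigma>) a = \<tau> a"
      using S(4)[OF T(1)[OF a]] by simp
    then show ?thesis
      using True a S T \<sigma> \<tau> l(5)[of "f a" "f' (\<tau> a)"] by (simp add: x_eq y_eq mult_W)
  next
    case False
    moreover have "\<tau> (\<sigma> (\<tau> a)) \<noteq> \<tau> a"
      using False T(4)[OF a] T(4)[OF S(1)[OF T(1)[OF a]]] by metis
    ultimately show ?thesis
      using a S T \<sigma> \<tau> by (simp add: x_eq y_eq mult_W)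
  qed
  then have "(\<Sum>a\<in>A. point_length (x \<otimes>\<^bsub>W\<^esub> y) a) = (\<Sum>a\<in>A. point_length (y \<otimes>\<^bsub>W\<^esub> x) (\<tau> a))"
    by (rule sum.cong[OF refl])
  also have "\<dots> = (\<Sum>a\<in>A. point_length (y \<otimes>\<^bsub>W\<^esub> x) a)"
    by (rule sum.reindex_bij_betw[OF bij(1)])
  finally show "wreath_length l A (x \<otimes>\<^bsub>W\<^esub> y) = wreath_length l A (y \<otimes>\<^bsub>W\<^esub> x)"
    by (simp add: wreath_length_def)
  \<comment> \<open>\<open>y\<close> is measured at the preimage of \<open>a\<close> under \<sigma>,
    because that is the entry of \<open>f'\<close> multiplied into place \<open>a\<close>. If
    \<sigma> moves \<open>a\<close>, then \<open>x\<close> alone contributes 1, which bounds the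
    left side by \<open>len_le\<close>.\<close>
  have "point_length (x \<otimes>\<^bsub>W\<^esub> y) a \<le> point_length x a + point_length y ((inv\<^bsub>BijGroup A\<^esub> \<sigma>) a)"
    if a: "a \<in> A" for a
  proof -
    define b where "b = (inv\<^bsub>BijGroup A\<^esub> \<sigma>) a"
    have b: "b \<in> A" "\<sigma> b = a"
      using S(2,3)[OF a] by (auto simp: b_def)
    have xy: "fst (x \<otimes>\<^bsub>W\<^esub> y) a = f a \<otimes>\<^bsub>G\<^esub> f' b" "snd (x \<otimes>\<^bsub>W\<^esub> y) a = \<sigma> (\<tau> a)"
      using a \<sigma> \<tau> S T by (simp_all add: x_eq y_eq mult_W b_def)
    have nn: "0 \<le> l (f a)" "0 \<le> l (f' b)" and le: "l (f a \<otimes>\<^bsub>G\<^esub> f' b) \<le> 1"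
      using a b by (auto simp: l(2) len_le)
    show ?thesis
    proof (cases "b = a")
      case True
      then have "\<sigma> (\<tau> a) = a \<longleftrightarrow> \<tau> a = a"
        using b S(4)[OF a] S(4)[OF T(1)[OF a]] by metis
      with True b nn le show ?thesis
        unfolding b_def[symmetric] xy using l(4)[of "f a" "f' a"] a by (auto simp: x_eq y_eq)
    next
      case False
      then have "\<sigma> a \<noteq> a"
        using S(4)[OF a] S(4)[OF b(1)] b(2) by metis
      then show ?thesis
        unfolding b_def[symmetric] xy using nn le by (auto simp: x_eq y_eq)
    qed
  qed
  then have "(\<Sum>a\<in>A. point_length (x \<otimes>\<^bsub>W\<^esub> y) a) \<le>
      (\<Sum>a\<in>A. point_length x a + point_length y ((inv\<^bsub>BijGroup A\<^esub> \<sigma>) a))"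
    by (rule sum_mono)
  also have "\<dots> = (\<Sum>a\<in>A. point_length x a) + (\<Sum>a\<in>A. point_length y a)"
    by (simp only: sum.distrib sum.reindex_bij_betw[OF bij(2), of "point_length y"])
  finally show "wreath_length l A (x \<otimes>\<^bsub>W\<^esub> y) \<le> wreath_length l A x + wreath_length l A y"
    unfolding wreath_length_def by (simp add: divide_right_mono flip: add_divide_distrib)
qed

text \<open>At a good point the two permutations agree, so the quotient fixes it and its entry is
  the defect in \<open>G\<close>. That entry sits at \<open>\<rho> a\<close> because inversion in
  the wreath product shifts the coordinates by \<rho>. Bad points cost at most 1 each.\<close>

lemma wreath_length_defect_le:
  assumes "f \<in> A \<rightarrow>\<^sub>E carrier G" "f' \<in> A \<rightarrow>\<^sub>E carrier G"
    "\<rho> \<in> carrier (BijGroup A)" "\<sigma> \<in> carrier (BijGroup A)"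
    and "B \<subseteq> A" "0 \<le> \<delta>"
    and good: "\<And>a. a \<in> A - B \<Longrightarrow> \<rho> a = \<sigma> a \<and> l (inv\<^bsub>G\<^esub> (f (\<rho> a)) \<otimes>\<^bsub>G\<^esub> f' (\<rho> a)) \<le> \<delta>"
  shows "wreath_length l A (inv\<^bsub>W\<^esub> (f, \<rho>) \<otimes>\<^bsub>W\<^esub> (f', \<sigma>)) \<le> \<delta> + real (card B) / real (card A)"
proof -
  let ?x = "inv\<^bsub>W\<^esub> (f, \<rho>) \<otimes>\<^bsub>W\<^esub> (f', \<sigma>)"
  have car: "f a \<in> carrier G" "f' a \<in> carrier G" if "a \<in> A" for a
    using assms that by auto
  note R = BijGroup_simps[OF assms(3)]
  have inv: "inv\<^bsub>BijGroup A\<^esub> \<rho> \<in> carrier (BijGroup A)"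
    using assms by (simp add: group.inv_closed group_BijGroup)
  have x: "fst ?x a = inv\<^bsub>G\<^esub> (f (\<rho> a)) \<otimes>\<^bsub>G\<^esub> f' (\<rho> a)" "snd ?x a = (inv\<^bsub>BijGroup A\<^esub> \<rho>) (\<sigma> a)"
    if "a \<in> A" for a
    using that assms R inv BijGroup_simps(5)[OF inv that]
    by (simp_all add: inv_W mult_W group.inv_inv group_BijGroup)
  have "(\<Sum>a\<in>A. point_length ?x a) = (\<Sum>a\<in>A - B. point_length ?x a) + (\<Sum>a\<in>B. point_length ?x a)"
    using assms fin by (simp add: sum.subset_diff)
  also have "\<dots> \<le> (\<Sum>a\<in>A - B. \<delta>) + (\<Sum>a\<in>B. 1)"
  proof (intro add_mono sum_mono)
    fix a assume a: "a \<in> A - B"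
    then show "point_length ?x a \<le> \<delta>"
      using good[OF a] R(4)[of a] by (auto simp: x)
  next
    fix a assume "a \<in> B"
    then have "a \<in> A" "\<rho> a \<in> A"
      using assms R by auto
    then show "point_length ?x a \<le> 1"
      by (auto simp: x intro!: len_le car)
  qed
  also have "\<dots> \<le> \<delta> * real (card A) + real (card B)"
    using assms fin by (simp add: mult.commute mult_left_mono card_mono)
  finally have "wreath_length l A ?x \<le> (\<delta> * real (card A) + real (card B)) / real (card A)"
    unfolding wreath_length_def by (rule divide_right_mono) simp
  \<comment> \<open>An inequality rather than an equation because \<open>A\<close> may be empty,
    where the quotients are 0 but \<delta> remains.\<close>
  also have "\<dots> \<le> \<delta> + real (card B) / real (card A)"
    using \<open>0 \<le> \<delta>\<close> by (simp add: add_divide_distrib)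
  finally show ?thesis .
qed

end

section \<open>Approximation of semidirect products\<close>

text \<open>The errors below are points thrown out of \<open>S\<close> by a permutation; there are
  as many as points outside \<open>S\<close>.\<close>

lemma BijGroup_card_preimage:
  assumes "finite A" "\<sigma> \<in> carrier (BijGroup A)" "S \<subseteq> A"
  shows "card {a \<in> A. \<sigma> a \<notin> S} = card A - card S"
proof -
  have \<sigma>: "bij_betw \<sigma> A A"
    using assms by (simp add: BijGroup_def Bij_def)
  have "\<sigma> ` {a \<in> A. \<sigma> a \<notin> S} = A - S"
    using \<sigma> by (auto simp: bij_betw_def)
  moreover have "inj_on \<sigma> {a \<in> A. \<sigma> a \<notin> S}"
    using \<sigma> by (auto simp: bij_betw_def inj_on_def)
  ultimately have "card {a \<in> A. \<sigma> a \<notin> S} = card (A - S)"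
    by (metis card_image)
  then show ?thesis
    using assms by (simp add: card_Diff_subset finite_subset)
qed

text \<open>\<open>approx\<close> separates the construction of the model from the geometry of the
  action: the three wreath products differ only in how they meet it. It promises nothing about
  \<open>p s\<close> for \<open>s\<close> outside \<open>S\<close>; such points are absorbed as
  errors of small density.\<close>

lemma weakly_sofic_semidirect:
  fixes N :: "('n, 'c) monoid_scheme" and K :: "('k, 'd) monoid_scheme"
  assumes act: "hom_action N K \<theta>" and sofic: "weakly_sofic K"
    and approx: "\<And>F P \<epsilon>. \<lbrakk>finite F; F \<subseteq> carrier K; finite P; P \<subseteq> carrier N; 0 < \<epsilon>\<rbrakk> \<Longrightarrow>
      \<exists>(A :: nat set) \<phi> S (M :: 'm monoid) p. finite A \<and> unital_multiplicative K F \<epsilon> A \<phi> \<and>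
        S \<subseteq> A \<and> (1 - \<epsilon>) * real (card A) < real (card S) \<and> weakly_sofic M \<and>
        (\<forall>s\<in>S. p s \<in> hom N M \<and> (\<forall>n\<in>P. n \<noteq> \<one>\<^bsub>N\<^esub> \<longrightarrow> p s n \<noteq> \<one>\<^bsub>M\<^esub>)) \<and>
        (\<forall>g\<in>F. \<forall>n\<in>P. \<forall>s\<in>S. \<phi> g s \<in> S \<longrightarrow> p (\<phi> g s) (\<theta> g n) = p s n)"
  shows "weakly_sofic (semidirect N K \<theta>)"
proof -
  interpret hom_action N K \<theta> by fact
  let ?D = "semidirect N K \<theta>"
  show ?thesis
  proof (rule weakly_soficI[where c = "1 / 2" and 'k = "((nat \<Rightarrow> nat) \<times> (nat \<Rightarrow> nat)) \<times> nat"])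
    fix F and \<epsilon> :: real assume F: "finite F" "F \<subseteq> carrier ?D" and "0 < \<epsilon>"
    \<comment> \<open>The defect is at most \<delta> in \<open>G\<close>, 3\<delta> from bad points
      and less than \<delta> in the model of \<open>K\<close>, hence the division by 5. The cap 1/2
      puts at least half of \<open>A\<close> into \<open>S\<close>, which yields the separation
      constant 1/2.\<close>
    define \<delta> where "\<delta> = min (1 / 2) (\<epsilon> / 5)"
    have \<delta>: "0 < \<delta>" "\<delta> \<le> 1 / 2" "5 * \<delta> \<le> \<epsilon>"
      using \<open>0 < \<epsilon>\<close> by (auto simp: \<delta>_def)
    have FK: "finite (snd ` F)" "snd ` F \<subseteq> carrier K" and FN: "finite (fst ` F)" "fst ` F \<subseteq> carrier N"
      using F by (auto simp: semidirect_def)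
    obtain A :: "nat set" and \<phi> S and M :: "'m monoid" and p where
      *: "finite A \<and> unital_multiplicative K (snd ` F) \<delta> A \<phi> \<and>
        S \<subseteq> A \<and> (1 - \<delta>) * real (card A) < real (card S) \<and> weakly_sofic M \<and>
        (\<forall>s\<in>S. p s \<in> hom N M \<and> (\<forall>n\<in>fst ` F. n \<noteq> \<one>\<^bsub>N\<^esub> \<longrightarrow> p s n \<noteq> \<one>\<^bsub>M\<^esub>)) \<and>
        (\<forall>g\<in>snd ` F. \<forall>n\<in>fst ` F. \<forall>s\<in>S. \<phi> g s \<in> S \<longrightarrow> p (\<phi> g s) (\<theta> g n) = p s n)"
      using approx[OF FK FN \<delta>(1)] by (elim exE) (rule that)
    have "finite A" "S \<subseteq> A" and S_large: "(1 - \<delta>) * real (card A) < real (card S)"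
      and "weakly_sofic M"
      and um: "unital_multiplicative K (snd ` F) \<delta> A \<phi>"
      and p: "\<And>s. s \<in> S \<Longrightarrow> p s \<in> hom N M"
      and p_sep: "\<And>s n. \<lbrakk>s \<in> S; n \<in> fst ` F; n \<noteq> \<one>\<^bsub>N\<^esub>\<rbrakk> \<Longrightarrow> p s n \<noteq> \<one>\<^bsub>M\<^esub>"
      and p_equiv: "\<And>g n s. \<lbrakk>g \<in> snd ` F; n \<in> fst ` F; s \<in> S; \<phi> g s \<in> S\<rbrakk> \<Longrightarrow>
        p (\<phi> g s) (\<theta> g n) = p s n"
      using * by (simp_all del: ball_simps)
    have \<phi>: "g \<in> carrier K \<Longrightarrow> \<phi> g \<in> carrier (BijGroup A)" "\<phi> \<one>\<^bsub>K\<^esub> = \<one>\<^bsub>BijGroup A\<^esub>" for g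
      using um by (auto simp: unital_multiplicative_def)
    have "finite S"
      using \<open>finite A\<close> \<open>S \<subseteq> A\<close> finite_subset by blast
    \<comment> \<open>Strictness of \<open>S_large\<close> then makes \<open>S\<close>, and so
      \<open>A\<close>, nonempty, so that averages over \<open>A\<close> are genuine.\<close>
    have "0 \<le> (1 - \<delta>) * real (card A)"
      using \<delta> by simp
    then have cardS: "0 < card S" "card S \<le> card A"
      using S_large \<open>finite A\<close> \<open>S \<subseteq> A\<close> by (auto intro: card_mono)
    then have cardA: "0 < card A"
      by simp
    interpret M: group M
      using \<open>weakly_sofic M\<close> by (simp add: weakly_sofic_def)
    have p_closed [simp]: "s \<in> S \<Longrightarrow> n \<in> carrier N \<Longrightarrow> p s n \<in> carrier M" for s n
      using p by (auto simp: hom_def)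
    \<comment> \<open>The values for all \<open>s\<close> are collected before the model of
      \<open>M\<close> is chosen, since one model serves every coordinate.\<close>
    define T where "T = (\<lambda>(s, n). p s n) ` (S \<times> fst ` F)"
    have in_T: "p s n \<in> T" if "s \<in> S" "n \<in> fst ` F" for s n
      unfolding T_def using that by (intro image_eqI[of _ _ "(s, n)"]) auto
    have "finite T" "T \<subseteq> carrier M"
      using FN \<open>finite S\<close> F by (auto simp: T_def semidirect_def)
    from weakly_soficE[OF \<open>weakly_sofic M\<close> this \<delta>(1)]
    obtain G :: "nat monoid" and l \<psi> where "group G" and finG: "finite (carrier G)"
      and l: "length_function G l" and l_le: "\<And>x. x \<in> carrier G \<Longrightarrow> l x \<le> 1"
      and \<psi>: "\<psi> \<in> carrier M \<rightarrow> carrier G" "\<psi> \<one>\<^bsub>M\<^esub> = \<one>\<^bsub>G\<^esub>"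
      and \<psi>_mult: "\<And>g h. \<lbrakk>g \<in> T; h \<in> T; g \<otimes>\<^bsub>M\<^esub> h \<in> T\<rbrakk> \<Longrightarrow>
        l (inv\<^bsub>G\<^esub> (\<psi> (g \<otimes>\<^bsub>M\<^esub> h)) \<otimes>\<^bsub>G\<^esub> (\<psi> g \<otimes>\<^bsub>G\<^esub> \<psi> h)) < \<delta>"
      and \<psi>_sep: "\<And>g. \<lbrakk>g \<in> T; g \<noteq> \<one>\<^bsub>M\<^esub>\<rbrakk> \<Longrightarrow> l (\<psi> g) = 1"
      by metis
    from weakly_soficE[OF sofic FK \<delta>(1)]
    obtain Q :: "nat monoid" and lQ \<eta> where "group Q" and finQ: "finite (carrier Q)"
      and lQ: "length_function Q lQ"
      and \<eta>: "\<eta> \<in> carrier K \<rightarrow> carrier Q" "\<eta> \<one>\<^bsub>K\<^esub> = \<one>\<^bsub>Q\<^esub>"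
      and \<eta>_mult: "\<And>g h. \<lbrakk>g \<in> snd ` F; h \<in> snd ` F; g \<otimes>\<^bsub>K\<^esub> h \<in> snd ` F\<rbrakk> \<Longrightarrow>
        lQ (inv\<^bsub>Q\<^esub> (\<eta> (g \<otimes>\<^bsub>K\<^esub> h)) \<otimes>\<^bsub>Q\<^esub> (\<eta> g \<otimes>\<^bsub>Q\<^esub> \<eta> h)) < \<delta>"
      and \<eta>_sep: "\<And>g. \<lbrakk>g \<in> snd ` F; g \<noteq> \<one>\<^bsub>K\<^esub>\<rbrakk> \<Longrightarrow> lQ (\<eta> g) = 1"
      by metis
    interpret G: group G by fact
    interpret Q: group Q by fact
    interpret finite_wreath G A l
      using \<open>group G\<close> \<open>finite A\<close> l l_le
      by (simp add: finite_wreath_def finite_wreath_axioms_def)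
    interpret W: group W by (rule group_W)
    define R where "R = W \<times>\<times> Q"
    define L where "L = (\<lambda>x. wreath_length l A (fst x) + lQ (snd x))"
    \<comment> \<open>The identity is a mere default off \<open>S\<close>, where \<open>p a\<close>
      need not be a homomorphism.\<close>
    define u where "u = (\<lambda>n. \<lambda>a\<in>A. if a \<in> S then \<psi> (p a n) else \<one>\<^bsub>G\<^esub>)"
    define \<Phi> where "\<Phi> = (\<lambda>(n, g). ((u n, \<phi> g), \<eta> g))"
    interpret R: group R
      unfolding R_def by (rule DirProd_group) unfold_locales
    have u: "u n \<in> A \<rightarrow>\<^sub>E carrier G" if "n \<in> carrier N" for n
      using that by (auto simp: u_def intro!: funcset_mem[OF \<psi>(1)])
    have fst_snd: "fst \<in> hom R W" "snd \<in> hom R Q"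
      by (auto simp: hom_def R_def mult_DirProd')
    have L: "length_function R L"
      unfolding L_def
      by (intro length_function_add length_function_comp[OF length_function_wreath fst_snd(1)]
            length_function_comp[OF lQ fst_snd(2)]) unfold_locales
    show "\<exists>(R :: (((nat \<Rightarrow> nat) \<times> (nat \<Rightarrow> nat)) \<times> nat) monoid) L \<Phi>.
        group R \<and> finite (carrier R) \<and> length_function R L \<and>
        \<Phi> \<in> carrier ?D \<rightarrow> carrier R \<and> \<Phi> \<one>\<^bsub>?D\<^esub> = \<one>\<^bsub>R\<^esub> \<and>
        (\<forall>x\<in>F. \<forall>y\<in>F. x \<otimes>\<^bsub>?D\<^esub> y \<in> F \<longrightarrow>
          L (inv\<^bsub>R\<^esub> (\<Phi> (x \<otimes>\<^bsub>?D\<^esub> y)) \<otimes>\<^bsub>R\<^esub> (\<Phi> x \<otimes>\<^bsub>R\<^esub> \<Phi> y)) < \<epsilon>) \<and>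
        (\<forall>x\<in>F. x \<noteq> \<one>\<^bsub>?D\<^esub> \<longrightarrow> 1 / 2 \<le> L (\<Phi> x))"
    proof (intro exI[of _ R] exI[of _ L] exI[of _ \<Phi>] conjI ballI impI R.group_axioms L)
      show "finite (carrier R)"
        using finG finQ finite_W by (simp add: R_def)
      show "\<Phi> \<in> carrier ?D \<rightarrow> carrier R"
        using u \<phi> \<eta> by (auto simp: \<Phi>_def R_def semidirect_def carrier_W)
      have "u \<one>\<^bsub>N\<^esub> = (\<lambda>a\<in>A. \<one>\<^bsub>G\<^esub>)"
        using hom_one[OF p N.group_axioms M.group_axioms] \<psi> by (auto simp: u_def)
      then show "\<Phi> \<one>\<^bsub>?D\<^esub> = \<one>\<^bsub>R\<^esub>"
        by (simp add: \<Phi>_def R_def semidirect_def one_W \<phi> \<eta>)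
    next
      fix x y assume xy: "x \<in> F" "y \<in> F" "x \<otimes>\<^bsub>?D\<^esub> y \<in> F"
      obtain n g where x: "x = (n, g)" by fastforce
      obtain m h where y: "y = (m, h)" by fastforce
      have car: "n \<in> carrier N" "m \<in> carrier N" "g \<in> carrier K" "h \<in> carrier K"
        using xy F by (auto simp: x y semidirect_def)
      have prod: "x \<otimes>\<^bsub>?D\<^esub> y = (n \<otimes>\<^bsub>N\<^esub> \<theta> g m, g \<otimes>\<^bsub>K\<^esub> h)"
        by (simp add: x y semidirect_def)
      have inF: "n \<in> fst ` F" "m \<in> fst ` F" "n \<otimes>\<^bsub>N\<^esub> \<theta> g m \<in> fst ` F"
          "g \<in> snd ` F" "h \<in> snd ` F" "g \<otimes>\<^bsub>K\<^esub> h \<in> snd ` F"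
        using xy(1,2)[THEN imageI, of fst] xy(1,2)[THEN imageI, of snd]
          xy(3)[unfolded prod, THEN imageI, of fst] xy(3)[unfolded prod, THEN imageI, of snd]
        by (simp_all only: x y fst_conv snd_conv)
      let ?\<rho> = "\<phi> (g \<otimes>\<^bsub>K\<^esub> h)" and ?\<sigma> = "\<phi> g \<otimes>\<^bsub>BijGroup A\<^esub> \<phi> h"
      let ?f = "u (n \<otimes>\<^bsub>N\<^esub> \<theta> g m)"
      let ?f' = "\<lambda>a\<in>A. u n a \<otimes>\<^bsub>G\<^esub> u m ((inv\<^bsub>BijGroup A\<^esub> (\<phi> g)) a)"
      note \<phi>g = BijGroup_simps[OF \<phi>(1)[OF car(3)]] and \<phi>h = BijGroup_simps[OF \<phi>(1)[OF car(4)]]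
      have perm: "?\<rho> \<in> carrier (BijGroup A)" "?\<sigma> \<in> carrier (BijGroup A)"
        using car by (auto intro!: \<phi> monoid.m_closed group.is_monoid group_BijGroup)
      have f: "?f \<in> A \<rightarrow>\<^sub>E carrier G" "?f' \<in> A \<rightarrow>\<^sub>E carrier G"
        using car u[of n] u[of m] \<phi>g(2) by (auto intro!: u G.m_closed)
      \<comment> \<open>Three ways to be bad: \<open>\<phi>\<close> fails to be multiplicative at
        \<open>a\<close>, or the compared coordinate \<open>?\<rho> a\<close> or the intermediate
        point \<open>\<phi> h a\<close> lies outside \<open>S\<close>. No condition on
        \<open>a\<close> itself arises, because only the coordinates at these two points are
        evaluated.\<close>
      define B1 where "B1 = {a \<in> A. ?\<rho> a \<noteq> ?\<sigma> a}"
      define B2 where "B2 = {a \<in> A. ?\<rho> a \<notin> S}"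
      define B3 where "B3 = {a \<in> A. \<phi> h a \<notin> S}"
      have "hamming A ?\<rho> ?\<sigma> < \<delta>"
        using um inF by (auto simp: unital_multiplicative_def)
      moreover have "real (card {a \<in> A. ?\<rho> a = ?\<sigma> a}) + real (card B1) = real (card A)"
      proof -
        have "card ({a \<in> A. ?\<rho> a = ?\<sigma> a} \<union> B1) = card {a \<in> A. ?\<rho> a = ?\<sigma> a} + card B1"
          using \<open>finite A\<close> by (intro card_Un_disjoint) (auto simp: B1_def)
        moreover have "{a \<in> A. ?\<rho> a = ?\<sigma> a} \<union> B1 = A"
          by (auto simp: B1_def)
        ultimately show ?thesis
          by simp
      qed
      ultimately have B1: "real (card B1) \<le> \<delta> * real (card A)"
        using cardA by (simp add: hamming_def field_simps)
      have "card B2 = card A - card S" "card B3 = card A - card S"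
        unfolding B2_def B3_def using car \<open>finite A\<close> \<open>S \<subseteq> A\<close> \<phi>
        by (simp_all add: BijGroup_card_preimage)
      then have B23: "real (card B2) \<le> \<delta> * real (card A)" "real (card B3) \<le> \<delta> * real (card A)"
        using S_large cardS by (simp_all add: of_nat_diff algebra_simps)
      define B where "B = B1 \<union> B2 \<union> B3"
      have "card B \<le> card B1 + card B2 + card B3"
        unfolding B_def by (meson card_Un_le add_le_mono1 order_trans)
      then have "real (card B) \<le> 3 * \<delta> * real (card A)"
        using B1 B23 by simp
      then have B: "real (card B) / real (card A) \<le> 3 * \<delta>"
        using cardA by (simp add: field_simps)
      have "wreath_length l A (inv\<^bsub>W\<^esub> (?f, ?\<rho>) \<otimes>\<^bsub>W\<^esub> (?f', ?\<sigma>)) \<le> \<delta> + real (card B) / real (card A)"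
      proof (rule wreath_length_defect_le[OF f perm])
        show "B \<subseteq> A"
          by (auto simp: B_def B1_def B2_def B3_def)
        fix a assume a: "a \<in> A - B"
        then have eq: "?\<rho> a = ?\<sigma> a" and S: "?\<rho> a \<in> S" "\<phi> h a \<in> S" and "a \<in> A"
          by (auto simp: B_def B1_def B2_def B3_def)
        have \<sigma>: "?\<sigma> a = \<phi> g (\<phi> h a)"
          using \<open>a \<in> A\<close> car \<phi> BijGroup_simps(5) by metis
        define s where "s = \<phi> h a"
        have s: "s \<in> S" "s \<in> A" "\<phi> g s \<in> S" "\<phi> g s \<in> A"
          using S \<open>S \<subseteq> A\<close> eq \<sigma> by (auto simp: s_def)
        have \<rho>: "?\<rho> a = \<phi> g s"
          using eq \<sigma> by (simp add: s_def)
        \<comment> \<open>This is the twisted product of the wreath product at the point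
          \<open>\<phi> g s\<close>: its second factor is the entry of \<open>u m\<close> at the
          preimage \<open>s\<close>, and equivariance of \<open>p\<close> produces exactly
          \<open>p s m\<close>.\<close>
        have "p (\<phi> g s) (n \<otimes>\<^bsub>N\<^esub> \<theta> g m) = p (\<phi> g s) n \<otimes>\<^bsub>M\<^esub> p s m"
          using hom_mult[OF p[OF s(3)]] car p_equiv[OF inF(4,2) s(1,3)] by simp
        moreover have "p (\<phi> g s) n \<in> T" "p s m \<in> T" "p (\<phi> g s) (n \<otimes>\<^bsub>N\<^esub> \<theta> g m) \<in> T"
          using in_T s inF by auto
        ultimately have "l (inv\<^bsub>G\<^esub> (\<psi> (p (\<phi> g s) (n \<otimes>\<^bsub>N\<^esub> \<theta> g m))) \<otimes>\<^bsub>G\<^esub>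
            (\<psi> (p (\<phi> g s) n) \<otimes>\<^bsub>G\<^esub> \<psi> (p s m))) < \<delta>"
          using \<psi>_mult by simp
        then show "?\<rho> a = ?\<sigma> a \<and> l (inv\<^bsub>G\<^esub> (?f (?\<rho> a)) \<otimes>\<^bsub>G\<^esub> ?f' (?\<rho> a)) \<le> \<delta>"
          using eq s \<phi>g(4)[of s] by (simp add: \<rho> u_def)
      qed (use \<delta> in simp)
      then have "wreath_length l A (inv\<^bsub>W\<^esub> (?f, ?\<rho>) \<otimes>\<^bsub>W\<^esub> (?f', ?\<sigma>)) \<le> 4 * \<delta>"
        using B by simp
      moreover have "lQ (inv\<^bsub>Q\<^esub> (\<eta> (g \<otimes>\<^bsub>K\<^esub> h)) \<otimes>\<^bsub>Q\<^esub> (\<eta> g \<otimes>\<^bsub>Q\<^esub> \<eta> h)) < \<delta>"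
        using \<eta>_mult inF by simp
      moreover have "inv\<^bsub>R\<^esub> (\<Phi> (x \<otimes>\<^bsub>?D\<^esub> y)) \<otimes>\<^bsub>R\<^esub> (\<Phi> x \<otimes>\<^bsub>R\<^esub> \<Phi> y) =
          (inv\<^bsub>W\<^esub> (?f, ?\<rho>) \<otimes>\<^bsub>W\<^esub> (?f', ?\<sigma>), inv\<^bsub>Q\<^esub> (\<eta> (g \<otimes>\<^bsub>K\<^esub> h)) \<otimes>\<^bsub>Q\<^esub> (\<eta> g \<otimes>\<^bsub>Q\<^esub> \<eta> h))"
      proof -
        have "(?f, ?\<rho>) \<in> carrier W" "\<eta> (g \<otimes>\<^bsub>K\<^esub> h) \<in> carrier Q"
          using f perm \<eta> car by (auto simp: carrier_W)
        then have "inv\<^bsub>R\<^esub> ((?f, ?\<rho>), \<eta> (g \<otimes>\<^bsub>K\<^esub> h)) = (inv\<^bsub>W\<^esub> (?f, ?\<rho>), inv\<^bsub>Q\<^esub> (\<eta> (g \<otimes>\<^bsub>K\<^esub> h)))"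
          unfolding R_def by (rule inv_DirProd[OF W.group_axioms Q.group_axioms])
        then show ?thesis
          unfolding prod by (simp add: x y \<Phi>_def R_def mult_W)
      qed
      ultimately show "L (inv\<^bsub>R\<^esub> (\<Phi> (x \<otimes>\<^bsub>?D\<^esub> y)) \<otimes>\<^bsub>R\<^esub> (\<Phi> x \<otimes>\<^bsub>R\<^esub> \<Phi> y)) < \<epsilon>"
        using \<delta> by (simp add: L_def)
    next
      fix x assume x: "x \<in> F" "x \<noteq> \<one>\<^bsub>?D\<^esub>"
      obtain n g where ng: "x = (n, g)" by fastforce
      have car: "n \<in> carrier N" "g \<in> carrier K" and inF: "n \<in> fst ` F" "g \<in> snd ` F"
        using x(1) F imageI[OF x(1), of fst] imageI[OF x(1), of snd] by (auto simp: ng semidirect_def)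
      have Lx: "L (\<Phi> x) = wreath_length l A (u n, \<phi> g) + lQ (\<eta> g)"
        by (simp add: L_def \<Phi>_def ng)
      have W_ge: "0 \<le> wreath_length l A (u n, \<phi> g)"
        using length_functionD(2)[OF length_function_wreath] u \<phi> car by (simp add: carrier_W)
      have Q_ge: "0 \<le> lQ (\<eta> g)"
        using length_functionD(2)[OF lQ] \<eta> car by auto
      show "1 / 2 \<le> L (\<Phi> x)"
      proof (cases "g = \<one>\<^bsub>K\<^esub>")
        \<comment> \<open>Here \<open>\<phi> g\<close> may be the identity permutation, so the
          separation comes from the model of \<open>K\<close>.\<close>
        case False
        then show ?thesis
          using \<eta>_sep inF W_ge by (simp add: Lx)
      next
        case True
        then have "n \<noteq> \<one>\<^bsub>N\<^esub>"
          using x by (auto simp: ng semidirect_def)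
        \<comment> \<open>The permutation is now the identity, so every point of \<open>S\<close>
          shows the full length 1 of a nontrivial element of \<open>M\<close>.\<close>
        have "point_length (u n, \<phi> g) a = 1" if "a \<in> S" for a
        proof -
          have "p a n \<in> T"
            using that inF by (intro in_T)
          then show ?thesis
            using that True \<open>S \<subseteq> A\<close> \<psi>_sep p_sep[OF that inF(1) \<open>n \<noteq> \<one>\<^bsub>N\<^esub>\<close>]
            by (auto simp: u_def)
        qed
        moreover have W_pos: "0 \<le> point_length (u n, \<phi> g) a" if "a \<in> A" for a
          using length_functionD(2)[OF l PiE_mem[OF u[OF car(1)] that]] by simp
        ultimately have "real (card S) = (\<Sum>a\<in>S. point_length (u n, \<phi> g) a)"
          by (simp cong: sum.cong)
        also have "\<dots> \<le> (\<Sum>a\<in>A. point_length (u n, \<phi> g) a)"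
          using \<open>finite A\<close> \<open>S \<subseteq> A\<close> W_pos by (intro sum_mono2) auto
        finally have "real (card S) / real (card A) \<le> wreath_length l A (u n, \<phi> g)"
          unfolding wreath_length_def by (rule divide_right_mono) simp
        moreover have "1 / 2 * real (card A) \<le> (1 - \<delta>) * real (card A)"
          using \<delta> by (intro mult_right_mono) auto
        then have "1 / 2 * real (card A) \<le> real (card S)"
          using S_large by linarith
        then have "1 / 2 \<le> real (card S) / real (card A)"
          using cardA by (simp add: field_simps)
        ultimately show ?thesis
          unfolding Lx using Q_ge by linarith
      qed
    qed
  qed (use group_semidirect in simp_all)
qed

section \<open>Reduction to generators\<close>

lemma hom_eq_on_generate:
  assumes "group N" "group M" "f \<in> hom N M" "f' \<in> hom N M" "Y \<subseteq> carrier N"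
    and "\<And>y. y \<in> Y \<Longrightarrow> f y = f' y" "n \<in> generate N Y"
  shows "f n = f' n"
proof -
  interpret f: group_hom N M f
    using assms by (simp add: group_hom_def group_hom_axioms_def)
  interpret f': group_hom N M f'
    using assms by (simp add: group_hom_def group_hom_axioms_def)
  show ?thesis
    using assms(7)
  proof (induction rule: generate.induct)
    case (inv h)
    then show ?case
      using assms(5,6) by (metis f.hom_inv f'.hom_inv subsetD)
  next
    case (eng h1 h2)
    then show ?case
      using f.G.generate_in_carrier[OF assms(5)] by simp
  qed (use assms(6) in auto)
qed

text \<open>An element is a finite word in the generators, so finitely many indices suffice. They
  form the vertex set on which the sofic approximation is invoked.\<close>

lemma generate_UN_finite_support:
  assumes "group N" "n \<in> generate N (\<Union>x\<in>X. J x)"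
  shows "\<exists>E. finite E \<and> E \<subseteq> X \<and> n \<in> generate N (\<Union>x\<in>E. J x)"
  using assms(2)
proof (induction rule: generate.induct)
  case one
  then show ?case
    by (intro exI[of _ "{}"]) (auto intro: generate.one)
next
  case (incl h)
  then obtain x where "x \<in> X" "h \<in> J x"
    by auto
  then show ?case
    by (intro exI[of _ "{x}"]) (auto intro: generate.incl)
next
  case (inv h)
  then obtain x where "x \<in> X" "h \<in> J x"
    by auto
  then show ?case
    by (intro exI[of _ "{x}"]) (auto intro: generate.inv)
next
  case (eng h1 h2)
  then obtain E1 E2 where E: "finite E1" "E1 \<subseteq> X" "h1 \<in> generate N (\<Union>x\<in>E1. J x)"
      "finite E2" "E2 \<subseteq> X" "h2 \<in> generate N (\<Union>x\<in>E2. J x)"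
    by blast
  moreover have "generate N (\<Union>x\<in>E1. J x) \<subseteq> generate N (\<Union>x\<in>E1 \<union> E2. J x)"
      "generate N (\<Union>x\<in>E2. J x) \<subseteq> generate N (\<Union>x\<in>E1 \<union> E2. J x)"
    by (rule group.mono_generate[OF assms(1)]; blast)+
  ultimately show ?case
    by (intro exI[of _ "E1 \<union> E2"]) (auto intro: generate.eng)
qed

text \<open>Putting \<open>\<alpha> g x\<close> for the point removes the inverse from
  \<open>orbit_compatible\<close> and gives the covariant form that matches
  \<open>\<theta> g (j x h) = j (\<alpha> g x) h\<close>.\<close>

lemma orbit_compatibleD:
  assumes "orbit_compatible X \<alpha> F E \<phi> S \<pi>" "group_action K X \<alpha>" "F \<subseteq> carrier K" "E \<subseteq> X"
    and "g \<in> F" "x \<in> E" "s \<in> S" "\<phi> g s \<in> S" "\<alpha> g x \<in> E"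
  shows "\<pi> (\<phi> g s) (\<alpha> g x) = \<pi> s x"
proof -
  interpret group_action K X \<alpha> by fact
  have "\<alpha> g \<in> carrier (BijGroup X)"
    using assms bij_prop0 by (auto simp: BijGroup_def)
  then have "(inv\<^bsub>BijGroup X\<^esub> (\<alpha> g)) (\<alpha> g x) = x"
    using assms by (auto intro: BijGroup_simps(4))
  then show ?thesis
    using assms by (auto simp: orbit_compatible_def)
qed

text \<open>The common criterion for direct sums, free products and graph products, with
  \<open>C\<close> the carrier of \<open>H\<close> and \<open>j x\<close> the inclusion of the copy
  at \<open>x\<close>. Equivariance comes from \<open>i\<close> not depending on \<open>s\<close>:
  the images of \<open>j x h\<close> under \<open>p s\<close> and of
  \<open>j (\<alpha> g x) h\<close> under \<open>p (\<phi> g s)\<close> are \<open>i\<close> at the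
  same vertex of \<open>B\<close>. The map \<open>q\<close> witnesses that \<open>p\<close> kills
  nothing over \<open>E\<close>.\<close>

lemma weakly_sofic_semidirect_generated:
  fixes N :: "('n, 'c) monoid_scheme" and K :: "('k, 'd) monoid_scheme"
    and j :: "'x \<Rightarrow> 'h \<Rightarrow> 'n"
  assumes act: "hom_action N K \<theta>" and sofic: "weakly_sofic K" and "group_action K X \<alpha>"
    and gen: "carrier N = generate N (\<Union>x\<in>X. j x ` C)"
    and j_closed: "\<And>x h. \<lbrakk>x \<in> X; h \<in> C\<rbrakk> \<Longrightarrow> j x h \<in> carrier N"
    and equiv: "\<And>g x h. \<lbrakk>g \<in> carrier K; x \<in> X; h \<in> C\<rbrakk> \<Longrightarrow> \<theta> g (j x h) = j (\<alpha> g x) h"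
    and approx: "\<And>F E \<epsilon>. \<lbrakk>finite F; F \<subseteq> carrier K; finite E; E \<subseteq> X; 0 < \<epsilon>\<rbrakk> \<Longrightarrow>
      \<exists>(A :: nat set) \<phi> S (\<pi> :: nat \<Rightarrow> 'x \<Rightarrow> nat) (M :: 'm monoid) i.
        finite A \<and> unital_multiplicative K F \<epsilon> A \<phi> \<and>
        S \<subseteq> A \<and> (1 - \<epsilon>) * real (card A) < real (card S) \<and>
        orbit_compatible X \<alpha> F E \<phi> S \<pi> \<and> weakly_sofic M \<and>
        (\<forall>s\<in>S. \<exists>p\<in>hom N M. \<exists>q\<in>hom M N. \<forall>x\<in>E. \<forall>h\<in>C.
          p (j x h) = i (\<pi> s x) h \<and> q (i (\<pi> s x) h) = j x h)"
  shows "weakly_sofic (semidirect N K \<theta>)"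
proof (rule weakly_sofic_semidirect[OF act sofic])
  interpret hom_action N K \<theta> by fact
  interpret X: group_action K X \<alpha> by fact
  fix F P and \<epsilon> :: real
  assume F: "finite F" "F \<subseteq> carrier K" and P: "finite P" "P \<subseteq> carrier N" and "0 < \<epsilon>"
  have "\<exists>E. finite E \<and> E \<subseteq> X \<and> n \<in> generate N (\<Union>x\<in>E. j x ` C)" if "n \<in> P" for n
    using that P gen by (intro generate_UN_finite_support N.group_axioms) auto
  then obtain supp where supp: "\<And>n. n \<in> P \<Longrightarrow> finite (supp n)" "\<And>n. n \<in> P \<Longrightarrow> supp n \<subseteq> X"
      "\<And>n. n \<in> P \<Longrightarrow> n \<in> generate N (\<Union>x\<in>supp n. j x ` C)"
    by metis
  define E0 where "E0 = (\<Union>n\<in>P. supp n)"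
  \<comment> \<open>The words of \<open>P\<close> live over \<open>E0\<close>, but compatibility
    compares \<open>x\<close> with \<open>\<alpha> g x\<close>, so the translates by
    \<open>F\<close> are included.\<close>
  define E where "E = E0 \<union> (\<Union>g\<in>F. \<alpha> g ` E0)"
  have E0: "finite E0" "E0 \<subseteq> X"
    using supp P by (auto simp: E0_def)
  have E: "finite E" "E \<subseteq> X"
    using E0 F X.element_image by (auto simp: E_def) blast
  have P_gen: "n \<in> generate N (\<Union>x\<in>E0. j x ` C)" if "n \<in> P" for n
  proof -
    have "generate N (\<Union>x\<in>supp n. j x ` C) \<subseteq> generate N (\<Union>x\<in>E0. j x ` C)"
      using that by (intro N.mono_generate) (auto simp: E0_def)
    then show ?thesis
      using supp(3)[OF that] by blast
  qed
  have gen_closed: "(\<Union>x\<in>E0. j x ` C) \<subseteq> carrier N"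
    using E0 j_closed by auto
  obtain A :: "nat set" and \<phi> S and \<pi> :: "nat \<Rightarrow> 'x \<Rightarrow> nat" and M :: "'m monoid" and i where
    *: "finite A \<and> unital_multiplicative K F \<epsilon> A \<phi> \<and>
      S \<subseteq> A \<and> (1 - \<epsilon>) * real (card A) < real (card S) \<and>
      orbit_compatible X \<alpha> F E \<phi> S \<pi> \<and> weakly_sofic M \<and>
      (\<forall>s\<in>S. \<exists>p\<in>hom N M. \<exists>q\<in>hom M N. \<forall>x\<in>E. \<forall>h\<in>C.
        p (j x h) = i (\<pi> s x) h \<and> q (i (\<pi> s x) h) = j x h)"
    using approx[OF F E \<open>0 < \<epsilon>\<close>] by (elim exE) (rule that)
  then have ex: "\<forall>s\<in>S. \<exists>p q. p \<in> hom N M \<and> q \<in> hom M N \<and>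
      (\<forall>x\<in>E. \<forall>h\<in>C. p (j x h) = i (\<pi> s x) h \<and> q (i (\<pi> s x) h) = j x h)"
    unfolding Bex_def by blast
  obtain p where ex': "\<forall>s\<in>S. \<exists>q. p s \<in> hom N M \<and> q \<in> hom M N \<and>
      (\<forall>x\<in>E. \<forall>h\<in>C. p s (j x h) = i (\<pi> s x) h \<and> q (i (\<pi> s x) h) = j x h)"
    using bchoice[OF ex] by (elim exE) (rule that)
  obtain q where pq: "\<forall>s\<in>S. p s \<in> hom N M \<and> q s \<in> hom M N \<and>
      (\<forall>x\<in>E. \<forall>h\<in>C. p s (j x h) = i (\<pi> s x) h \<and> q s (i (\<pi> s x) h) = j x h)"
    using bchoice[OF ex'] by (elim exE) (rule that)
  then have p: "s \<in> S \<Longrightarrow> p s \<in> hom N M" and q: "s \<in> S \<Longrightarrow> q s \<in> hom M N"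
    and pi: "\<lbrakk>s \<in> S; x \<in> E; h \<in> C\<rbrakk> \<Longrightarrow> p s (j x h) = i (\<pi> s x) h"
    and qi: "\<lbrakk>s \<in> S; x \<in> E; h \<in> C\<rbrakk> \<Longrightarrow> q s (i (\<pi> s x) h) = j x h" for s x h
    by simp_all
  have oc: "orbit_compatible X \<alpha> F E \<phi> S \<pi>"
    using * by simp
  have qp: "\<lbrakk>s \<in> S; x \<in> E; h \<in> C\<rbrakk> \<Longrightarrow> q s (p s (j x h)) = j x h"
    and pj: "\<lbrakk>g \<in> F; x \<in> E; s \<in> S; \<phi> g s \<in> S; \<alpha> g x \<in> E; h \<in> C\<rbrakk> \<Longrightarrow>
      p (\<phi> g s) (j (\<alpha> g x) h) = p s (j x h)" for s x h g
    using pi qi orbit_compatibleD[OF oc assms(3) F(2) E(2)] by simp_all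
  interpret M: group M
    using * by (simp add: weakly_sofic_def)
  have "p s n \<noteq> \<one>\<^bsub>M\<^esub>" if s: "s \<in> S" and n: "n \<in> P" "n \<noteq> \<one>\<^bsub>N\<^esub>" for s n
  proof -
    \<comment> \<open>\<open>q s\<close> undoes \<open>p s\<close> on the generators over
      \<open>E0\<close>, hence on \<open>n\<close>; if \<open>p s n\<close> were trivial, so would
      be \<open>n\<close>.\<close>
    have "(q s \<circ> p s) n = id n"
    proof (rule hom_eq_on_generate[OF N.group_axioms N.group_axioms _ _ gen_closed _ P_gen[OF n(1)]])
      show "q s \<circ> p s \<in> hom N N"
        using p[OF s] q[OF s] by (rule hom_compose)
    qed (use qp[OF s] in \<open>auto simp: hom_def E_def\<close>)
    then show ?thesis
      using n(2) hom_one[OF q[OF s] M.group_axioms N.group_axioms] by auto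
  qed
  moreover have "p (\<phi> g s) (\<theta> g n) = p s n"
    if gs: "g \<in> F" "s \<in> S" "\<phi> g s \<in> S" and n: "n \<in> P" for g s n
  proof -
    have g: "g \<in> carrier K"
      using gs F by auto
    have "(p (\<phi> g s) \<circ> \<theta> g) n = p s n"
    proof (rule hom_eq_on_generate[OF N.group_axioms M.group_axioms _ p[OF gs(2)] gen_closed _ P_gen[OF n]])
      show "p (\<phi> g s) \<circ> \<theta> g \<in> hom N M"
        using action_hom[OF g] p[OF gs(3)] by (rule hom_compose)
      fix y assume "y \<in> (\<Union>x\<in>E0. j x ` C)"
      then obtain x h where y: "x \<in> E0" "h \<in> C" "y = j x h"
        by auto
      then have "x \<in> E" "\<alpha> g x \<in> E" "x \<in> X"
        using E0 gs(1) by (auto simp: E_def)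
      then show "(p (\<phi> g s) \<circ> \<theta> g) y = p s y"
        using y g gs pj by (simp add: equiv)
    qed
    then show ?thesis
      by simp
  qed
  ultimately show "\<exists>(A :: nat set) \<phi> S (M :: 'm monoid) p. finite A \<and> unital_multiplicative K F \<epsilon> A \<phi> \<and>
        S \<subseteq> A \<and> (1 - \<epsilon>) * real (card A) < real (card S) \<and> weakly_sofic M \<and>
        (\<forall>s\<in>S. p s \<in> hom N M \<and> (\<forall>n\<in>P. n \<noteq> \<one>\<^bsub>N\<^esub> \<longrightarrow> p s n \<noteq> \<one>\<^bsub>M\<^esub>)) \<and>
        (\<forall>g\<in>F. \<forall>n\<in>P. \<forall>s\<in>S. \<phi> g s \<in> S \<longrightarrow> p (\<phi> g s) (\<theta> g n) = p s n)"
    using * p by - (rule exI[of _ A], rule exI[of _ \<phi>], rule exI[of _ S], rule exI[of _ M], rule exI[of _ p],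
        (intro conjI ballI impI; simp))
qed

section \<open>Direct sums\<close>

text \<open>The model is a power of a model of \<open>H\<close> with the sum of the lengths: one
  nontrivial coordinate already contributes 1, and the defects add up over finitely many
  coordinates. The sum may exceed 1, which \<open>weakly_soficI\<close> permits.\<close>

lemma weakly_sofic_sum_group:
  fixes B :: "'b set"
  assumes "finite B" "weakly_sofic (H :: ('h, 'c) monoid_scheme)"
  shows "weakly_sofic (sum_group B (\<lambda>_. H))"
proof (rule weakly_soficI[where c = 1 and 'k = "'b \<Rightarrow> nat"])
  interpret H: group H
    using assms by (simp add: weakly_sofic_def)
  let ?N = "sum_group B (\<lambda>_. H)"
  show "group ?N"
    by (simp add: H.group_axioms)
  have car: "carrier ?N = B \<rightarrow>\<^sub>E carrier H"
    using assms by (simp add: carrier_sum_group H.group_axioms)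
  fix F and \<epsilon> :: real assume F: "finite F" "F \<subseteq> carrier ?N" and "0 < \<epsilon>"
  define T where "T = (\<Union>f\<in>F. f ` B)"
  \<comment> \<open>The extra 1 in the denominator covers an empty \<open>B\<close> and makes the
    total defect strictly less than \<epsilon>.\<close>
  have T: "finite T" "T \<subseteq> carrier H" and \<delta>: "0 < \<epsilon> / (1 + real (card B))"
    using F assms(1) \<open>0 < \<epsilon>\<close> by (auto simp: T_def car)
  obtain G :: "nat monoid" and l \<psi> where "group G" and finG: "finite (carrier G)"
    and l: "length_function G l"
    and \<psi>: "\<psi> \<in> carrier H \<rightarrow> carrier G" "\<psi> \<one>\<^bsub>H\<^esub> = \<one>\<^bsub>G\<^esub>"
    and \<psi>_mult: "\<And>g h. \<lbrakk>g \<in> T; h \<in> T; g \<otimes>\<^bsub>H\<^esub> h \<in> T\<rbrakk> \<Longrightarrow>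
      l (inv\<^bsub>G\<^esub> (\<psi> (g \<otimes>\<^bsub>H\<^esub> h)) \<otimes>\<^bsub>G\<^esub> (\<psi> g \<otimes>\<^bsub>G\<^esub> \<psi> h)) < \<epsilon> / (1 + real (card B))"
    and \<psi>_sep: "\<And>g. \<lbrakk>g \<in> T; g \<noteq> \<one>\<^bsub>H\<^esub>\<rbrakk> \<Longrightarrow> l (\<psi> g) = 1"
    using weakly_soficE[OF assms(2) T \<delta>] by metis
  interpret G: group G by fact
  define R where "R = product_group B (\<lambda>_. G)"
  define L where "L = (\<lambda>f. \<Sum>b\<in>B. l (f b))"
  define \<Phi> where "\<Phi> = (\<lambda>f. \<lambda>b\<in>B. \<psi> (f b))"
  have R: "group R" "finite (carrier R)"
    using assms(1) finG by (simp_all add: R_def G.group_axioms finite_PiE)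
  note ld = length_functionD[OF l]
  have L: "length_function R L"
    unfolding length_function_def
  proof (intro conjI ballI)
    show "L \<one>\<^bsub>R\<^esub> = 0"
      by (simp add: L_def R_def ld(1))
    fix x assume x: "x \<in> carrier R"
    then have xb: "b \<in> B \<Longrightarrow> x b \<in> carrier G" for b
      by (auto simp: R_def)
    then show "0 \<le> L x"
      by (auto simp: L_def ld(2) intro: sum_nonneg)
    have "inv\<^bsub>R\<^esub> x = (\<lambda>b\<in>B. inv\<^bsub>G\<^esub> (x b))"
      using x by (simp add: R_def G.group_axioms)
    then show "L (inv\<^bsub>R\<^esub> x) = L x"
      using xb by (simp add: L_def ld(3))
    fix y assume "y \<in> carrier R"
    then have yb: "b \<in> B \<Longrightarrow> y b \<in> carrier G" for b
      by (auto simp: R_def)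
    show "L (x \<otimes>\<^bsub>R\<^esub> y) \<le> L x + L y"
      using xb yb by (auto simp: L_def R_def ld(4) simp flip: sum.distrib intro!: sum_mono)
    show "L (x \<otimes>\<^bsub>R\<^esub> y) = L (y \<otimes>\<^bsub>R\<^esub> x)"
      using xb yb by (auto simp: L_def R_def ld(5) intro!: sum.cong)
  qed
  have in_T: "f \<in> F \<Longrightarrow> b \<in> B \<Longrightarrow> f b \<in> T" for f b
    by (auto simp: T_def)
  have mult: "L (inv\<^bsub>R\<^esub> (\<Phi> (f \<otimes>\<^bsub>?N\<^esub> f')) \<otimes>\<^bsub>R\<^esub> (\<Phi> f \<otimes>\<^bsub>R\<^esub> \<Phi> f')) < \<epsilon>"
    if f: "f \<in> F" "f' \<in> F" "f \<otimes>\<^bsub>?N\<^esub> f' \<in> F" for f f'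
  proof -
    have "\<Phi> (f \<otimes>\<^bsub>?N\<^esub> f') \<in> B \<rightarrow>\<^sub>E carrier G"
      using f F \<psi>(1) unfolding car by (fastforce simp: \<Phi>_def)
    then have "L (inv\<^bsub>R\<^esub> (\<Phi> (f \<otimes>\<^bsub>?N\<^esub> f')) \<otimes>\<^bsub>R\<^esub> (\<Phi> f \<otimes>\<^bsub>R\<^esub> \<Phi> f')) =
      (\<Sum>b\<in>B. l (inv\<^bsub>G\<^esub> (\<psi> (f b \<otimes>\<^bsub>H\<^esub> f' b)) \<otimes>\<^bsub>G\<^esub> (\<psi> (f b) \<otimes>\<^bsub>G\<^esub> \<psi> (f' b))))"
      by (simp add: L_def R_def \<Phi>_def G.group_axioms)
    also have "\<dots> \<le> (\<Sum>b\<in>B. \<epsilon> / (1 + real (card B)))"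
    proof (rule sum_mono)
      fix b assume "b \<in> B"
      then show "l (inv\<^bsub>G\<^esub> (\<psi> (f b \<otimes>\<^bsub>H\<^esub> f' b)) \<otimes>\<^bsub>G\<^esub> (\<psi> (f b) \<otimes>\<^bsub>G\<^esub> \<psi> (f' b))) \<le> \<epsilon> / (1 + real (card B))"
        using in_T[OF f(1)] in_T[OF f(2)] in_T[OF f(3), of b] by (intro less_imp_le \<psi>_mult) auto
    qed
    also have "\<dots> < \<epsilon>"
      using \<open>0 < \<epsilon>\<close> by (simp add: field_simps)
    finally show ?thesis .
  qed
  have sep: "1 \<le> L (\<Phi> f)" if f: "f \<in> F" "f \<noteq> \<one>\<^bsub>?N\<^esub>" for f
  proof -
    have "f \<in> B \<rightarrow>\<^sub>E carrier H"
      using f F car by auto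
    then obtain b where b: "b \<in> B" "f b \<noteq> \<one>\<^bsub>H\<^esub>"
      using f(2) by (auto simp: fun_eq_iff PiE_iff extensional_def split: if_splits)
    then have "l (\<Phi> f b) = 1"
      using \<psi>_sep[OF in_T[OF f(1)]] by (simp add: \<Phi>_def)
    moreover have "\<Phi> f c \<in> carrier G" if "c \<in> B" for c
      using that \<open>f \<in> B \<rightarrow>\<^sub>E carrier H\<close> \<psi> by (auto simp: \<Phi>_def)
    ultimately show ?thesis
      unfolding L_def using b assms(1) ld(2) member_le_sum[of b B "\<lambda>b. l (\<Phi> f b)"] by auto
  qed
  have \<Phi>: "\<Phi> \<in> carrier ?N \<rightarrow> carrier R" "\<Phi> \<one>\<^bsub>?N\<^esub> = \<one>\<^bsub>R\<^esub>"
    using \<psi> by (auto simp: car R_def \<Phi>_def)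
  show "\<exists>(R :: ('b \<Rightarrow> nat) monoid) L \<Phi>. group R \<and> finite (carrier R) \<and> length_function R L \<and>
      \<Phi> \<in> carrier ?N \<rightarrow> carrier R \<and> \<Phi> \<one>\<^bsub>?N\<^esub> = \<one>\<^bsub>R\<^esub> \<and>
      (\<forall>f\<in>F. \<forall>f'\<in>F. f \<otimes>\<^bsub>?N\<^esub> f' \<in> F \<longrightarrow>
        L (inv\<^bsub>R\<^esub> (\<Phi> (f \<otimes>\<^bsub>?N\<^esub> f')) \<otimes>\<^bsub>R\<^esub> (\<Phi> f \<otimes>\<^bsub>R\<^esub> \<Phi> f')) < \<epsilon>) \<and>
      (\<forall>f\<in>F. f \<noteq> \<one>\<^bsub>?N\<^esub> \<longrightarrow> 1 \<le> L (\<Phi> f))"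
    by (intro exI[of _ R] exI[of _ L] exI[of _ \<Phi>] conjI ballI impI)
      (rule R L \<Phi> mult sep | assumption)+
qed simp

text \<open>Coordinates are split off one at a time. The induction runs over a finite set containing
  the support, so that a removed coordinate may be trivial already.\<close>

lemma generate_sum_group:
  assumes "group H"
  shows "carrier (sum_group X (\<lambda>_. H)) =
    generate (sum_group X (\<lambda>_. H)) (\<Union>x\<in>X. (\<lambda>h. \<lambda>y\<in>X. if y = x then h else \<one>\<^bsub>H\<^esub>) ` carrier H)"
    (is "carrier ?N = generate ?N ?J")
proof -
  interpret H: group H by fact
  interpret N: group ?N by (simp add: assms)
  have car: "carrier ?N = {f \<in> X \<rightarrow>\<^sub>E carrier H. finite {x \<in> X. f x \<noteq> \<one>\<^bsub>H\<^esub>}}"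
    by (simp add: carrier_sum_group assms)
  have J: "?J \<subseteq> carrier ?N"
    by (auto simp: car intro: finite_subset[of _ "{_}"])
  have "f \<in> generate ?N ?J" if "finite S" "S \<subseteq> X" "f \<in> X \<rightarrow>\<^sub>E carrier H" "\<And>x. x \<in> X - S \<Longrightarrow> f x = \<one>\<^bsub>H\<^esub>" for S f
    using that
  proof (induction S arbitrary: f rule: finite_induct)
    case empty
    then have "f = \<one>\<^bsub>?N\<^esub>"
      by (auto simp: fun_eq_iff PiE_iff extensional_def)
    then show ?case
      by (simp only: generate.one)
  next
    case (insert x S)
    then have x: "x \<in> X"
      by simp
    define f' where "f' = f(x := \<one>\<^bsub>H\<^esub>)"
    have "f' \<in> generate ?N ?J"
    proof (rule insert.IH)
      show "f' \<in> X \<rightarrow>\<^sub>E carrier H"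
        using insert.prems x by (auto simp: f'_def PiE_iff extensional_def)
    qed (use insert.prems in \<open>auto simp: f'_def\<close>)
    moreover have "(\<lambda>y\<in>X. if y = x then f x else \<one>\<^bsub>H\<^esub>) \<in> generate ?N ?J"
      using insert.prems x by (intro generate.incl) auto
    moreover have "f = (\<lambda>y\<in>X. if y = x then f x else \<one>\<^bsub>H\<^esub>) \<otimes>\<^bsub>?N\<^esub> f'"
    proof
      fix y show "f y = ((\<lambda>y\<in>X. if y = x then f x else \<one>\<^bsub>H\<^esub>) \<otimes>\<^bsub>?N\<^esub> f') y"
        using insert.prems x by (cases "y \<in> X") (auto simp: f'_def PiE_iff extensional_def)
    qed
    ultimately show ?case
      by (metis generate.eng)
  qed
  then have "carrier ?N \<subseteq> generate ?N ?J"
    by (force simp: car)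
  then show ?thesis
    using N.generate_incl[OF J] by blast
qed

text \<open>Pullback along a partial map, extended by the identity. Both \<open>p\<close> and
  \<open>q\<close> of the criterion are instances, with \<open>t\<close> the inverse of
  \<open>\<pi> s\<close> and \<open>\<pi> s\<close> itself; finiteness of \<open>E\<close> keeps
  supports finite.\<close>

lemma sum_group_reindex_hom:
  assumes "group H" "finite E" "E \<subseteq> W" "t \<in> E \<rightarrow> X"
  shows "(\<lambda>f. \<lambda>w\<in>W. if w \<in> E then f (t w) else \<one>\<^bsub>H\<^esub>) \<in> hom (sum_group X (\<lambda>_. H)) (sum_group W (\<lambda>_. H))"
proof -
  interpret H: group H by fact
  have "finite {w \<in> W. (w \<in> E \<longrightarrow> f (t w) \<noteq> \<one>\<^bsub>H\<^esub>) \<and> w \<in> E}" for f :: "_ \<Rightarrow> 'a"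
    using assms(2) by (rule rev_finite_subset) auto
  then show ?thesis
    using assms by (auto simp: hom_def carrier_sum_group Pi_iff PiE_iff intro!: restrict_ext)
qed

text \<open>The group over \<open>B\<close> can be formed from \<open>H\<close> directly, without a
  copy in another type, because its weak soficity is proved above and not taken from a
  hypothesis.\<close>

lemma weakly_sofic_wreath:
  fixes X :: "'x set"
  assumes \<Gamma>: "weakly_sofic (\<Gamma> :: ('g, 'd) monoid_scheme)" and H: "weakly_sofic (H :: ('h, 'c) monoid_scheme)"
    and \<alpha>: "sofic_action \<Gamma> X \<alpha>"
  shows "weakly_sofic (wreath H \<Gamma> X \<alpha>)"
  unfolding wreath_def
proof (rule weakly_sofic_semidirect_generated[where 'm = "nat \<Rightarrow> 'h"])
  interpret H: group H
    using H by (simp add: weakly_sofic_def)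
  show ga: "group_action \<Gamma> X \<alpha>"
    using \<alpha> by (simp add: sofic_action_def)
  interpret X: group_action \<Gamma> X \<alpha> by fact
  let ?N = "sum_group X (\<lambda>_. H)" and ?j = "\<lambda>x h. \<lambda>y\<in>X. if y = x then h else \<one>\<^bsub>H\<^esub>"
  show "hom_action ?N \<Gamma> (sum_perm X \<alpha>)"
    by (rule hom_action_sum_perm[OF H.group_axioms ga])
  show "carrier ?N = generate ?N (\<Union>x\<in>X. ?j x ` carrier H)"
    by (rule generate_sum_group[OF H.group_axioms])
  show "?j x h \<in> carrier ?N" if "x \<in> X" "h \<in> carrier H" for x h
    using that by (auto simp: carrier_sum_group H.group_axioms intro: finite_subset[of _ "{x}"])
  show "sum_perm X \<alpha> g (?j x h) = ?j (\<alpha> g x) h" if g: "g \<in> carrier \<Gamma>" and "x \<in> X" "h \<in> carrier H" for g x h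
  proof -
    have "\<alpha> g \<in> carrier (BijGroup X)"
      using X.bij_prop0[OF g] by (simp add: BijGroup_def)
    note B = BijGroup_simps[OF this]
    show ?thesis
      using that B by (auto simp: sum_perm_def intro!: restrict_ext)
  qed
  fix F E and \<epsilon> :: real
  assume F: "finite F" "F \<subseteq> carrier \<Gamma>" and E: "finite E" "E \<subseteq> X" and "0 < \<epsilon>"
  then obtain A :: "nat set" and \<phi> where A: "finite A" "unital_multiplicative \<Gamma> F \<epsilon> A \<phi>" "orbit_approx X \<alpha> F E \<epsilon> A \<phi>"
    using \<alpha> unfolding sofic_action_def by meson
  then obtain B :: "nat set" and S \<pi> where B: "finite B" "S \<subseteq> A" "real (card S) > (1 - \<epsilon>) * real (card A)"
    and \<pi>: "\<And>s. s \<in> S \<Longrightarrow> \<pi> s \<in> E \<rightarrow> B" "\<And>s. s \<in> S \<Longrightarrow> inj_on (\<pi> s) E" and oc: "orbit_compatible X \<alpha> F E \<phi> S \<pi>"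
    unfolding orbit_approx_def by metis
  let ?M = "sum_group B (\<lambda>_. H)"
  define i where "i = (\<lambda>c h. \<lambda>b\<in>B. if b = c then h else \<one>\<^bsub>H\<^esub>)"
  have "\<exists>p\<in>hom ?N ?M. \<exists>q\<in>hom ?M ?N. \<forall>x\<in>E. \<forall>h\<in>carrier H.
      p (?j x h) = i (\<pi> s x) h \<and> q (i (\<pi> s x) h) = ?j x h" if s: "s \<in> S" for s
  proof (intro bexI ballI conjI)
    let ?t = "inv_into E (\<pi> s)"
    have t: "?t (\<pi> s y) = y" if "y \<in> E" for y
      using \<pi>(2)[OF s] that by simp
    have EX: "y \<in> X" if "y \<in> E" for y
      using E that by blast
    show "(\<lambda>f. \<lambda>b\<in>B. if b \<in> \<pi> s ` E then f (?t b) else \<one>\<^bsub>H\<^esub>) \<in> hom ?N ?M"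
      using \<pi>(1)[OF s] E
      by (intro sum_group_reindex_hom H.group_axioms) (auto intro!: subsetD[OF E(2)] inv_into_into)
    show "(\<lambda>f. \<lambda>x\<in>X. if x \<in> E then f (\<pi> s x) else \<one>\<^bsub>H\<^esub>) \<in> hom ?M ?N"
      using \<pi>(1)[OF s] E by (intro sum_group_reindex_hom H.group_axioms) auto
    fix x h assume "x \<in> E"
    then show "(\<lambda>b\<in>B. if b \<in> \<pi> s ` E then ?j x h (?t b) else \<one>\<^bsub>H\<^esub>) = i (\<pi> s x) h"
      using t EX by (auto simp: i_def intro!: restrict_ext)
    show "(\<lambda>y\<in>X. if y \<in> E then i (\<pi> s x) h (\<pi> s y) else \<one>\<^bsub>H\<^esub>) = ?j x h"
      using \<open>x \<in> E\<close> \<pi>(1)[OF s] \<pi>(2)[OF s] by (auto simp: i_def inj_on_def intro!: restrict_ext)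
  qed
  then show "\<exists>(A :: nat set) \<phi> S (\<pi> :: nat \<Rightarrow> 'x \<Rightarrow> nat) (M :: (nat \<Rightarrow> 'h) monoid) i.
      finite A \<and> unital_multiplicative \<Gamma> F \<epsilon> A \<phi> \<and>
      S \<subseteq> A \<and> (1 - \<epsilon>) * real (card A) < real (card S) \<and>
      orbit_compatible X \<alpha> F E \<phi> S \<pi> \<and> weakly_sofic M \<and>
      (\<forall>s\<in>S. \<exists>p\<in>hom ?N M. \<exists>q\<in>hom M ?N. \<forall>x\<in>E. \<forall>h\<in>carrier H.
        p (?j x h) = i (\<pi> s x) h \<and> q (i (\<pi> s x) h) = ?j x h)"
    using A B oc weakly_sofic_sum_group[OF B(1) H]
    by - (rule exI[of _ A], rule exI[of _ \<phi>], rule exI[of _ S], rule exI[of _ \<pi>], rule exI[of _ ?M], rule exI[of _ i],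
        (intro conjI ballI impI; simp))
qed (rule \<Gamma>)

section \<open>Free products\<close>

locale group_family =
  fixes V :: "'v set" and \<Gamma> :: "'v \<Rightarrow> ('a, 'c) monoid_scheme"
  assumes groups: "v \<in> V \<Longrightarrow> group (\<Gamma> v)"
begin

abbreviation words where "words \<equiv> fp_words V \<Gamma>"
abbreviation FP where "FP \<equiv> free_product V \<Gamma>"
abbreviation cls where "cls w \<equiv> fp_rel V \<Gamma> `` {w}"

lemma words_simps [simp]:
  "[] \<in> words"
  "(v, g) # w \<in> words \<longleftrightarrow> v \<in> V \<and> g \<in> carrier (\<Gamma> v) \<and> w \<in> words"
  "u @ w \<in> words \<longleftrightarrow> u \<in> words \<and> w \<in> words"
  by (auto simp: fp_words_def)

lemma fp_eq_words: "fp_eq V \<Gamma> u w \<Longrightarrow> u \<in> words \<and> w \<in> words"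
  by (induction rule: fp_eq.induct)
    (auto simp: groups group.is_monoid monoid.m_closed monoid.one_closed)

lemma fp_eq_append_right: "fp_eq V \<Gamma> u u' \<Longrightarrow> w \<in> words \<Longrightarrow> fp_eq V \<Gamma> (u @ w) (u' @ w)"
proof (induction rule: fp_eq.induct)
  case (fp_eq_trivial u x v)
  then show ?case
    using fp_eq.fp_eq_trivial[of u V \<Gamma> "x @ w" v] by simp
next
  case (fp_eq_mult u x v g h)
  then show ?case
    using fp_eq.fp_eq_mult[of u V \<Gamma> "x @ w" v g h] by simp
next
  case (fp_eq_trans u v x)
  then show ?case
    by (blast intro: fp_eq.fp_eq_trans)
qed (auto intro: fp_eq.fp_eq_refl fp_eq.fp_eq_sym)

lemma fp_eq_append_left: "fp_eq V \<Gamma> u u' \<Longrightarrow> w \<in> words \<Longrightarrow> fp_eq V \<Gamma> (w @ u) (w @ u')"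
proof (induction rule: fp_eq.induct)
  case (fp_eq_trivial u x v)
  then show ?case
    using fp_eq.fp_eq_trivial[of "w @ u" V \<Gamma> x v] by simp
next
  case (fp_eq_mult u x v g h)
  then show ?case
    using fp_eq.fp_eq_mult[of "w @ u" V \<Gamma> x v g h] by simp
next
  case (fp_eq_trans u v x)
  then show ?case
    by (blast intro: fp_eq.fp_eq_trans)
qed (auto intro: fp_eq.fp_eq_refl fp_eq.fp_eq_sym)

lemma fp_eq_append:
  "fp_eq V \<Gamma> u u' \<Longrightarrow> fp_eq V \<Gamma> w w' \<Longrightarrow> fp_eq V \<Gamma> (u @ w) (u' @ w')"
  by (meson fp_eq.fp_eq_trans fp_eq_append_left fp_eq_append_right fp_eq_words)

lemma cls_eq_iff: "u \<in> words \<Longrightarrow> cls u = cls w \<longleftrightarrow> fp_eq V \<Gamma> u w"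
  by (auto simp: fp_rel_def intro: fp_eq.intros)

lemma mem_cls: "u \<in> cls w \<longleftrightarrow> fp_eq V \<Gamma> w u"
  by (simp add: fp_rel_def)

lemma carrier_FP: "carrier FP = cls ` words"
  by (auto simp: free_product_def quotient_def)

lemma carrier_FP_cases:
  assumes "C \<in> carrier FP"
  obtains w where "w \<in> words" "C = cls w"
  using assms by (auto simp: carrier_FP)

lemma one_FP: "\<one>\<^bsub>FP\<^esub> = cls []"
  by (simp add: free_product_def)

text \<open>The product is a union over all representatives; since the relation is a congruence, all
  members of the union are the same class.\<close>

lemma mult_FP:
  assumes "u \<in> words" "w \<in> words"
  shows "cls u \<otimes>\<^bsub>FP\<^esub> cls w = cls (u @ w)"
proof -
  have "cls (c @ d) = cls (u @ w)" if "c \<in> cls u" "d \<in> cls w" for c d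
    using that assms fp_eq_append[of u c w d] by (subst eq_commute, subst cls_eq_iff) (auto simp: fp_rel_def)
  moreover have "u \<in> cls u" "w \<in> cls w"
    using assms by (auto simp: fp_rel_def intro: fp_eq.fp_eq_refl)
  ultimately have "(\<Union>c\<in>cls u. \<Union>d\<in>cls w. cls (c @ d)) = cls (u @ w)"
    by blast
  then show ?thesis
    by (simp add: free_product_def)
qed

text \<open>The inverse of the first letter goes to the end of the inverse of the tail, where it
  meets that letter and both merge into a trivial one. Left inverses are all that
  \<open>groupI\<close> asks for.\<close>

lemma word_left_inverse:
  assumes "w \<in> words"
  shows "\<exists>w'\<in>words. fp_eq V \<Gamma> (w' @ w) []"
  using assms
proof (induction w)
  case Nil
  then show ?case
    by (intro bexI[of _ "[]"]) (auto intro: fp_eq.fp_eq_refl)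
next
  case (Cons l w)
  obtain v g where l: "l = (v, g)" by fastforce
  have v: "v \<in> V" "g \<in> carrier (\<Gamma> v)" "w \<in> words"
    using Cons.prems by (auto simp: l)
  interpret G: group "\<Gamma> v"
    by (rule groups[OF v(1)])
  obtain w' where w': "w' \<in> words" "fp_eq V \<Gamma> (w' @ w) []"
    using Cons.IH[OF v(3)] by blast
  have "fp_eq V \<Gamma> (w' @ [(v, inv\<^bsub>\<Gamma> v\<^esub> g), (v, g)] @ w) (w' @ [(v, \<one>\<^bsub>\<Gamma> v\<^esub>)] @ w)"
    using fp_eq.fp_eq_mult[of w' V \<Gamma> w v "inv\<^bsub>\<Gamma> v\<^esub> g" g] w' v by simp
  moreover have "fp_eq V \<Gamma> (w' @ [(v, \<one>\<^bsub>\<Gamma> v\<^esub>)] @ w) (w' @ w)"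
    using w' v by (intro fp_eq.fp_eq_trivial)
  ultimately have "fp_eq V \<Gamma> ((w' @ [(v, inv\<^bsub>\<Gamma> v\<^esub> g)]) @ l # w) []"
    using w'(2) by (auto simp: l intro: fp_eq.fp_eq_trans)
  moreover have "w' @ [(v, inv\<^bsub>\<Gamma> v\<^esub> g)] \<in> words"
    using w' v by simp
  ultimately show ?case
    by blast
qed

lemma group_FP: "group FP"
proof (rule groupI)
  fix C assume "C \<in> carrier FP"
  then obtain w where w: "w \<in> words" "C = cls w"
    by (rule carrier_FP_cases)
  then obtain w' where w': "w' \<in> words" "fp_eq V \<Gamma> (w' @ w) []"
    using word_left_inverse by blast
  show "\<one>\<^bsub>FP\<^esub> \<otimes>\<^bsub>FP\<^esub> C = C"
    using w by (simp add: one_FP mult_FP)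
  have "cls w' \<otimes>\<^bsub>FP\<^esub> C = \<one>\<^bsub>FP\<^esub>"
    using w w' by (simp add: one_FP mult_FP cls_eq_iff)
  then show "\<exists>D\<in>carrier FP. D \<otimes>\<^bsub>FP\<^esub> C = \<one>\<^bsub>FP\<^esub>"
    using w' by (auto simp: carrier_FP)
next
  fix C D assume "C \<in> carrier FP" "D \<in> carrier FP"
  then show "C \<otimes>\<^bsub>FP\<^esub> D \<in> carrier FP"
    by (elim carrier_FP_cases) (auto simp: mult_FP carrier_FP)
next
  fix B C D assume "B \<in> carrier FP" "C \<in> carrier FP" "D \<in> carrier FP"
  then show "B \<otimes>\<^bsub>FP\<^esub> C \<otimes>\<^bsub>FP\<^esub> D = B \<otimes>\<^bsub>FP\<^esub> (C \<otimes>\<^bsub>FP\<^esub> D)"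
    by (elim carrier_FP_cases) (simp add: mult_FP)
qed (auto simp: one_FP carrier_FP)

sublocale FP: group FP
  by (rule group_FP)

lemma fp_incl_hom: "v \<in> V \<Longrightarrow> fp_incl V \<Gamma> v \<in> hom (\<Gamma> v) FP"
proof (rule homI)
  fix g h assume "v \<in> V" and gh: "g \<in> carrier (\<Gamma> v)" "h \<in> carrier (\<Gamma> v)"
  interpret G: group "\<Gamma> v"
    by (rule groups) fact
  have "fp_eq V \<Gamma> [(v, g \<otimes>\<^bsub>\<Gamma> v\<^esub> h)] [(v, g), (v, h)]"
    using fp_eq.fp_eq_mult[of "[]" V \<Gamma> "[]" v g h] gh \<open>v \<in> V\<close> by (simp add: fp_eq.fp_eq_sym)
  then show "fp_incl V \<Gamma> v (g \<otimes>\<^bsub>\<Gamma> v\<^esub> h) = fp_incl V \<Gamma> v g \<otimes>\<^bsub>FP\<^esub> fp_incl V \<Gamma> v h"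
    using gh \<open>v \<in> V\<close> by (simp add: fp_incl_def mult_FP cls_eq_iff)
qed (auto simp: fp_incl_def carrier_FP)

lemma fp_incl_closed [simp]: "v \<in> V \<Longrightarrow> g \<in> carrier (\<Gamma> v) \<Longrightarrow> fp_incl V \<Gamma> v g \<in> carrier FP"
  by (auto simp: fp_incl_def carrier_FP)

lemma FP_generate: "carrier FP = generate FP (\<Union>v\<in>V. fp_incl V \<Gamma> v ` carrier (\<Gamma> v))"
proof
  let ?J = "\<Union>v\<in>V. fp_incl V \<Gamma> v ` carrier (\<Gamma> v)"
  have "cls w \<in> generate FP ?J" if "w \<in> words" for w
    using that
  proof (induction w)
    case Nil
    then show ?case
      using generate.one[of FP ?J] by (simp add: one_FP)
  next
    case (Cons l w)
    obtain v g where l: "l = (v, g)" by fastforce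
    have v: "v \<in> V" "g \<in> carrier (\<Gamma> v)" "w \<in> words"
      using Cons.prems by (auto simp: l)
    then have "fp_incl V \<Gamma> v g \<in> generate FP ?J"
      by (intro generate.incl) auto
    then have "fp_incl V \<Gamma> v g \<otimes>\<^bsub>FP\<^esub> cls w \<in> generate FP ?J"
      using Cons.IH[OF v(3)] by (rule generate.eng)
    then show ?case
      using v by (simp add: fp_incl_def mult_FP l)
  qed
  then show "carrier FP \<subseteq> generate FP ?J"
    by (auto simp: carrier_FP)
  show "generate FP ?J \<subseteq> carrier FP"
    by (rule FP.generate_incl) auto
qed

text \<open>The existence half of the universal property; uniqueness is supplied by
  \<open>FP_generate\<close>. Words are evaluated letter by letter, and the value respects both
  generating relations because each \<open>q v\<close> is a homomorphism.\<close>

lemma free_product_lift: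
  assumes "group M" and q: "\<And>v. v \<in> V \<Longrightarrow> q v \<in> hom (\<Gamma> v) M"
  obtains p where "p \<in> hom FP M"
    "\<And>v g. \<lbrakk>v \<in> V; g \<in> carrier (\<Gamma> v)\<rbrakk> \<Longrightarrow> p (fp_incl V \<Gamma> v g) = q v g"
proof -
  interpret M: group M by fact
  define ev where "ev = (\<lambda>w. foldr (\<lambda>(v, g) m. q v g \<otimes>\<^bsub>M\<^esub> m) w \<one>\<^bsub>M\<^esub>)"
  have q_closed [simp]: "q v g \<in> carrier M" if "v \<in> V" "g \<in> carrier (\<Gamma> v)" for v g
    using q that by (auto simp: hom_def)
  have ev_simps [simp]: "ev [] = \<one>\<^bsub>M\<^esub>" "ev ((v, g) # w) = q v g \<otimes>\<^bsub>M\<^esub> ev w" for v g w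
    by (simp_all add: ev_def)
  have ev_closed [simp]: "ev w \<in> carrier M" if "w \<in> words" for w
    using that by (induction w) auto
  have ev_append: "ev (u @ w) = ev u \<otimes>\<^bsub>M\<^esub> ev w" if "u \<in> words" "w \<in> words" for u w
    using that by (induction u) (auto simp: M.m_assoc)
  have ev_eq: "ev u = ev w" if "fp_eq V \<Gamma> u w" for u w
    using that
  proof (induction rule: fp_eq.induct)
    case (fp_eq_trivial u w v)
    then show ?case
      using hom_one[OF q groups M.group_axioms, of v] groups[of v]
      by (simp add: ev_append group.is_monoid)
  next
    case (fp_eq_mult u w v g h)
    then show ?case
      using hom_mult[OF q, of v g h] groups[of v]
      by (simp add: ev_append M.m_assoc group.is_monoid monoid.m_closed)
  qed auto
  \<comment> \<open>An arbitrary representative is evaluated; \<open>ev_eq\<close> makes the choice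
    irrelevant.\<close>
  define p where "p = (\<lambda>C. ev (SOME w. w \<in> C))"
  have p: "p (cls w) = ev w" if "w \<in> words" for w
  proof -
    have "w \<in> cls w"
      using that by (simp add: fp_rel_def fp_eq.fp_eq_refl)
    then have "(SOME u. u \<in> cls w) \<in> cls w"
      by (rule someI)
    then show ?thesis
      unfolding p_def using ev_eq by (simp only: mem_cls)
  qed
  show thesis
  proof (rule that[of p])
    show "p \<in> hom FP M"
      by (rule homI; elim carrier_FP_cases) (auto simp: p mult_FP ev_append)
    show "p (fp_incl V \<Gamma> v g) = q v g" if "v \<in> V" "g \<in> carrier (\<Gamma> v)" for v g
      using that by (simp add: fp_incl_def p)
  qed
qed

end

section \<open>Relabelling of words and the induced action on the free product\<close>

lemma fp_eq_relabel:
  assumes "group H" "fp_eq V (\<lambda>_. H) u w" "f \<in> V \<rightarrow> W"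
  shows "fp_eq W (\<lambda>_. H) (map (\<lambda>(x, h). (f x, h)) u) (map (\<lambda>(x, h). (f x, h)) w)"
proof -
  interpret V: group_family V "\<lambda>_. H"
    by (simp add: group_family_def assms)
  interpret W: group_family W "\<lambda>_. H"
    by (simp add: group_family_def assms)
  have words: "map (\<lambda>(x, h). (f x, h)) u \<in> W.words" if "u \<in> V.words" for u
    using that assms(3) by (induction u) (auto simp: Pi_iff)
  show ?thesis
    using assms(2)
  proof (induction rule: fp_eq.induct)
    case (fp_eq_trivial u w v)
    then show ?case
      using fp_eq.fp_eq_trivial[OF words[of u] words[of w], of "f v"] assms(3) by auto
  next
    case (fp_eq_mult u w v g h)
    then show ?case
      using fp_eq.fp_eq_mult[OF words[of u] words[of w], of "f v" g h] assms(3) by auto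
  next
    case (fp_eq_trans u v w)
    then show ?case
      by (blast intro: fp_eq.fp_eq_trans)
  qed (auto intro: fp_eq.fp_eq_refl fp_eq.fp_eq_sym words)
qed

locale relabelling = H: group H + group_action K X \<alpha>
  for H :: "('h, 'c) monoid_scheme" and K :: "('k, 'd) monoid_scheme" and X :: "'x set" and \<alpha>
begin

sublocale group_family X "\<lambda>_. H"
  by (simp add: group_family_def H.group_axioms)

interpretation K: group K
  using group_hom group_hom.axioms(1) by blast

abbreviation relabel where "relabel g \<equiv> map (\<lambda>(x, h). (\<alpha> g x, h))"

lemma \<alpha>_closed: "g \<in> carrier K \<Longrightarrow> x \<in> X \<Longrightarrow> \<alpha> g x \<in> X"
  using element_image by blast

lemma relabel_words: "g \<in> carrier K \<Longrightarrow> w \<in> words \<Longrightarrow> relabel g w \<in> words"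
  by (induction w) (auto simp: \<alpha>_closed)

lemma relabel_one: "w \<in> words \<Longrightarrow> relabel \<one>\<^bsub>K\<^esub> w = w"
  by (induction w) (auto simp flip: id_eq_one)

lemma relabel_mult:
  "\<lbrakk>g \<in> carrier K; h \<in> carrier K; w \<in> words\<rbrakk> \<Longrightarrow> relabel (g \<otimes>\<^bsub>K\<^esub> h) w = relabel g (relabel h w)"
  by (induction w) (auto simp: composition_rule)

text \<open>\<open>fp_perm\<close> is an elementwise image, so it has to be shown to fill a whole
  class. One inclusion relabels a chain of relations by \<open>g\<close>, the other relabels back by
  the inverse of \<open>g\<close>.\<close>

lemma fp_perm_cls:
  assumes g: "g \<in> carrier K" and w: "w \<in> words"
  shows "fp_perm \<alpha> g (cls w) = cls (relabel g w)"
proof (intro equalityI subsetI)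
  note eq = fp_eq_relabel[OF H.group_axioms]
  fix u assume "u \<in> fp_perm \<alpha> g (cls w)"
  then show "u \<in> cls (relabel g w)"
    using g by (auto simp: fp_perm_def fp_rel_def \<alpha>_closed intro!: eq)
next
  note eq = fp_eq_relabel[OF H.group_axioms]
  fix u assume "u \<in> cls (relabel g w)"
  then have u: "fp_eq X (\<lambda>_. H) (relabel g w) u"
    by (simp add: fp_rel_def)
  have g': "inv\<^bsub>K\<^esub> g \<in> carrier K"
    using g by simp
  have "fp_eq X (\<lambda>_. H) (relabel (inv\<^bsub>K\<^esub> g) (relabel g w)) (relabel (inv\<^bsub>K\<^esub> g) u)"
    using u g' by (intro eq) (auto simp: \<alpha>_closed)
  then have "relabel (inv\<^bsub>K\<^esub> g) u \<in> cls w"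
    using relabel_mult[OF g' g w] g w relabel_one by (simp add: fp_rel_def)
  moreover have "relabel g (relabel (inv\<^bsub>K\<^esub> g) u) = u"
    using relabel_mult[OF g g', of u] g fp_eq_words[OF u] relabel_one by simp
  ultimately show "u \<in> fp_perm \<alpha> g (cls w)"
    unfolding fp_perm_def by (metis imageI)
qed

lemma hom_action_fp_perm: "hom_action FP K (fp_perm \<alpha>)"
proof (intro hom_action.intro hom_action_axioms.intro)
  fix g assume "g \<in> carrier K"
  then show "fp_perm \<alpha> g \<in> hom FP FP"
    by (intro homI; elim carrier_FP_cases) (auto simp: fp_perm_cls mult_FP relabel_words carrier_FP)
next
  fix C assume "C \<in> carrier FP"
  then show "fp_perm \<alpha> \<one>\<^bsub>K\<^esub> C = C"
    by (elim carrier_FP_cases) (simp add: fp_perm_cls relabel_one)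
next
  fix g h C assume "g \<in> carrier K" "h \<in> carrier K" "C \<in> carrier FP"
  then show "fp_perm \<alpha> (g \<otimes>\<^bsub>K\<^esub> h) C = fp_perm \<alpha> g (fp_perm \<alpha> h C)"
    by (elim carrier_FP_cases) (simp add: fp_perm_cls relabel_words relabel_mult del: map_map)
qed (rule FP.group_axioms K.group_axioms)+

lemma fp_perm_incl:
  assumes "g \<in> carrier K" "x \<in> X" "h \<in> carrier H"
  shows "fp_perm \<alpha> g (fp_incl X (\<lambda>_. H) x h) = fp_incl X (\<lambda>_. H) (\<alpha> g x) h"
  using assms by (simp add: fp_incl_def fp_perm_cls)

end

section \<open>Homomorphisms induced by partial maps of index sets\<close>

lemma hom_trivial: "monoid M \<Longrightarrow> (\<lambda>_. \<one>\<^bsub>M\<^esub>) \<in> hom G M"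
  by (auto simp: hom_def monoid.one_closed)

text \<open>Factors outside \<open>E\<close> go to the identity, which makes a map known only on
  \<open>E\<close> total on the free product. It is applied to an embedding of \<open>E\<close> and
  then to the inverse embedding.\<close>

lemma free_product_partial_map:
  assumes "group H" "group K" "\<kappa> \<in> hom H K" "f \<in> E \<rightarrow> W" "E \<subseteq> V"
  obtains p where "p \<in> hom (free_product V (\<lambda>_. H)) (free_product W (\<lambda>_. K))"
    "\<And>x h. \<lbrakk>x \<in> E; h \<in> carrier H\<rbrakk> \<Longrightarrow> p (fp_incl V (\<lambda>_. H) x h) = fp_incl W (\<lambda>_. K) (f x) (\<kappa> h)"
proof -
  interpret V: group_family V "\<lambda>_. H"
    by (simp add: group_family_def assms)
  interpret W: group_family W "\<lambda>_. K"
    by (simp add: group_family_def assms)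
  define q where "q = (\<lambda>x. if x \<in> E then fp_incl W (\<lambda>_. K) (f x) \<circ> \<kappa> else (\<lambda>_. \<one>\<^bsub>W.FP\<^esub>))"
  have q: "q x \<in> hom H W.FP" for x
    using hom_compose[OF assms(3) W.fp_incl_hom] assms(4) hom_trivial[OF W.FP.is_monoid]
    by (auto simp: q_def)
  obtain p where p: "p \<in> hom V.FP W.FP"
    "\<And>v g. \<lbrakk>v \<in> V; g \<in> carrier H\<rbrakk> \<Longrightarrow> p (fp_incl V (\<lambda>_. H) v g) = q v g"
    by (rule V.free_product_lift[OF W.group_FP q]) (rule that)
  show thesis
    using p assms(5) by (intro that[of p]) (auto simp: q_def)
qed

text \<open>The assumption on free products speaks of index sets and groups inside
  \<open>'u\<close>, while \<open>B\<close> consists of naturals and \<open>H\<close> lives on its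
  own type. The map \<open>e\<close> and the isomorphism \<open>\<iota>\<close> carry both into
  \<open>'u\<close>.\<close>

lemma weakly_sofic_free_wreath:
  fixes X :: "'x set" and H :: "('h, 'c) monoid_scheme" and H' :: "'u monoid" and \<iota> :: "'h \<Rightarrow> 'u"
    and e :: "nat \<Rightarrow> 'u"
  assumes \<Gamma>: "weakly_sofic (\<Gamma> :: ('g, 'd) monoid_scheme)" and \<alpha>: "sofic_action \<Gamma> X \<alpha>"
    and "group H" "group H'" and \<iota>: "\<iota> \<in> iso H H'" and e: "inj e"
    and free: "\<And>B. finite B \<Longrightarrow> weakly_sofic (free_product (e ` B) (\<lambda>_. H'))"
  shows "weakly_sofic (free_wreath H \<Gamma> X \<alpha>)"
  unfolding free_wreath_def
proof (rule weakly_sofic_semidirect_generated[where 'm = "('u \<times> 'u) list set"])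
  show ga: "group_action \<Gamma> X \<alpha>"
    using \<alpha> by (simp add: sofic_action_def)
  interpret relabelling H \<Gamma> X \<alpha>
    by (simp add: relabelling_def ga assms(3))
  show "hom_action FP \<Gamma> (fp_perm \<alpha>)"
    by (rule hom_action_fp_perm)
  show "carrier FP = generate FP (\<Union>x\<in>X. fp_incl X (\<lambda>_. H) x ` carrier H)"
    by (rule FP_generate)
  fix F E and \<epsilon> :: real
  assume F: "finite F" "F \<subseteq> carrier \<Gamma>" and E: "finite E" "E \<subseteq> X" and "0 < \<epsilon>"
  then obtain A :: "nat set" and \<phi> where A: "finite A" "unital_multiplicative \<Gamma> F \<epsilon> A \<phi>" "orbit_approx X \<alpha> F E \<epsilon> A \<phi>"
    using \<alpha> unfolding sofic_action_def by meson
  then obtain B :: "nat set" and S \<pi> where B: "finite B" "S \<subseteq> A" "real (card S) > (1 - \<epsilon>) * real (card A)"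
    and \<pi>: "\<And>s. s \<in> S \<Longrightarrow> \<pi> s \<in> E \<rightarrow> B" "\<And>s. s \<in> S \<Longrightarrow> inj_on (\<pi> s) E" and oc: "orbit_compatible X \<alpha> F E \<phi> S \<pi>"
    unfolding orbit_approx_def by metis
  let ?M = "free_product (e ` B) (\<lambda>_. H')"
  define i where "i = (\<lambda>b h. fp_incl (e ` B) (\<lambda>_. H') (e b) (\<iota> h))"
  have "\<exists>p\<in>hom FP ?M. \<exists>q\<in>hom ?M FP. \<forall>x\<in>E. \<forall>h\<in>carrier H.
      p (fp_incl X (\<lambda>_. H) x h) = i (\<pi> s x) h \<and> q (i (\<pi> s x) h) = fp_incl X (\<lambda>_. H) x h" if s: "s \<in> S" for s
  proof -
    define f where "f = (\<lambda>x. e (\<pi> s x))"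
    have f: "f \<in> E \<rightarrow> e ` B" "inj_on f E"
      using \<pi>[OF s] e by (auto simp: f_def inj_on_def)
    have f': "inv_into E f \<in> f ` E \<rightarrow> X"
      using E by (auto intro!: subsetD[OF E(2)] inv_into_into)
    define \<kappa> where "\<kappa> = inv_into (carrier H) \<iota>"
    have \<kappa>: "\<kappa> \<in> iso H' H" "h \<in> carrier H \<Longrightarrow> \<kappa> (\<iota> h) = h" for h
      using \<iota> H.iso_set_sym[OF \<iota>] by (auto simp: \<kappa>_def iso_def bij_betw_def)
    obtain p where p: "p \<in> hom FP ?M" "\<And>x h. \<lbrakk>x \<in> E; h \<in> carrier H\<rbrakk> \<Longrightarrow>
        p (fp_incl X (\<lambda>_. H) x h) = fp_incl (e ` B) (\<lambda>_. H') (f x) (\<iota> h)"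
      by (rule free_product_partial_map[OF assms(3,4) iso_imp_homomorphism[OF \<iota>] f(1) E(2)]) (rule that)
    have fE: "f ` E \<subseteq> e ` B"
      using f(1) by auto
    obtain q where q: "q \<in> hom ?M FP" "\<And>y k. \<lbrakk>y \<in> f ` E; k \<in> carrier H'\<rbrakk> \<Longrightarrow>
        q (fp_incl (e ` B) (\<lambda>_. H') y k) = fp_incl X (\<lambda>_. H) (inv_into E f y) (\<kappa> k)"
      by (rule free_product_partial_map[OF assms(4,3) iso_imp_homomorphism[OF \<kappa>(1)] f' fE]) (rule that)
    have "\<iota> h \<in> carrier H'" if "h \<in> carrier H" for h
      using \<iota> that by (auto simp: iso_def hom_def)
    then have "q (fp_incl (e ` B) (\<lambda>_. H') (f x) (\<iota> h)) = fp_incl X (\<lambda>_. H) x h"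
      if "x \<in> E" "h \<in> carrier H" for x h
      using q(2)[of "f x" "\<iota> h"] f(2) that \<kappa>(2) by simp
    then show ?thesis
      using p q(1) by (intro bexI[of _ p] bexI[of _ q]) (auto simp: i_def f_def)
  qed
  then show "\<exists>(A :: nat set) \<phi> S (\<pi> :: nat \<Rightarrow> 'x \<Rightarrow> nat) (M :: ('u \<times> 'u) list set monoid) i.
      finite A \<and> unital_multiplicative \<Gamma> F \<epsilon> A \<phi> \<and>
      S \<subseteq> A \<and> (1 - \<epsilon>) * real (card A) < real (card S) \<and>
      orbit_compatible X \<alpha> F E \<phi> S \<pi> \<and> weakly_sofic M \<and>
      (\<forall>s\<in>S. \<exists>p\<in>hom FP M. \<exists>q\<in>hom M FP. \<forall>x\<in>E. \<forall>h\<in>carrier H.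
        p (fp_incl X (\<lambda>_. H) x h) = i (\<pi> s x) h \<and> q (i (\<pi> s x) h) = fp_incl X (\<lambda>_. H) x h)"
    using A B oc free[OF B(1)]
    by - (rule exI[of _ A], rule exI[of _ \<phi>], rule exI[of _ S], rule exI[of _ \<pi>], rule exI[of _ ?M], rule exI[of _ i],
        (intro conjI ballI impI; simp))
next
  interpret relabelling H \<Gamma> X \<alpha>
    using \<alpha> by (simp add: relabelling_def sofic_action_def assms(3))
  show "fp_incl X (\<lambda>_. H) x h \<in> carrier FP" if "x \<in> X" "h \<in> carrier H" for x h
    using that by simp
  show "fp_perm \<alpha> g (fp_incl X (\<lambda>_. H) x h) = fp_incl X (\<lambda>_. H) (\<alpha> g x) h"
    if "g \<in> carrier \<Gamma>" "x \<in> X" "h \<in> carrier H" for g x h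
    using that by (rule fp_perm_incl)
qed (rule \<Gamma>)

section \<open>Graph products\<close>

text \<open>The whole group belongs to the intersected family, which is therefore nonempty.\<close>

lemma normal_closure:
  assumes "group G" "R \<subseteq> carrier G"
  shows "normal_closure G R \<lhd> G" "R \<subseteq> normal_closure G R"
proof -
  interpret group G by fact
  have "carrier G \<lhd> G"
    by (rule normal_invI[OF subgroup_self]) auto
  then have ne: "{N. N \<lhd> G \<and> R \<subseteq> N} \<noteq> {}"
    using assms by auto
  show "normal_closure G R \<lhd> G"
    unfolding normal_closure_def
  proof (rule normal_invI)
    show "subgroup (\<Inter> {N. N \<lhd> G \<and> R \<subseteq> N}) G"
      using ne by (intro subgroup_Inter) (auto simp: normal_inv_iff)
  qed (auto simp: normal_inv_iff)
qed (auto simp: normal_closure_def)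

lemma normal_closure_subset: "N \<lhd> G \<Longrightarrow> R \<subseteq> N \<Longrightarrow> normal_closure G R \<subseteq> N"
  by (auto simp: normal_closure_def)

locale graph_family = group_family V \<Gamma>
  for V :: "'v set" and \<Gamma> :: "'v \<Rightarrow> ('a, 'c) monoid_scheme" +
  fixes D :: "('v \<times> 'v) set"
  assumes edges: "D \<subseteq> V \<times> V"
begin

abbreviation rels where "rels \<equiv> graph_relators V D \<Gamma>"
abbreviation ncl where "ncl \<equiv> normal_closure FP rels"
abbreviation GP where "GP \<equiv> graph_product V D \<Gamma>"
abbreviation coset where "coset x \<equiv> ncl #>\<^bsub>FP\<^esub> x"
abbreviation gp_incl where "gp_incl v g \<equiv> coset (fp_incl V \<Gamma> v g)"

lemma rels_carrier: "rels \<subseteq> carrier FP"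
  using edges by (auto simp: graph_relators_def)

sublocale normal ncl FP
  by (rule normal_closure[OF group_FP rels_carrier])

lemma rels_ncl: "rels \<subseteq> ncl"
  by (rule normal_closure[OF group_FP rels_carrier])

lemma GP_eq: "GP = FP Mod ncl"
  by (simp add: graph_product_def)

sublocale GP: group GP
  unfolding GP_eq by (rule factorgroup_is_group)

lemma coset_hom: "coset \<in> hom FP GP"
  unfolding GP_eq by (rule r_coset_hom_Mod)

lemma carrier_GP: "carrier GP = coset ` carrier FP"
  by (simp add: GP_eq carrier_FactGroup)

lemma gp_incl_hom: "v \<in> V \<Longrightarrow> gp_incl v \<in> hom (\<Gamma> v) GP"
  using hom_compose[OF fp_incl_hom coset_hom, of v] by (simp add: comp_def)

lemma gp_incl_closed [simp]: "v \<in> V \<Longrightarrow> g \<in> carrier (\<Gamma> v) \<Longrightarrow> gp_incl v g \<in> carrier GP"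
  by (auto simp: carrier_GP)

lemma GP_generate: "carrier GP = generate GP (\<Union>v\<in>V. gp_incl v ` carrier (\<Gamma> v))"
proof -
  interpret c: group_hom FP GP coset
    by (simp add: group_hom_def group_hom_axioms_def coset_hom)
  have "coset ` generate FP (\<Union>v\<in>V. fp_incl V \<Gamma> v ` carrier (\<Gamma> v)) =
      generate GP (coset ` (\<Union>v\<in>V. fp_incl V \<Gamma> v ` carrier (\<Gamma> v)))"
    by (rule c.generate_img[symmetric]) auto
  then show ?thesis
    by (simp add: carrier_GP image_UN image_image flip: FP_generate)
qed

text \<open>The relator is the inverse of \<open>b a\<close> times \<open>a b\<close>, so its
  vanishing in the quotient says that \<open>a\<close> and \<open>b\<close> commute.\<close>

lemma gp_incl_commute:
  assumes "(v, w) \<in> D" "g \<in> carrier (\<Gamma> v)" "h \<in> carrier (\<Gamma> w)"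
  shows "gp_incl v g \<otimes>\<^bsub>GP\<^esub> gp_incl w h = gp_incl w h \<otimes>\<^bsub>GP\<^esub> gp_incl v g"
proof -
  interpret c: group_hom FP GP coset
    by (simp add: group_hom_def group_hom_axioms_def coset_hom)
  let ?a = "fp_incl V \<Gamma> v g" and ?b = "fp_incl V \<Gamma> w h"
  have ab: "?a \<in> carrier FP" "?b \<in> carrier FP"
    using assms edges by auto
  let ?r = "inv\<^bsub>FP\<^esub> ?a \<otimes>\<^bsub>FP\<^esub> inv\<^bsub>FP\<^esub> ?b \<otimes>\<^bsub>FP\<^esub> ?a \<otimes>\<^bsub>FP\<^esub> ?b"
  have "?r \<in> rels"
    unfolding graph_relators_def using assms by blast
  then have "?r \<in> ncl"
    using rels_ncl by blast
  then have "coset ?r = \<one>\<^bsub>GP\<^esub>"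
    using rcos_const by (simp add: GP_eq)
  moreover have "?r = inv\<^bsub>FP\<^esub> (?b \<otimes>\<^bsub>FP\<^esub> ?a) \<otimes>\<^bsub>FP\<^esub> (?a \<otimes>\<^bsub>FP\<^esub> ?b)"
    using ab by (simp add: FP.m_assoc FP.inv_mult_group)
  ultimately have "inv\<^bsub>GP\<^esub> coset (?b \<otimes>\<^bsub>FP\<^esub> ?a) \<otimes>\<^bsub>GP\<^esub> coset (?a \<otimes>\<^bsub>FP\<^esub> ?b) = \<one>\<^bsub>GP\<^esub>"
    using ab by simp
  then have "inv\<^bsub>GP\<^esub> coset (?a \<otimes>\<^bsub>FP\<^esub> ?b) = inv\<^bsub>GP\<^esub> coset (?b \<otimes>\<^bsub>FP\<^esub> ?a)"
    using ab by (intro GP.inv_equality) auto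
  then have "coset (?a \<otimes>\<^bsub>FP\<^esub> ?b) = coset (?b \<otimes>\<^bsub>FP\<^esub> ?a)"
    using ab by (metis c.hom_closed FP.m_closed GP.inv_inv)
  then show ?thesis
    using ab by simp
qed

text \<open>The lift to the free product kills the relators by \<open>commute\<close>. Its kernel is
  normal and hence contains the normal closure, so the lift is constant on cosets.\<close>

lemma graph_product_lift:
  assumes "group M" and q: "\<And>v. v \<in> V \<Longrightarrow> q v \<in> hom (\<Gamma> v) M"
    and commute: "\<And>v w g h. \<lbrakk>(v, w) \<in> D; g \<in> carrier (\<Gamma> v); h \<in> carrier (\<Gamma> w)\<rbrakk> \<Longrightarrow>
      q v g \<otimes>\<^bsub>M\<^esub> q w h = q w h \<otimes>\<^bsub>M\<^esub> q v g"
  obtains p where "p \<in> hom GP M"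
    "\<And>v g. \<lbrakk>v \<in> V; g \<in> carrier (\<Gamma> v)\<rbrakk> \<Longrightarrow> p (gp_incl v g) = q v g"
proof -
  interpret M: group M by fact
  obtain p0 where p0: "p0 \<in> hom FP M"
    "\<And>v g. \<lbrakk>v \<in> V; g \<in> carrier (\<Gamma> v)\<rbrakk> \<Longrightarrow> p0 (fp_incl V \<Gamma> v g) = q v g"
    by (rule free_product_lift[OF assms(1) q]) (assumption | rule that)+
  interpret p0: group_hom FP M p0
    by (simp add: group_hom_def group_hom_axioms_def p0 M.group_axioms)
  have q_closed: "q v g \<in> carrier M" if "v \<in> V" "g \<in> carrier (\<Gamma> v)" for v g
    using q that by (auto simp: hom_def)
  have "rels \<subseteq> kernel FP M p0"
  proof
    fix r assume "r \<in> rels"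
    then obtain v w g h where vw: "(v, w) \<in> D" "g \<in> carrier (\<Gamma> v)" "h \<in> carrier (\<Gamma> w)"
      and r: "r = inv\<^bsub>FP\<^esub> (fp_incl V \<Gamma> v g) \<otimes>\<^bsub>FP\<^esub> inv\<^bsub>FP\<^esub> (fp_incl V \<Gamma> w h) \<otimes>\<^bsub>FP\<^esub> fp_incl V \<Gamma> v g \<otimes>\<^bsub>FP\<^esub> fp_incl V \<Gamma> w h"
      by (auto simp: graph_relators_def)
    have V: "v \<in> V" "w \<in> V"
      using vw edges by auto
    have "p0 r = inv\<^bsub>M\<^esub> q v g \<otimes>\<^bsub>M\<^esub> inv\<^bsub>M\<^esub> q w h \<otimes>\<^bsub>M\<^esub> (q v g \<otimes>\<^bsub>M\<^esub> q w h)"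
      using V vw by (simp add: r p0(2) q_closed M.m_assoc)
    also have "\<dots> = inv\<^bsub>M\<^esub> (q w h \<otimes>\<^bsub>M\<^esub> q v g) \<otimes>\<^bsub>M\<^esub> (q w h \<otimes>\<^bsub>M\<^esub> q v g)"
      using V vw by (simp only: commute[OF vw] M.inv_mult_group q_closed)
    also have "\<dots> = \<one>\<^bsub>M\<^esub>"
      using V vw by (intro M.l_inv M.m_closed q_closed)
    finally show "r \<in> kernel FP M p0"
      using rels_carrier \<open>r \<in> rels\<close> by (auto simp: kernel_def)
  qed
  then have ncl: "ncl \<subseteq> kernel FP M p0"
    by (intro normal_closure_subset p0.normal_kernel)
  have eq: "p0 x = p0 y" if xy: "x \<in> carrier FP" "y \<in> carrier FP" "coset x = coset y" for x y
  proof -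
    have "x \<in> coset y"
      using FP.rcos_self[OF xy(1) is_subgroup] xy(3) by simp
    then obtain n where "n \<in> ncl" "x = n \<otimes>\<^bsub>FP\<^esub> y"
      by (auto simp: r_coset_def)
    then show ?thesis
      using ncl xy by (auto simp: kernel_def)
  qed
  obtain p where "p \<in> hom GP M" "\<And>x. x \<in> carrier FP \<Longrightarrow> p (coset x) = p0 x"
    using FactGroup_universal[OF p0(1) normal_axioms eq] by (metis GP_eq)
  then show thesis
    by (intro that[of p]) (simp_all add: p0(2))
qed

end

text \<open>For an edge inside \<open>E\<close> the images commute because \<open>f\<close> maps it
  to an edge; if an endpoint lies outside \<open>E\<close>, its factor is sent to the
  identity.\<close>

lemma graph_product_partial_map:
  assumes "group H" "group K" "\<kappa> \<in> hom H K" "f \<in> E \<rightarrow> W" "E \<subseteq> V"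
    and "graph_family V (\<lambda>_. H) D" "graph_family W (\<lambda>_. K) D'"
    and edge: "\<And>x y. \<lbrakk>x \<in> E; y \<in> E; (x, y) \<in> D\<rbrakk> \<Longrightarrow> (f x, f y) \<in> D'"
  obtains p where "p \<in> hom (graph_product V D (\<lambda>_. H)) (graph_product W D' (\<lambda>_. K))"
    "\<And>x h. \<lbrakk>x \<in> E; h \<in> carrier H\<rbrakk> \<Longrightarrow>
      p (graph_family.gp_incl V (\<lambda>_. H) D x h) = graph_family.gp_incl W (\<lambda>_. K) D' (f x) (\<kappa> h)"
proof -
  interpret V: graph_family V "\<lambda>_. H" D by fact
  interpret W: graph_family W "\<lambda>_. K" D' by fact
  define q where "q = (\<lambda>x. if x \<in> E then W.gp_incl (f x) \<circ> \<kappa> else (\<lambda>_. \<one>\<^bsub>W.GP\<^esub>))"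
  have q: "q x \<in> hom H W.GP" for x
    using hom_compose[OF assms(3) W.gp_incl_hom] assms(4) hom_trivial[OF W.GP.is_monoid]
    by (auto simp: q_def)
  have \<kappa>: "h \<in> carrier H \<Longrightarrow> \<kappa> h \<in> carrier K" for h
    using assms(3) by (auto simp: hom_def)
  have commute: "q v g \<otimes>\<^bsub>W.GP\<^esub> q w h = q w h \<otimes>\<^bsub>W.GP\<^esub> q v g"
    if "(v, w) \<in> D" "g \<in> carrier H" "h \<in> carrier H" for v w g h
  proof (cases "v \<in> E \<and> w \<in> E")
    case True
    then have "W.gp_incl (f v) (\<kappa> g) \<otimes>\<^bsub>W.GP\<^esub> W.gp_incl (f w) (\<kappa> h) =
        W.gp_incl (f w) (\<kappa> h) \<otimes>\<^bsub>W.GP\<^esub> W.gp_incl (f v) (\<kappa> g)"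
      using that edge \<kappa> by (intro W.gp_incl_commute) auto
    then show ?thesis
      using True by (simp add: q_def)
  next
    case False
    have "q v g \<in> carrier W.GP" "q w h \<in> carrier W.GP"
      using q that by (auto simp: hom_def)
    moreover have "q v g = \<one>\<^bsub>W.GP\<^esub> \<or> q w h = \<one>\<^bsub>W.GP\<^esub>"
      using False by (auto simp: q_def)
    ultimately show ?thesis
      by (elim disjE) simp_all
  qed
  obtain p where p: "p \<in> hom V.GP W.GP"
    "\<And>v g. \<lbrakk>v \<in> V; g \<in> carrier H\<rbrakk> \<Longrightarrow> p (V.gp_incl v g) = q v g"
    by (rule V.graph_product_lift[OF W.GP.group_axioms q commute]) (assumption | rule that)+
  show thesis
    using p assms(5) by (intro that[of p]) (auto simp: q_def)
qed

section \<open>The action on the graph product\<close>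

locale graph_relabelling = relabelling H K X \<alpha>
  for H :: "('h, 'c) monoid_scheme" and K :: "('k, 'd) monoid_scheme" and X :: "'x set" and \<alpha> +
  fixes D :: "('x \<times> 'x) set"
  assumes action: "graph_action K X D \<alpha>"
begin

sublocale graph_family X "\<lambda>_. H" D
  using action by unfold_locales (auto simp: graph_action_def simple_graph_def)

sublocale T: hom_action FP K "fp_perm \<alpha>"
  by (rule hom_action_fp_perm)

lemma fp_perm_rels:
  assumes "g \<in> carrier K" "r \<in> rels"
  shows "fp_perm \<alpha> g r \<in> rels"
proof -
  interpret T: group_hom FP FP "fp_perm \<alpha> g"
    using T.action_hom[OF assms(1)] by (simp add: group_hom_def group_hom_axioms_def)
  obtain v w h k where vw: "(v, w) \<in> D" "h \<in> carrier H" "k \<in> carrier H"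
    and r: "r = inv\<^bsub>FP\<^esub> (fp_incl X (\<lambda>_. H) v h) \<otimes>\<^bsub>FP\<^esub> inv\<^bsub>FP\<^esub> (fp_incl X (\<lambda>_. H) w k)
      \<otimes>\<^bsub>FP\<^esub> fp_incl X (\<lambda>_. H) v h \<otimes>\<^bsub>FP\<^esub> fp_incl X (\<lambda>_. H) w k"
    using assms(2) by (auto simp: graph_relators_def)
  have V: "v \<in> X" "w \<in> X"
    using vw edges by auto
  then have "(\<alpha> g v, \<alpha> g w) \<in> D"
    using action assms(1) vw by (simp add: graph_action_def)
  moreover have "fp_perm \<alpha> g r =
      inv\<^bsub>FP\<^esub> (fp_incl X (\<lambda>_. H) (\<alpha> g v) h) \<otimes>\<^bsub>FP\<^esub> inv\<^bsub>FP\<^esub> (fp_incl X (\<lambda>_. H) (\<alpha> g w) k)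
      \<otimes>\<^bsub>FP\<^esub> fp_incl X (\<lambda>_. H) (\<alpha> g v) h \<otimes>\<^bsub>FP\<^esub> fp_incl X (\<lambda>_. H) (\<alpha> g w) k"
    using V vw assms(1) by (simp add: r fp_perm_incl)
  ultimately show ?thesis
    unfolding graph_relators_def using vw(2,3) by blast
qed

text \<open>A graph automorphism permutes the relators. Hence the kernel of
  \<open>fp_perm \<alpha> g\<close> followed by the quotient map is a normal subgroup containing
  them, and so it contains the normal closure.\<close>

lemma fp_perm_ncl:
  assumes "g \<in> carrier K" "n \<in> ncl"
  shows "fp_perm \<alpha> g n \<in> ncl"
proof -
  interpret c: group_hom FP GP "coset \<circ> fp_perm \<alpha> g"
    using hom_compose[OF T.action_hom[OF assms(1)] coset_hom]
    by (simp add: group_hom_def group_hom_axioms_def)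
  have "rels \<subseteq> kernel FP GP (coset \<circ> fp_perm \<alpha> g)"
  proof
    fix r assume r: "r \<in> rels"
    then have "coset (fp_perm \<alpha> g r) = ncl"
      using fp_perm_rels[OF assms(1)] rels_ncl by (intro rcos_const) auto
    then show "r \<in> kernel FP GP (coset \<circ> fp_perm \<alpha> g)"
      using r rels_carrier by (auto simp: kernel_def GP_eq)
  qed
  then have "ncl \<subseteq> kernel FP GP (coset \<circ> fp_perm \<alpha> g)"
    by (intro normal_closure_subset c.normal_kernel)
  then have n: "n \<in> carrier FP" "coset (fp_perm \<alpha> g n) = ncl"
    using assms(2) by (auto simp: kernel_def GP_eq)
  then show ?thesis
    using FP.rcos_self[OF T.action_closed[OF assms(1)] is_subgroup] by metis
qed

text \<open>As for classes of words, the elementwise image must exhaust a coset. For the reverse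
  inclusion the element of \<open>ncl\<close> is pulled back by the inverse of \<open>g\<close>,
  which again preserves \<open>ncl\<close>.\<close>

lemma gp_perm_coset:
  assumes g: "g \<in> carrier K" and c: "c \<in> carrier FP"
  shows "gp_perm \<alpha> g (coset c) = coset (fp_perm \<alpha> g c)"
proof (intro equalityI subsetI)
  have car: "n \<in> carrier FP" if "n \<in> ncl" for n
    using that by (rule mem_carrier)
  fix y assume "y \<in> gp_perm \<alpha> g (coset c)"
  then obtain n where "n \<in> ncl" "y = fp_perm \<alpha> g (n \<otimes>\<^bsub>FP\<^esub> c)"
    by (auto simp: gp_perm_def r_coset_def)
  then show "y \<in> coset (fp_perm \<alpha> g c)"
    using hom_mult[OF T.action_hom[OF g]] car c fp_perm_ncl[OF g] by (auto simp: r_coset_def)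
next
  have car: "n \<in> carrier FP" if "n \<in> ncl" for n
    using that by (rule mem_carrier)
  fix y assume "y \<in> coset (fp_perm \<alpha> g c)"
  then obtain n where n: "n \<in> ncl" "y = n \<otimes>\<^bsub>FP\<^esub> fp_perm \<alpha> g c"
    by (auto simp: r_coset_def)
  define m where "m = fp_perm \<alpha> (inv\<^bsub>K\<^esub> g) n"
  have m: "m \<in> ncl"
    unfolding m_def using g n by (intro fp_perm_ncl) auto
  have "fp_perm \<alpha> g m = n"
    using T.action_mult[of g "inv\<^bsub>K\<^esub> g" n] g car[OF n(1)] T.action_one by (simp add: m_def)
  then have "y = fp_perm \<alpha> g (m \<otimes>\<^bsub>FP\<^esub> c)"
    using hom_mult[OF T.action_hom[OF g]] car[OF m] c n by simp
  then show "y \<in> gp_perm \<alpha> g (coset c)"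
    using m by (auto simp: gp_perm_def r_coset_def)
qed

lemma hom_action_gp_perm: "hom_action GP K (gp_perm \<alpha>)"
proof (intro hom_action.intro hom_action_axioms.intro)
  have mult: "coset c \<otimes>\<^bsub>GP\<^esub> coset d = coset (c \<otimes>\<^bsub>FP\<^esub> d)" if "c \<in> carrier FP" "d \<in> carrier FP" for c d
    using hom_mult[OF coset_hom that] by simp
  fix g assume "g \<in> carrier K"
  then show "gp_perm \<alpha> g \<in> hom GP GP"
    by (intro homI) (auto simp: carrier_GP gp_perm_coset mult hom_mult[OF T.action_hom])
qed (auto simp: carrier_GP gp_perm_coset T.action_one T.action_mult GP.group_axioms T.K.group_axioms)

lemma gp_perm_incl:
  "\<lbrakk>g \<in> carrier K; x \<in> X; h \<in> carrier H\<rbrakk> \<Longrightarrow> gp_perm \<alpha> g (gp_incl x h) = gp_incl (\<alpha> g x) h"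
  by (simp add: gp_perm_coset fp_perm_incl)

end

lemma weakly_sofic_graph_wreath:
  fixes X :: "'x set" and H :: "('h, 'c) monoid_scheme" and H' :: "'u monoid" and \<iota> :: "'h \<Rightarrow> 'u"
    and e :: "nat \<Rightarrow> 'u"
  assumes \<Gamma>: "weakly_sofic (\<Gamma> :: ('g, 'd) monoid_scheme)" and \<alpha>: "sofic_graph_action \<Gamma> X D \<alpha>"
    and "group H" "group H'" and \<iota>: "\<iota> \<in> iso H H'" and e: "inj e"
    and graph: "\<And>B D'. finite B \<Longrightarrow> simple_graph (e ` B) D' \<Longrightarrow>
      weakly_sofic (graph_product (e ` B) D' (\<lambda>_. H'))"
  shows "weakly_sofic (graph_wreath \<Gamma> H X D \<alpha>)"
  unfolding graph_wreath_def
proof (rule weakly_sofic_semidirect_generated[where 'm = "('u \<times> 'u) list set set"])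
  show ga: "group_action \<Gamma> X \<alpha>"
    using \<alpha> by (simp add: sofic_graph_action_def graph_action_def)
  interpret graph_relabelling H \<Gamma> X \<alpha> D
    using \<alpha> by (simp add: graph_relabelling_def graph_relabelling_axioms_def relabelling_def ga assms(3) sofic_graph_action_def)
  show "hom_action GP \<Gamma> (gp_perm \<alpha>)"
    by (rule hom_action_gp_perm)
  show "carrier GP = generate GP (\<Union>x\<in>X. gp_incl x ` carrier H)"
    by (rule GP_generate)
  show "gp_incl x h \<in> carrier GP" if "x \<in> X" "h \<in> carrier H" for x h
    using that by simp
  show "gp_perm \<alpha> g (gp_incl x h) = gp_incl (\<alpha> g x) h"
    if "g \<in> carrier \<Gamma>" "x \<in> X" "h \<in> carrier H" for g x h
    using that by (rule gp_perm_incl)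
  fix F E and \<epsilon> :: real
  assume F: "finite F" "F \<subseteq> carrier \<Gamma>" and E: "finite E" "E \<subseteq> X" and "0 < \<epsilon>"
  then obtain A :: "nat set" and \<phi> where A: "finite A" "unital_multiplicative \<Gamma> F \<epsilon> A \<phi>"
      "graph_orbit_approx X D \<alpha> F E \<epsilon> A \<phi>"
    using \<alpha> unfolding sofic_graph_action_def by meson
  then obtain B :: "nat set" and DB S \<pi> where B: "finite B" "S \<subseteq> A" "real (card S) > (1 - \<epsilon>) * real (card A)"
    and DB: "simple_graph B DB"
    and \<pi>: "\<And>s. s \<in> S \<Longrightarrow> \<pi> s \<in> E \<rightarrow> B" "\<And>s. s \<in> S \<Longrightarrow> inj_on (\<pi> s) E"
      "\<And>s x y. \<lbrakk>s \<in> S; x \<in> E; y \<in> E\<rbrakk> \<Longrightarrow> (\<pi> s x, \<pi> s y) \<in> DB \<longleftrightarrow> (x, y) \<in> D"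
    and oc: "orbit_compatible X \<alpha> F E \<phi> S \<pi>"
    unfolding graph_orbit_approx_def by metis
  \<comment> \<open>The finite graph is moved along \<open>e\<close> to vertices in
    \<open>'u\<close>; injectivity of \<open>e\<close> keeps it free of loops and keeps adjacency
    unchanged.\<close>
  define D' where "D' = map_prod e e ` DB"
  have D'_iff: "(e a, e b) \<in> D' \<longleftrightarrow> (a, b) \<in> DB" for a b
    using e by (auto simp: D'_def inj_eq)
  have D': "simple_graph (e ` B) D'"
    using DB e by (auto simp: simple_graph_def D'_def irrefl_def sym_def inj_eq)
  interpret M: graph_family "e ` B" "\<lambda>_. H'" D'
    using D' assms(4)
    by (simp add: graph_family_def group_family_def graph_family_axioms_def simple_graph_def)
  define i where "i = (\<lambda>b h. M.gp_incl (e b) (\<iota> h))"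
  have "\<exists>p\<in>hom GP M.GP. \<exists>q\<in>hom M.GP GP. \<forall>x\<in>E. \<forall>h\<in>carrier H.
      p (gp_incl x h) = i (\<pi> s x) h \<and> q (i (\<pi> s x) h) = gp_incl x h" if s: "s \<in> S" for s
  proof -
    define f where "f = (\<lambda>x. e (\<pi> s x))"
    have f: "f \<in> E \<rightarrow> e ` B" "inj_on f E"
      using \<pi>(1,2)[OF s] e by (auto simp: f_def inj_on_def)
    have f_edge: "(f x, f y) \<in> D' \<longleftrightarrow> (x, y) \<in> D" if "x \<in> E" "y \<in> E" for x y
      using \<pi>(3)[OF s that] by (simp add: f_def D'_iff)
    have f': "inv_into E f \<in> f ` E \<rightarrow> X"
      using E by (auto intro!: subsetD[OF E(2)] inv_into_into)
    \<comment> \<open>This is where embeddings of induced subgraphs matter: that the inverse map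
      sends edges to edges is preservation of non-adjacency by \<open>\<pi> s\<close>.\<close>
    have f'_edge: "(inv_into E f a, inv_into E f b) \<in> D" if "a \<in> f ` E" "b \<in> f ` E" "(a, b) \<in> D'" for a b
      using that f(2) by (auto simp: f_edge)
    define \<kappa> where "\<kappa> = inv_into (carrier H) \<iota>"
    have \<kappa>: "\<kappa> \<in> iso H' H" "h \<in> carrier H \<Longrightarrow> \<kappa> (\<iota> h) = h" for h
      using \<iota> H.iso_set_sym[OF \<iota>] by (auto simp: \<kappa>_def iso_def bij_betw_def)
    obtain p where p: "p \<in> hom GP M.GP" "\<And>x h. \<lbrakk>x \<in> E; h \<in> carrier H\<rbrakk> \<Longrightarrow> p (gp_incl x h) = M.gp_incl (f x) (\<iota> h)"
      by (rule graph_product_partial_map[OF assms(3,4) iso_imp_homomorphism[OF \<iota>] f(1) E(2)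
            graph_family_axioms M.graph_family_axioms]) (use f_edge in blast, rule that)
    have fE: "f ` E \<subseteq> e ` B"
      using f(1) by auto
    obtain q where q: "q \<in> hom M.GP GP" "\<And>y k. \<lbrakk>y \<in> f ` E; k \<in> carrier H'\<rbrakk> \<Longrightarrow>
        q (M.gp_incl y k) = gp_incl (inv_into E f y) (\<kappa> k)"
      by (rule graph_product_partial_map[OF assms(4,3) iso_imp_homomorphism[OF \<kappa>(1)] f' fE
            M.graph_family_axioms graph_family_axioms f'_edge]) (assumption | rule that)+
    have "\<iota> h \<in> carrier H'" if "h \<in> carrier H" for h
      using \<iota> that by (auto simp: iso_def hom_def)
    then have "q (M.gp_incl (f x) (\<iota> h)) = gp_incl x h" if "x \<in> E" "h \<in> carrier H" for x h
      using q(2)[of "f x" "\<iota> h"] f(2) that \<kappa>(2) by simp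
    then show ?thesis
      using p q(1) by (intro bexI[of _ p] bexI[of _ q]) (auto simp: i_def f_def)
  qed
  then show "\<exists>(A :: nat set) \<phi> S (\<pi> :: nat \<Rightarrow> 'x \<Rightarrow> nat) (M :: ('u \<times> 'u) list set set monoid) i.
      finite A \<and> unital_multiplicative \<Gamma> F \<epsilon> A \<phi> \<and>
      S \<subseteq> A \<and> (1 - \<epsilon>) * real (card A) < real (card S) \<and>
      orbit_compatible X \<alpha> F E \<phi> S \<pi> \<and> weakly_sofic M \<and>
      (\<forall>s\<in>S. \<exists>p\<in>hom GP M. \<exists>q\<in>hom M GP. \<forall>x\<in>E. \<forall>h\<in>carrier H.
        p (gp_incl x h) = i (\<pi> s x) h \<and> q (i (\<pi> s x) h) = gp_incl x h)"
    using A B oc graph[OF B(1) D']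
    by - (rule exI[of _ A], rule exI[of _ \<phi>], rule exI[of _ S], rule exI[of _ \<pi>], rule exI[of _ M.GP], rule exI[of _ i],
        (intro conjI ballI impI; simp))
qed (rule \<Gamma>)

(* 'u is the universe over which the hypotheses of (b) and (c) quantify: their index sets, and the
   carriers of their groups, are arbitrary sets of elements of 'u. It is an arbitrary infinite type
   into which the elements of H embed. *)

theorem theorem6p17:
  fixes \<Gamma> :: "'g monoid" and H :: "'h monoid"
    and X :: "'x set" and \<alpha> :: "'g \<Rightarrow> 'x \<Rightarrow> 'x"
    and Y :: "'y set" and E :: "('y \<times> 'y) set" and \<beta> :: "'g \<Rightarrow> 'y \<Rightarrow> 'y"
    and \<iota> :: "'h \<Rightarrow> 'u"
  assumes "weakly_sofic \<Gamma>" and "weakly_sofic H"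
    and "sofic_action \<Gamma> X \<alpha>"
    and "sofic_graph_action \<Gamma> Y E \<beta>"
    and "infinite (UNIV :: 'u set)" and "inj \<iota>"
  shows "weakly_sofic (wreath H \<Gamma> X \<alpha>) \<and>
    ((\<forall>(V :: 'u set) (K :: 'u \<Rightarrow> 'u monoid).
        (\<forall>v\<in>V. weakly_sofic (K v)) \<longrightarrow> weakly_sofic (free_product V K)) \<longrightarrow>
      weakly_sofic (free_wreath H \<Gamma> X \<alpha>)) \<and>
    ((\<forall>(V :: 'u set) (K :: 'u \<Rightarrow> 'u monoid) (D :: ('u \<times> 'u) set).
        (\<forall>v\<in>V. weakly_sofic (K v)) \<and> simple_graph V D \<longrightarrow>
          weakly_sofic (graph_product V D K)) \<longrightarrow>
      weakly_sofic (graph_wreath \<Gamma> H Y E \<beta>))"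
proof -
  have H: "group H"
    using assms(2) by (simp add: weakly_sofic_def)
  \<comment> \<open>The hypotheses of (b) and (c) range over groups on \<open>'u\<close>, so
    \<open>H\<close> is replaced by an isomorphic copy there; its weak soficity follows by embedding
    it back into \<open>H\<close>.\<close>
  have "inj_on \<iota> (carrier H)"
    using assms(6) by (rule inj_on_subset) simp
  then obtain H' :: "'u monoid" where H': "group H'" and \<iota>: "\<iota> \<in> iso H H'"
    by (rule group_copy[OF H]) (rule that)
  have "inv_into (carrier H) \<iota> \<in> iso H' H"
    by (rule group.iso_set_sym[OF H \<iota>])
  then have sofic: "weakly_sofic H'"
    using weakly_sofic_embedding[OF H' assms(2)] by (auto simp: iso_def bij_betw_def)
  \<comment> \<open>Infinity of \<open>'u\<close> makes room for the vertex sets \<open>B\<close>,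
    which are finite sets of naturals of unbounded size.\<close>
  obtain e :: "nat \<Rightarrow> 'u" where e: "inj e"
    using infinite_countable_subset[OF assms(5)] by blast
  show ?thesis
  proof (intro conjI impI)
    show "weakly_sofic (wreath H \<Gamma> X \<alpha>)"
      by (rule weakly_sofic_wreath[OF assms(1-3)])
  next
    assume "\<forall>(V :: 'u set) (K :: 'u \<Rightarrow> 'u monoid).
        (\<forall>v\<in>V. weakly_sofic (K v)) \<longrightarrow> weakly_sofic (free_product V K)"
    then show "weakly_sofic (free_wreath H \<Gamma> X \<alpha>)"
      using sofic by (intro weakly_sofic_free_wreath[OF assms(1,3) H H' \<iota> e]) simp
  next
    assume "\<forall>(V :: 'u set) (K :: 'u \<Rightarrow> 'u monoid) (D :: ('u \<times> 'u) set).
        (\<forall>v\<in>V. weakly_sofic (K v)) \<and> simple_graph V D \<longrightarrow> weakly_sofic (graph_product V D K)"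
    then show "weakly_sofic (graph_wreath \<Gamma> H Y E \<beta>)"
      using sofic by (intro weakly_sofic_graph_wreath[OF assms(1,4) H H' \<iota> e]) simp
  qed
qed

end
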